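(* Let $s:M\to\mathscr{H}$ be a Sachs section with associated vector field $k$, metric $g_s$ of signature $(p,q)$, umbral bundle $K=k^\perp/\operatorname{span}k$ with metric $g_K$, and let $P_s|_K\in\operatorname{End}(K)$ be the endomorphism induced by $P_s$. Let $$P_s|_K=\operatorname{Alt}P_s|_K+\operatorname{Sym}_0P_s|_K+\frac{\operatorname{tr}P_s|_K}{n-2}\operatorname{Id}_K=\rho+\sigma+\frac{\theta}{n-2}\operatorname{Id}_K$$ be its decomposition into irreducible $O(p-1,q-1)$ components (the skew part, the trace-free symmetric part and the trace part with respect to $g_K$). Then $$k(\theta)=-\operatorname{tr}(\rho^2)-\operatorname{tr}(\sigma^2)-\frac{\theta^2}{n-2}+\operatorname{tr}S^\sharp.$$
   Context: Let $M$ be a smooth manifold of dimension $n\ge 3$, and $TM'$ its tangent bundle with the zero section removed, with local coordinates $(x^i,v^i)$ induced from coordinates $x^i$ on $M$. Let $VTM'=\ker d\pi_{TM'}$ be the vertical bundle, where $\pi_{TM'}:TM'\to M$, and $V^0TM'\subset T^*TM'$ its annihilator. Let $\lambda=dx^i\otimes\frac{\partial}{\partial v^i}\in\Gamma(\operatorname{End}(TTM'))$, with image and kernel $VTM'$, and let $\overline\lambda:\pi_{TM'}^{-1}TM\to VTM'$ be the isomorphism $\overline\lambda(\partial/\partial x^i)=\partial/\partial v^i$. For a function $f$ let $Df=\frac{\partial f}{\partial v^i}dx^i$. Let $\mathscr{H}\subset TM'$ be a smooth hypersurface, invariant under the scalings $(x,v)\mapsto(x,sv)$, $s>0$, projecting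 onto $M$ and meeting each fibre of $TM'$ in a smooth hypersurface of the fibre, given by $G=0$ where $G$ is a smooth function on an open scaling-invariant neighborhood of $\mathscr{H}$ in $TM'$ (over which we work) such that $DG\ne0$, $G(x,tv)=t^mG(x,v)$ for all $t>0$ with $m$ real, $m\ne1$, and $g_{ij}=\frac{\partial^2G}{\partial v^i\partial v^j}$ is nondegenerate. Let $\alpha=DG$ (and $d\alpha$ is symplectic), $g_h=g_{ij}\,dx^i\otimes dx^j$, and let $g_v$ be the bilinear form on $VTM'$ with $g_v(\partial/\partial v^i,\partial/\partial v^j)=g_{ij}$. Let $V$ be the vector field with $V\lrcorner\,d\alpha=-(m-1)\,dG$ (usual interior product); in coordinates $V=v^i\frac{\partial}{\partial x^i}+u^i\frac{\partial}{\partial v^i}$ with $u^ig_{ij}=\frac{\partial G}{\partial x^j}-v^i\frac{\partial^2G}{\partial x^i\partial v^j}$; it is tangent to $\mathscr{H}$ (the null geodesic spray). Let $P=\frac12(\operatorname{Id}+\mathscr{L}_V\lambda):TTM'\to VTM'$, where $(\mathscr{L}_V\lambda)(X)=[V,\lambda X]-\lambda[V,X]$. The tidal force tensor is the symmetric section $S$ of $V^0TM'\otimes V^0TM'$ determined by $\frac12(\mathscr{L}_V^2g_h)(X,Y)=g_v(PX,PY)+S(X,Y)$ for all $X,Y$. A continuous surjection $q:Y\to X$ of Hausdorff spaces is a branched cover if the set of points of $Y$ having an open neighborhood that $q$ maps homeomorphically onto an open subset of $X$ is dense in $Y$. An affine Sachs manifold is an $n$-dimensional smooth submanifold $\mathcal{T}\subset\mathscr{H}$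 such that the projection $\mathcal{T}\to M$ is a branched cover, $V$ is everywhere tangent to $\mathcal{T}$, and $\alpha\wedge d\alpha$ restricts to zero on $\mathcal{T}$. A Sachs section over an open set $U\subset M$ is a (smooth) section $s:U\to\mathcal{T}$ of the projection $\mathcal{T}\to M$ over $U$, where $\mathcal{T}$ is an affine Sachs manifold; here $U=M$. Given a Sachs section $s$, let $k$ be the vector field on $M$ with $s_*k=V$ along $s$ (so $k(x)=s(x)$ as a tangent vector). Let $g_s=s^*g_h$, a pseudo-Riemannian metric on $M$ for which $g_s(k,k)=0$; let $k^\perp$ be the $g_s$-orthogonal complement of $k$, $K=k^\perp/\operatorname{span}k$ (isomorphic to the pullback by $s$ of the umbral bundle $E$ of $\mathscr{H}$), and $g_K$ the metric induced on $K$ by $g_s$, of signature $(p-1,q-1)$. Let $P_s\in\operatorname{End}(TM)$ be $P_s(X)=\overline\lambda^{-1}P(s_*X)$; it kills $k$ and has image in $k^\perp$, so induces $P_s|_K\in\operatorname{End}(K)$. Let $S^\sharp\in\operatorname{End}(TM)$ be defined by $g_s(S^\sharp X,Y)=S(s_*X,s_*Y)$; its image lies in $k^\perp$, it kills $k$, and it has the same trace as the endomorphism it induces on $K$. *)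

theory Defs
  imports "HOL-Analysis.Analysis"
begin

section \<open>Smooth maps and submanifolds of Euclidean spaces\<close>

abbreviation dirder :: "('a::real_normed_vector \<Rightarrow> 'b::real_normed_vector) \<Rightarrow> 'a \<Rightarrow> 'a \<Rightarrow> 'b"
  where "dirder f z w \<equiv> frechet_derivative f (at z) w"

text \<open>Meant for open \<open>S\<close> only.\<close>

primrec ck_on :: "nat \<Rightarrow> 'a::euclidean_space set \<Rightarrow> ('a \<Rightarrow> 'b::real_normed_vector) \<Rightarrow> bool" where
  "ck_on 0 S f \<longleftrightarrow> continuous_on S f"
| "ck_on (Suc k) S f \<longleftrightarrow>
     (\<forall>x\<in>S. f differentiable (at x)) \<and> (\<forall>w. ck_on k S (\<lambda>x. dirder f x w))"

definition smooth_on :: "'a::euclidean_space set \<Rightarrow> ('a \<Rightarrow> 'b::real_normed_vector) \<Rightarrow> bool" where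
  "smooth_on S f \<longleftrightarrow> (\<forall>k. ck_on k S f)"

definition diffeomorphic_on :: "'a::euclidean_space set \<Rightarrow> ('a \<Rightarrow> 'a) \<Rightarrow> bool" where
  "diffeomorphic_on U \<phi> \<longleftrightarrow> open U \<and> open (\<phi> ` U) \<and> inj_on \<phi> U \<and>
     smooth_on U \<phi> \<and> smooth_on (\<phi> ` U) (inv_into U \<phi>)"

text \<open>Embedded submanifolds, by slice charts.\<close>

definition submanifold :: "nat \<Rightarrow> 'a::euclidean_space set \<Rightarrow> bool" where
  "submanifold d S \<longleftrightarrow>
     (\<forall>z\<in>S. \<exists>U \<phi> L. z \<in> U \<and> diffeomorphic_on U \<phi> \<and> subspace L \<and> dim L = d \<and>
        \<phi> ` (S \<inter> U) = \<phi> ` U \<inter> L)"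

definition tangent_space :: "'a::euclidean_space set \<Rightarrow> 'a \<Rightarrow> 'a set" where
  "tangent_space S z =
     {w. \<exists>e>0. \<exists>\<gamma>::real \<Rightarrow> 'a. smooth_on {-e<..<e} \<gamma> \<and> \<gamma> ` {-e<..<e} \<subseteq> S \<and> \<gamma> 0 = z \<and>
           (\<gamma> has_vector_derivative w) (at 0)}"


section \<open>Smooth manifolds and their tangent bundles\<close>

text \<open>A chart is a pair of its domain and its coordinate map; the values of the
  coordinate map outside the domain are irrelevant.\<close>

type_synonym ('a, 'n) chart = "'a set \<times> ('a \<Rightarrow> real ^ 'n)"

abbreviation chart_image :: "('a, 'n) chart \<Rightarrow> (real ^ 'n) set" where
  "chart_image c \<equiv> snd c ` fst c"

definition chart_inv :: "('a, 'n) chart \<Rightarrow> real ^ 'n \<Rightarrow> 'a" where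
  "chart_inv c = inv_into (fst c) (snd c)"

definition transition :: "('a, 'n) chart \<Rightarrow> ('a, 'n) chart \<Rightarrow> real ^ 'n \<Rightarrow> real ^ 'n" where
  "transition c d = snd d \<circ> chart_inv c"

definition is_chart :: "'a topology \<Rightarrow> ('a, 'n::finite) chart \<Rightarrow> bool" where
  "is_chart M c \<longleftrightarrow> openin M (fst c) \<and> open (chart_image c) \<and>
     homeomorphic_map (subtopology M (fst c)) (top_of_set (chart_image c)) (snd c)"

definition smooth_manifold :: "'a topology \<Rightarrow> ('a, 'n::finite) chart set \<Rightarrow> bool" where
  "smooth_manifold M A \<longleftrightarrow> Hausdorff_space M \<and> second_countable M \<and>
     (\<forall>c\<in>A. is_chart M c) \<and> (\<Union>c\<in>A. fst c) = topspace M \<and>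
     (\<forall>c\<in>A. \<forall>d\<in>A. smooth_on (snd c ` (fst c \<inter> fst d)) (transition c d))"

text \<open>A tangent vector at \<open>p\<close> is the family of its components in all charts around \<open>p\<close>,
  which transform by the Jacobians of the transition maps (and are set to zero for the other
  indices, so that each tangent vector has exactly one representation).\<close>

type_synonym ('a, 'n) tvector = "'a \<times> (('a, 'n) chart \<Rightarrow> real ^ 'n)"

definition tangent_bundle :: "'a topology \<Rightarrow> ('a, 'n::finite) chart set \<Rightarrow> ('a, 'n) tvector set" where
  "tangent_bundle M A = {(p, \<xi>). p \<in> topspace M \<and>
     (\<forall>c\<in>A. \<forall>d\<in>A. p \<in> fst c \<and> p \<in> fst d \<longrightarrow> \<xi> d = dirder (transition c d) (snd c p) (\<xi> c)) \<and>
     (\<forall>c. \<not> (c \<in> A \<and> p \<in> fst c) \<longrightarrow> \<xi> c = 0)}"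

definition slit_tangent_bundle :: "'a topology \<Rightarrow> ('a, 'n::finite) chart set \<Rightarrow> ('a, 'n) tvector set" where
  "slit_tangent_bundle M A = {z \<in> tangent_bundle M A. snd z \<noteq> (\<lambda>_. 0)}"

definition scale_tvector :: "real \<Rightarrow> ('a, 'n::finite) tvector \<Rightarrow> ('a, 'n) tvector" where
  "scale_tvector t z = (fst z, \<lambda>c. t *\<^sub>R snd z c)"

text \<open>The induced coordinates \<open>(x, v)\<close> on the tangent bundle, and their inverse.\<close>

definition tb_coord :: "('a, 'n) chart \<Rightarrow> ('a, 'n) tvector \<Rightarrow> (real ^ 'n) \<times> (real ^ 'n)" where
  "tb_coord c z = (snd c (fst z), snd z c)"

definition tb_point ::
    "('a, 'n::finite) chart set \<Rightarrow> ('a, 'n) chart \<Rightarrow> (real ^ 'n) \<times> (real ^ 'n) \<Rightarrow> ('a, 'n) tvector" where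
  "tb_point A c = (\<lambda>(x, v). let p = chart_inv c x in
     (p, \<lambda>d. if d \<in> A \<and> p \<in> fst d then dirder (transition c d) x v else 0))"

text \<open>The coordinate expression of a subset \<open>Z\<close> of the tangent bundle.\<close>

definition tb_set ::
    "('a, 'n::finite) chart set \<Rightarrow> ('a, 'n) chart \<Rightarrow> ('a, 'n) tvector set \<Rightarrow> ((real ^ 'n) \<times> (real ^ 'n)) set" where
  "tb_set A c Z = {z \<in> chart_image c \<times> UNIV. tb_point A c z \<in> Z}"

definition tb_topology :: "'a topology \<Rightarrow> ('a, 'n::finite) chart set \<Rightarrow> ('a, 'n) tvector topology" where
  "tb_topology M A =
     topology (\<lambda>Z. Z \<subseteq> tangent_bundle M A \<and> (\<forall>c\<in>A. open (tb_set A c Z)))"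

lemma openin_tb_topology:
  "openin (tb_topology M A) Z \<longleftrightarrow> Z \<subseteq> tangent_bundle M A \<and> (\<forall>c\<in>A. open (tb_set A c Z))"
proof -
  have "tb_set A c (Y \<inter> Z) = tb_set A c Y \<inter> tb_set A c Z" for c Y Z
    by (auto simp: tb_set_def)
  moreover have "tb_set A c (\<Union>\<K>) = (\<Union>Z\<in>\<K>. tb_set A c Z)" for c \<K>
    by (auto simp: tb_set_def)
  ultimately have "istopology (\<lambda>Z. Z \<subseteq> tangent_bundle M A \<and> (\<forall>c\<in>A. open (tb_set A c Z)))"
    unfolding istopology_def by (auto intro!: open_Int open_UN)
  then show ?thesis
    by (simp add: tb_topology_def topology_inverse')
qed


section \<open>Tensor calculus on open subsets of Euclidean spaces\<close>

text \<open>Vector fields are functions \<open>'a \<Rightarrow> 'a\<close>; tensor fields have the point as first argument.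
  Exterior and Lie derivatives are evaluated on vectors extended to constant vector fields, which
  is harmless as the results are tensorial. The exterior derivative is normalized by
  \<open>d\<alpha>(X,Y) = X \<alpha>(Y) - Y \<alpha>(X) - \<alpha>([X,Y])\<close>.\<close>

definition lie_bracket :: "('a::real_normed_vector \<Rightarrow> 'a) \<Rightarrow> ('a \<Rightarrow> 'a) \<Rightarrow> 'a \<Rightarrow> 'a" where
  "lie_bracket X Y z = dirder Y z (X z) - dirder X z (Y z)"

definition ext_d :: "('a::real_normed_vector \<Rightarrow> 'a \<Rightarrow> real) \<Rightarrow> 'a \<Rightarrow> 'a \<Rightarrow> 'a \<Rightarrow> real" where
  "ext_d \<alpha> z X Y = dirder (\<lambda>y. \<alpha> y Y) z X - dirder (\<lambda>y. \<alpha> y X) z Y"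

definition lie_endo ::
    "('a::real_normed_vector \<Rightarrow> 'a) \<Rightarrow> ('a \<Rightarrow> 'a \<Rightarrow> 'a) \<Rightarrow> 'a \<Rightarrow> 'a \<Rightarrow> 'a" where
  "lie_endo V L z X = lie_bracket V (\<lambda>y. L y X) z - L z (lie_bracket V (\<lambda>_. X) z)"

definition lie_form ::
    "('a::real_normed_vector \<Rightarrow> 'a) \<Rightarrow> ('a \<Rightarrow> 'a \<Rightarrow> 'a \<Rightarrow> real) \<Rightarrow> 'a \<Rightarrow> 'a \<Rightarrow> 'a \<Rightarrow> real" where
  "lie_form V h z X Y = dirder (\<lambda>y. h y X Y) z (V z)
     - h z (lie_bracket V (\<lambda>_. X) z) Y - h z X (lie_bracket V (\<lambda>_. Y) z)"

definition wedge_1_2 :: "('a \<Rightarrow> real) \<Rightarrow> ('a \<Rightarrow> 'a \<Rightarrow> real) \<Rightarrow> 'a \<Rightarrow> 'a \<Rightarrow> 'a \<Rightarrow> real" where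
  "wedge_1_2 \<alpha> \<omega> X Y Z = \<alpha> X * \<omega> Y Z + \<alpha> Y * \<omega> Z X + \<alpha> Z * \<omega> X Y"


section \<open>Geometry of the tangent bundle in induced coordinates\<close>

text \<open>Below, \<open>F\<close> is a function of the induced coordinates \<open>(x, v)\<close>, later the coordinate
  expression of \<open>G\<close>; a tangent vector of the tangent bundle is a pair \<open>(\<xi>, \<eta>)\<close> standing for
  \<open>\<xi>\<^sup>i \<partial>/\<partial>x\<^sup>i + \<eta>\<^sup>i \<partial>/\<partial>v\<^sup>i\<close>.\<close>

type_synonym 'n pt = "(real ^ 'n) \<times> (real ^ 'n)"

definition pdv :: "'n::finite \<Rightarrow> ('n pt \<Rightarrow> real) \<Rightarrow> 'n pt \<Rightarrow> real" where
  "pdv i F z = dirder F z (0, axis i 1)"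

definition Dv :: "('n::finite pt \<Rightarrow> real) \<Rightarrow> 'n pt \<Rightarrow> 'n pt \<Rightarrow> real" where
  "Dv F z X = (\<Sum>i\<in>UNIV. pdv i F z * fst X $ i)"

definition fibre_hessian :: "('n::finite pt \<Rightarrow> real) \<Rightarrow> 'n pt \<Rightarrow> real ^ 'n ^ 'n" where
  "fibre_hessian F z = (\<chi> i j. pdv i (pdv j F) z)"

definition g_h :: "('n::finite pt \<Rightarrow> real) \<Rightarrow> 'n pt \<Rightarrow> 'n pt \<Rightarrow> 'n pt \<Rightarrow> real" where
  "g_h F z X Y = (\<Sum>i\<in>UNIV. \<Sum>j\<in>UNIV. fibre_hessian F z $ i $ j * fst X $ i * fst Y $ j)"

text \<open>Only meant for vertical \<open>X\<close> and \<open>Y\<close>.\<close>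

definition g_v :: "('n::finite pt \<Rightarrow> real) \<Rightarrow> 'n pt \<Rightarrow> 'n pt \<Rightarrow> 'n pt \<Rightarrow> real" where
  "g_v F z X Y = (\<Sum>i\<in>UNIV. \<Sum>j\<in>UNIV. fibre_hessian F z $ i $ j * snd X $ i * snd Y $ j)"

definition lam :: "'n::finite pt \<Rightarrow> 'n pt \<Rightarrow> 'n pt" where
  "lam z X = (0, fst X)"

definition lam_bar :: "real ^ 'n::finite \<Rightarrow> 'n pt" where
  "lam_bar \<xi> = (0, \<xi>)"

text \<open>With \<open>\<alpha> = Dv F\<close>: the vector field \<open>V\<close> with \<open>V \<lrcorner> d\<alpha> = -(m - 1) dF\<close>, unique where the
  fibre Hessian is nondegenerate.\<close>

definition spray :: "('n::finite pt \<Rightarrow> real) \<Rightarrow> real \<Rightarrow> 'n pt \<Rightarrow> 'n pt" where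
  "spray F m z = (THE V. \<forall>Y. ext_d (Dv F) z V Y = - (m - 1) * dirder F z Y)"

definition vert_proj :: "('n::finite pt \<Rightarrow> real) \<Rightarrow> real \<Rightarrow> 'n pt \<Rightarrow> 'n pt \<Rightarrow> 'n pt" where
  "vert_proj F m z X = (1/2) *\<^sub>R (X + lie_endo (spray F m) lam z X)"

definition tidal :: "('n::finite pt \<Rightarrow> real) \<Rightarrow> real \<Rightarrow> 'n pt \<Rightarrow> 'n pt \<Rightarrow> 'n pt \<Rightarrow> real" where
  "tidal F m z X Y = 1/2 * lie_form (spray F m) (lie_form (spray F m) (g_h F)) z X Y
     - g_v F z (vert_proj F m z X) (vert_proj F m z Y)"


section \<open>The hypersurface, affine Sachs manifolds and Sachs sections\<close>

definition local_G ::
    "('a, 'n::finite) chart set \<Rightarrow> (('a, 'n) tvector \<Rightarrow> real) \<Rightarrow> ('a, 'n) chart \<Rightarrow> 'n pt \<Rightarrow> real" where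
  "local_G A G c = G \<circ> tb_point A c"

text \<open>\<open>W\<close> is the open neighborhood of \<open>H\<close> on which \<open>G\<close> is considered.\<close>

definition null_hypersurface ::
    "'a topology \<Rightarrow> ('a, 'n::finite) chart set \<Rightarrow> ('a, 'n) tvector set \<Rightarrow>
     (('a, 'n) tvector \<Rightarrow> real) \<Rightarrow> real \<Rightarrow> ('a, 'n) tvector set \<Rightarrow> bool" where
  "null_hypersurface M A W G m H \<longleftrightarrow>
     openin (tb_topology M A) W \<and> W \<subseteq> slit_tangent_bundle M A \<and>
     (\<forall>z\<in>W. \<forall>t>0. scale_tvector t z \<in> W) \<and>
     H = {z \<in> W. G z = 0} \<and>
     (\<forall>z\<in>H. \<forall>t>0. scale_tvector t z \<in> H) \<and>
     fst ` H = topspace M \<and>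
     (\<forall>c\<in>A. submanifold (2 * CARD('n) - 1) (tb_set A c H)) \<and>
     (\<forall>c\<in>A. \<forall>x\<in>chart_image c. submanifold (CARD('n) - 1) {v. (x, v) \<in> tb_set A c H}) \<and>
     (\<forall>c\<in>A. smooth_on (tb_set A c W) (local_G A G c)) \<and>
     (\<forall>c\<in>A. \<forall>z\<in>tb_set A c W. \<exists>X. Dv (local_G A G c) z X \<noteq> 0) \<and>
     m \<noteq> 1 \<and> (\<forall>z\<in>W. \<forall>t>0. G (scale_tvector t z) = t powr m * G z) \<and>
     (\<forall>c\<in>A. \<forall>z\<in>tb_set A c W. det (fibre_hessian (local_G A G c) z) \<noteq> 0)"

definition branched_cover :: "'b topology \<Rightarrow> 'a topology \<Rightarrow> ('b \<Rightarrow> 'a) \<Rightarrow> bool" where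
  "branched_cover Y X q \<longleftrightarrow> Hausdorff_space Y \<and> Hausdorff_space X \<and>
     continuous_map Y X q \<and> q ` topspace Y = topspace X \<and>
     Y closure_of {y. \<exists>N. openin Y N \<and> y \<in> N \<and> openin X (q ` N) \<and>
                    homeomorphic_map (subtopology Y N) (subtopology X (q ` N)) q} = topspace Y"

definition affine_sachs_manifold ::
    "'a topology \<Rightarrow> ('a, 'n::finite) chart set \<Rightarrow> (('a, 'n) tvector \<Rightarrow> real) \<Rightarrow> real \<Rightarrow>
     ('a, 'n) tvector set \<Rightarrow> ('a, 'n) tvector set \<Rightarrow> bool" where
  "affine_sachs_manifold M A G m H T \<longleftrightarrow>
     T \<subseteq> H \<and>
     (\<forall>c\<in>A. submanifold CARD('n) (tb_set A c T)) \<and>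
     branched_cover (subtopology (tb_topology M A) T) M fst \<and>
     (\<forall>c\<in>A. \<forall>z\<in>tb_set A c T. spray (local_G A G c) m z \<in> tangent_space (tb_set A c T) z) \<and>
     (\<forall>c\<in>A. \<forall>z\<in>tb_set A c T.
        \<forall>X\<in>tangent_space (tb_set A c T) z. \<forall>Y\<in>tangent_space (tb_set A c T) z.
        \<forall>Z\<in>tangent_space (tb_set A c T) z.
          wedge_1_2 (Dv (local_G A G c) z) (ext_d (Dv (local_G A G c)) z) X Y Z = 0)"

definition local_section ::
    "('a \<Rightarrow> ('a, 'n) tvector) \<Rightarrow> ('a, 'n) chart \<Rightarrow> real ^ 'n \<Rightarrow> (real ^ 'n) \<times> (real ^ 'n)" where
  "local_section s c x = tb_coord c (s (chart_inv c x))"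

definition sachs_section ::
    "'a topology \<Rightarrow> ('a, 'n::finite) chart set \<Rightarrow> ('a, 'n) tvector set \<Rightarrow>
     ('a \<Rightarrow> ('a, 'n) tvector) \<Rightarrow> bool" where
  "sachs_section M A T s \<longleftrightarrow>
     (\<forall>p\<in>topspace M. s p \<in> T \<and> fst (s p) = p) \<and>
     (\<forall>c\<in>A. smooth_on (chart_image c) (local_section s c))"


section \<open>Endomorphisms of quotient spaces\<close>

text \<open>For subspaces \<open>N \<subseteq> V\<close> the elements of \<open>V/N\<close> are cosets of \<open>N\<close>. Operations on the
  quotient are given by representatives; \<open>rep C\<close> is an arbitrary element of \<open>C\<close>.\<close>

definition coset :: "'a::real_vector set \<Rightarrow> 'a \<Rightarrow> 'a set" where
  "coset N v = {v + w |w. w \<in> N}"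

definition rep :: "'a set \<Rightarrow> 'a" where
  "rep C = (SOME v. v \<in> C)"

definition quot :: "'a::real_vector set \<Rightarrow> 'a set \<Rightarrow> 'a set set" where
  "quot V N = coset N ` V"

definition q_lincomb :: "'a::real_vector set \<Rightarrow> 'a set set \<Rightarrow> ('a set \<Rightarrow> real) \<Rightarrow> 'a set" where
  "q_lincomb N B r = coset N (\<Sum>b\<in>B. r b *\<^sub>R rep b)"

definition q_basis :: "'a::real_vector set \<Rightarrow> 'a set \<Rightarrow> 'a set set \<Rightarrow> bool" where
  "q_basis V N B \<longleftrightarrow> finite B \<and> B \<subseteq> quot V N \<and>
     (\<forall>C\<in>quot V N. \<exists>!r. (\<forall>b. b \<notin> B \<longrightarrow> r b = 0) \<and> C = q_lincomb N B r)"

definition q_coord :: "'a::real_vector set \<Rightarrow> 'a set set \<Rightarrow> 'a set \<Rightarrow> 'a set \<Rightarrow> real" where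
  "q_coord N B C = (THE r. (\<forall>b. b \<notin> B \<longrightarrow> r b = 0) \<and> C = q_lincomb N B r)"

definition q_trace :: "'a::real_vector set \<Rightarrow> 'a set \<Rightarrow> ('a set \<Rightarrow> 'a set) \<Rightarrow> real" where
  "q_trace V N E = (let B = (SOME B. q_basis V N B) in \<Sum>b\<in>B. q_coord N B (E b) b)"

definition q_lin2 :: "'a::real_vector set \<Rightarrow> real \<Rightarrow> ('a set \<Rightarrow> 'a set) \<Rightarrow> real \<Rightarrow> ('a set \<Rightarrow> 'a set) \<Rightarrow> 'a set \<Rightarrow> 'a set" where
  "q_lin2 N a E b E' C = coset N (a *\<^sub>R rep (E C) + b *\<^sub>R rep (E' C))"

definition q_endo :: "'a::real_vector set \<Rightarrow> ('a \<Rightarrow> 'a) \<Rightarrow> 'a set \<Rightarrow> 'a set" where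
  "q_endo N L C = coset N (L (rep C))"

definition q_form :: "('a \<Rightarrow> 'a \<Rightarrow> real) \<Rightarrow> 'a set \<Rightarrow> 'a set \<Rightarrow> real" where
  "q_form g C D = g (rep C) (rep D)"

text \<open>Adjoint and decomposition with respect to a nondegenerate symmetric form \<open>h\<close> on the
  quotient; \<open>d\<close> is the dimension of the quotient.\<close>

definition q_adjoint ::
    "'a::real_vector set \<Rightarrow> 'a set \<Rightarrow> ('a set \<Rightarrow> 'a set \<Rightarrow> real) \<Rightarrow> ('a set \<Rightarrow> 'a set) \<Rightarrow> 'a set \<Rightarrow> 'a set" where
  "q_adjoint V N h E D = (THE D'. D' \<in> quot V N \<and> (\<forall>C\<in>quot V N. h (E C) D = h C D'))"

definition q_alt ::
    "'a::real_vector set \<Rightarrow> 'a set \<Rightarrow> ('a set \<Rightarrow> 'a set \<Rightarrow> real) \<Rightarrow> ('a set \<Rightarrow> 'a set) \<Rightarrow> 'a set \<Rightarrow> 'a set" where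
  "q_alt V N h E = q_lin2 N (1/2) E (-1/2) (q_adjoint V N h E)"

definition q_sym ::
    "'a::real_vector set \<Rightarrow> 'a set \<Rightarrow> ('a set \<Rightarrow> 'a set \<Rightarrow> real) \<Rightarrow> ('a set \<Rightarrow> 'a set) \<Rightarrow> 'a set \<Rightarrow> 'a set" where
  "q_sym V N h E = q_lin2 N (1/2) E (1/2) (q_adjoint V N h E)"

definition q_sym0 ::
    "'a::real_vector set \<Rightarrow> 'a set \<Rightarrow> ('a set \<Rightarrow> 'a set \<Rightarrow> real) \<Rightarrow> real \<Rightarrow> ('a set \<Rightarrow> 'a set) \<Rightarrow> 'a set \<Rightarrow> 'a set" where
  "q_sym0 V N h d E = q_lin2 N 1 (q_sym V N h E) (- (q_trace V N E / d)) id"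


section \<open>Objects associated with a section\<close>

text \<open>Here \<open>f\<close> is the coordinate expression \<open>x \<mapsto> (x, v(x))\<close> of a section of the tangent bundle
  and \<open>F\<close> that of \<open>G\<close>. The results are the coordinate expressions of the corresponding objects
  on the chart domain.\<close>

definition assoc_field ::
    "('n::finite pt \<Rightarrow> real) \<Rightarrow> real \<Rightarrow> (real ^ 'n \<Rightarrow> 'n pt) \<Rightarrow> real ^ 'n \<Rightarrow> real ^ 'n" where
  "assoc_field F m f x = (THE k. dirder f x k = spray F m (f x))"

definition g_s ::
    "('n::finite pt \<Rightarrow> real) \<Rightarrow> (real ^ 'n \<Rightarrow> 'n pt) \<Rightarrow> real ^ 'n \<Rightarrow> real ^ 'n \<Rightarrow> real ^ 'n \<Rightarrow> real" where
  "g_s F f x X Y = g_h F (f x) (dirder f x X) (dirder f x Y)"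

definition has_signature :: "(real ^ 'n \<Rightarrow> real ^ 'n \<Rightarrow> real) \<Rightarrow> nat \<Rightarrow> nat \<Rightarrow> bool" where
  "has_signature g p q \<longleftrightarrow>
     (\<exists>e::'n::finite \<Rightarrow> real ^ 'n. inj e \<and> independent (range e) \<and>
        (\<forall>i j. i \<noteq> j \<longrightarrow> g (e i) (e j) = 0) \<and>
        (\<forall>i. g (e i) (e i) = 1 \<or> g (e i) (e i) = -1) \<and>
        card {i. g (e i) (e i) = 1} = p \<and> card {i. g (e i) (e i) = -1} = q)"

definition P_s ::
    "('n::finite pt \<Rightarrow> real) \<Rightarrow> real \<Rightarrow> (real ^ 'n \<Rightarrow> 'n pt) \<Rightarrow> real ^ 'n \<Rightarrow> real ^ 'n \<Rightarrow> real ^ 'n" where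
  "P_s F m f x X = inv lam_bar (vert_proj F m (f x) (dirder f x X))"

definition S_sharp ::
    "('n::finite pt \<Rightarrow> real) \<Rightarrow> real \<Rightarrow> (real ^ 'n \<Rightarrow> 'n pt) \<Rightarrow> real ^ 'n \<Rightarrow> real ^ 'n \<Rightarrow> real ^ 'n" where
  "S_sharp F m f x X =
     (THE Z. \<forall>Y. g_s F f x Z Y = tidal F m (f x) (dirder f x X) (dirder f x Y))"

definition k_perp ::
    "('n::finite pt \<Rightarrow> real) \<Rightarrow> real \<Rightarrow> (real ^ 'n \<Rightarrow> 'n pt) \<Rightarrow> real ^ 'n \<Rightarrow> (real ^ 'n) set" where
  "k_perp F m f x = {X. g_s F f x (assoc_field F m f x) X = 0}"

definition k_span ::
    "('n::finite pt \<Rightarrow> real) \<Rightarrow> real \<Rightarrow> (real ^ 'n \<Rightarrow> 'n pt) \<Rightarrow> real ^ 'n \<Rightarrow> (real ^ 'n) set" where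
  "k_span F m f x = span {assoc_field F m f x}"

definition g_K ::
    "('n::finite pt \<Rightarrow> real) \<Rightarrow> (real ^ 'n \<Rightarrow> 'n pt) \<Rightarrow> real ^ 'n \<Rightarrow>
     (real ^ 'n) set \<Rightarrow> (real ^ 'n) set \<Rightarrow> real" where
  "g_K F f x = q_form (g_s F f x)"

definition P_K ::
    "('n::finite pt \<Rightarrow> real) \<Rightarrow> real \<Rightarrow> (real ^ 'n \<Rightarrow> 'n pt) \<Rightarrow> real ^ 'n \<Rightarrow>
     (real ^ 'n) set \<Rightarrow> (real ^ 'n) set" where
  "P_K F m f x = q_endo (k_span F m f x) (P_s F m f x)"

definition tr_K ::
    "('n::finite pt \<Rightarrow> real) \<Rightarrow> real \<Rightarrow> (real ^ 'n \<Rightarrow> 'n pt) \<Rightarrow> real ^ 'n \<Rightarrow>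
     ((real ^ 'n) set \<Rightarrow> (real ^ 'n) set) \<Rightarrow> real" where
  "tr_K F m f x = q_trace (k_perp F m f x) (k_span F m f x)"

definition rot ::
    "('n::finite pt \<Rightarrow> real) \<Rightarrow> real \<Rightarrow> (real ^ 'n \<Rightarrow> 'n pt) \<Rightarrow> real ^ 'n \<Rightarrow>
     (real ^ 'n) set \<Rightarrow> (real ^ 'n) set" where
  "rot F m f x = q_alt (k_perp F m f x) (k_span F m f x) (g_K F f x) (P_K F m f x)"

definition shear ::
    "('n::finite pt \<Rightarrow> real) \<Rightarrow> real \<Rightarrow> (real ^ 'n \<Rightarrow> 'n pt) \<Rightarrow> real ^ 'n \<Rightarrow>
     (real ^ 'n) set \<Rightarrow> (real ^ 'n) set" where
  "shear F m f x = q_sym0 (k_perp F m f x) (k_span F m f x) (g_K F f x)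
     (real CARD('n) - 2) (P_K F m f x)"

definition expansion ::
    "('n::finite pt \<Rightarrow> real) \<Rightarrow> real \<Rightarrow> (real ^ 'n \<Rightarrow> 'n pt) \<Rightarrow> real ^ 'n \<Rightarrow> real" where
  "expansion F m f x = tr_K F m f x (P_K F m f x)"

end

theory Submission
  imports Defs
begin

text \<open>
  In a chart put \<open>z = (x, v)\<close>. Differentiating \<open>u\<^sup>i g\<^sub>i\<^sub>j = \<partial>G/\<partial>x\<^sup>j - v\<^sup>i \<partial>\<^sup>2G/\<partial>x\<^sup>i\<partial>v\<^sup>j\<close> along the
  fibre gives \<open>V(g\<^sub>i\<^sub>j)\<close> as the symmetrization of \<open>-\<partial>u\<^sub>i/\<partial>v\<^sup>j\<close>, which says that the Lie derivative
  of \<open>g\<^sub>h\<close> along \<open>V\<close> is \<open>g(P X, Y) + g(X, P Y)\<close>. The tangent space of an affine Sachs manifold at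
  \<open>s(x)\<close> has dimension \<open>n\<close> and contains the image of \<open>ds\<close>, so it equals that image, and \<open>V\<close> being
  tangent means that \<open>V\<close> is \<open>s\<close>-related to \<open>k\<close>. Hence Lie derivatives along \<open>V\<close> pull back to Lie
  derivatives along \<open>k\<close>, and with \<open>B = P\<^sub>s\<close> the pullback of \<open>S\<close> is the \<open>g\<^sub>s\<close>-symmetric part of
  \<open>L\<^sub>k B + B\<^sup>2\<close>. Taking traces, \<open>k(tr B) = - tr B\<^sup>2 + tr S\<^sup>\<sharp>\<close>. By Euler's identities \<open>B\<close> kills \<open>k\<close>
  and maps into \<open>k\<^sup>\<bottom>\<close>, so these traces can be taken on \<open>K\<close>; there \<open>B\<^sup>2\<close> is decomposed using that
  \<open>\<rho>\<close>, \<open>\<sigma>\<close> and the identity are trace-orthogonal.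
\<close>

section \<open>Calculus of smooth maps\<close>

text \<open>Two cancellations produce the trace formula. Once the first Lie derivative of the metric
  along \<open>k\<close> is \<open>g_s(B X, Y) + g_s(X, B Y)\<close>, the second one contains
  \<open>2 g_s(B X, B Y)\<close>; after the factor 1/2 this is exactly the term
  \<open>g_v(P X, P Y)\<close> subtracted in the definition of S. The Lie derivative of
  \<open>B\<close> differs from the entrywise derivative by a commutator with the Jacobian of
  \<open>k\<close>, which has trace zero, and symmetrization does not change a trace. The quotient K
  consists of cosets handled through arbitrary representatives, so the computation is kept on the
  whole tangent space. A matrix that kills \<open>k\<close> and maps into the orthogonal complement
  of \<open>k\<close> has no diagonal contribution along \<open>k\<close> or along a transversal to
  that complement, hence the same trace on K. The identity is not of this kind: it is carried as a
  separate scalar that counts with weight \<open>n - 2\<close>, the dimension of K. The second Lie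
  derivative has to be formed on an open set before it is restricted to the section, so the spray,
  given only by a description, must first be identified with a smooth field there.\<close>

lemma dirder_eq: "(f has_derivative f') (at x) \<Longrightarrow> dirder f x w = f' w"
  by (metis frechet_derivative_at)

lemma has_derivative_dirder: "f differentiable (at x) \<Longrightarrow> (f has_derivative dirder f x) (at x)"
  by (simp add: frechet_derivative_works)

lemma dirder_cong:
  assumes "open S" "x \<in> S" "\<And>y. y \<in> S \<Longrightarrow> f y = g y"
  shows "frechet_derivative f (at x) = frechet_derivative g (at x)"
proof -
  have "(f has_derivative f') (at x) \<longleftrightarrow> (g has_derivative f') (at x)" for f'
    using assms by (metis has_derivative_transform_within_open)
  then show ?thesis by (simp add: frechet_derivative_def)
qed

lemma differentiable_cong_open:
  assumes "open S" "x \<in> S" "\<And>y. y \<in> S \<Longrightarrow> f y = g y"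
  shows "f differentiable (at x) \<longleftrightarrow> g differentiable (at x)"
  unfolding differentiable_def
  using assms by (metis has_derivative_transform_within_open)

lemma ck_on_cong:
  assumes "open S" "\<And>y. y \<in> S \<Longrightarrow> f y = g y"
  shows "ck_on k S f \<longleftrightarrow> ck_on k S g"
  using assms(2)
proof (induction k arbitrary: f g)
  case 0
  then show ?case by (simp cong: continuous_on_cong)
next
  case (Suc k)
  have "ck_on k S (\<lambda>x. dirder f x w) \<longleftrightarrow> ck_on k S (\<lambda>x. dirder g x w)" for w
    by (rule Suc.IH) (use dirder_cong[OF assms(1)] Suc.prems in metis)
  moreover have "f differentiable (at x) \<longleftrightarrow> g differentiable (at x)" if "x \<in> S" for x
    using differentiable_cong_open[OF assms(1) that] Suc.prems by metis
  ultimately show ?case by simp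
qed

lemma ck_on_Suc_imp: "ck_on (Suc k) S f \<Longrightarrow> ck_on k S f"
proof (induction k arbitrary: f)
  case 0
  then show ?case
    by (auto intro!: continuous_at_imp_continuous_on differentiable_imp_continuous_within)
qed auto

lemma ck_on_const: "ck_on k S (\<lambda>x. c)"
  by (induction k arbitrary: c) auto

lemma ck_on_linear_compose:
  assumes "open S" "bounded_linear L" "ck_on k S f"
  shows "ck_on k S (\<lambda>x. L (f x))"
  using assms(3)
proof (induction k arbitrary: f)
  case 0
  then show ?case
    using assms(2) by (simp add: bounded_linear.continuous_on)
next
  case (Suc k)
  have d: "((\<lambda>x. L (f x)) has_derivative (\<lambda>w. L (dirder f x w))) (at x)" if "x \<in> S" for x
    using Suc.prems that
    by (intro bounded_linear.has_derivative[OF assms(2)] has_derivative_dirder) simp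
  have "ck_on k S (\<lambda>x. dirder (\<lambda>x. L (f x)) x w)" for w
    using Suc.prems Suc.IH[of "\<lambda>x. dirder f x w"]
    by (subst ck_on_cong[OF assms(1), where g = "\<lambda>x. L (dirder f x w)"])
      (auto simp: dirder_eq[OF d])
  then show ?case using d by (auto simp: differentiable_def)
qed

lemma ck_on_add:
  assumes "open S" "ck_on k S f" "ck_on k S g"
  shows "ck_on k S (\<lambda>x. f x + g x)"
  using assms(2-)
proof (induction k arbitrary: f g)
  case (Suc k)
  have d: "((\<lambda>x. f x + g x) has_derivative (\<lambda>w. dirder f x w + dirder g x w)) (at x)"
    if "x \<in> S" for x
    using Suc.prems that by (intro has_derivative_add has_derivative_dirder) simp_all
  have "ck_on k S (\<lambda>x. dirder (\<lambda>x. f x + g x) x w)" for w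
    using Suc.prems
    by (subst ck_on_cong[OF assms(1), where g = "\<lambda>x. dirder f x w + dirder g x w"])
      (auto simp: dirder_eq[OF d] intro: Suc.IH)
  then show ?case using d by (auto simp: differentiable_def)
qed (auto intro: continuous_intros)

lemma ck_on_mult:
  fixes f g :: "'a::euclidean_space \<Rightarrow> real"
  assumes "open S" "ck_on k S f" "ck_on k S g"
  shows "ck_on k S (\<lambda>x. f x * g x)"
  using assms(2-)
proof (induction k arbitrary: f g)
  case (Suc k)
  have d: "((\<lambda>x. f x * g x) has_derivative (\<lambda>w. f x * dirder g x w + dirder f x w * g x)) (at x)"
    if "x \<in> S" for x
    using Suc.prems that by (intro has_derivative_mult has_derivative_dirder) simp_all
  have "ck_on k S (\<lambda>x. dirder (\<lambda>x. f x * g x) x w)" for w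
    using Suc.prems Suc.prems[THEN ck_on_Suc_imp]
    by (subst ck_on_cong[OF assms(1), where g = "\<lambda>x. f x * dirder g x w + dirder f x w * g x"])
      (auto simp: dirder_eq[OF d] intro!: Suc.IH ck_on_add assms(1))
  then show ?case using d by (auto simp: differentiable_def)
qed (auto intro: continuous_intros)

lemma ck_on_inverse:
  fixes f :: "'a::euclidean_space \<Rightarrow> real"
  assumes "open S" "ck_on k S f" "\<And>x. x \<in> S \<Longrightarrow> f x \<noteq> 0"
  shows "ck_on k S (\<lambda>x. inverse (f x))"
  using assms(2)
proof (induction k)
  case 0
  then show ?case using assms(3) by (auto intro!: continuous_intros)
next
  case (Suc k)
  have d: "((\<lambda>x. inverse (f x)) has_derivative
      (\<lambda>w. - (inverse (f x) * dirder f x w * inverse (f x)))) (at x)" if "x \<in> S" for x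
    using Suc.prems that assms(3) by (intro Deriv.has_derivative_inverse has_derivative_dirder) simp_all
  have "ck_on k S (\<lambda>x. inverse (f x))"
    using Suc.prems Suc.IH ck_on_Suc_imp by blast
  then have "ck_on k S (\<lambda>x. - (inverse (f x) * dirder f x w * inverse (f x)))" for w
    using Suc.prems assms(1)
    by (intro ck_on_linear_compose[OF _ bounded_linear_minus[OF bounded_linear_ident]] ck_on_mult) auto
  then have "ck_on k S (\<lambda>x. dirder (\<lambda>x. inverse (f x)) x w)" for w
    by (subst ck_on_cong[OF assms(1), where g = "\<lambda>x. - (inverse (f x) * dirder f x w * inverse (f x))"])
      (auto simp: dirder_eq[OF d])
  then show ?case using d by (auto simp: differentiable_def)
qed

lemma smooth_on_differentiable: "smooth_on S f \<Longrightarrow> x \<in> S \<Longrightarrow> f differentiable (at x)"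
  unfolding smooth_on_def by (metis ck_on.simps(2))

lemma smooth_on_has_derivative:
  "smooth_on S f \<Longrightarrow> x \<in> S \<Longrightarrow> (f has_derivative dirder f x) (at x)"
  by (rule has_derivative_dirder[OF smooth_on_differentiable])

lemma smooth_on_dirder: "smooth_on S f \<Longrightarrow> smooth_on S (\<lambda>x. dirder f x w)"
  unfolding smooth_on_def by (metis ck_on.simps(2))

lemma smooth_on_const: "smooth_on S (\<lambda>x. c)"
  by (simp add: smooth_on_def ck_on_const)

lemma smooth_on_linear_compose:
  "open S \<Longrightarrow> bounded_linear L \<Longrightarrow> smooth_on S f \<Longrightarrow> smooth_on S (\<lambda>x. L (f x))"
  by (simp add: smooth_on_def ck_on_linear_compose)

lemma smooth_on_add: "open S \<Longrightarrow> smooth_on S f \<Longrightarrow> smooth_on S g \<Longrightarrow> smooth_on S (\<lambda>x. f x + g x)"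
  by (simp add: smooth_on_def ck_on_add)

lemma smooth_on_minus: "open S \<Longrightarrow> smooth_on S f \<Longrightarrow> smooth_on S (\<lambda>x. - f x)"
  by (rule smooth_on_linear_compose[OF _ bounded_linear_minus[OF bounded_linear_ident]])

lemma smooth_on_diff: "open S \<Longrightarrow> smooth_on S f \<Longrightarrow> smooth_on S g \<Longrightarrow> smooth_on S (\<lambda>x. f x - g x)"
  using smooth_on_add[of S f "\<lambda>x. - g x"] by (simp add: smooth_on_minus)

lemma smooth_on_mult:
  fixes f g :: "'a::euclidean_space \<Rightarrow> real"
  shows "open S \<Longrightarrow> smooth_on S f \<Longrightarrow> smooth_on S g \<Longrightarrow> smooth_on S (\<lambda>x. f x * g x)"
  by (simp add: smooth_on_def ck_on_mult)

lemma smooth_on_divide: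
  fixes f g :: "'a::euclidean_space \<Rightarrow> real"
  assumes "open S" "smooth_on S f" "smooth_on S g" "\<And>x. x \<in> S \<Longrightarrow> g x \<noteq> 0"
  shows "smooth_on S (\<lambda>x. f x / g x)"
  using assms by (simp add: smooth_on_def divide_inverse ck_on_mult ck_on_inverse)

lemma smooth_on_sum:
  "open S \<Longrightarrow> (\<And>i. i \<in> I \<Longrightarrow> smooth_on S (f i)) \<Longrightarrow> smooth_on S (\<lambda>x. \<Sum>i\<in>I. f i x)"
  by (induction I rule: infinite_finite_induct) (auto intro: smooth_on_add smooth_on_const)

lemma smooth_on_prod:
  fixes f :: "'i \<Rightarrow> 'a::euclidean_space \<Rightarrow> real"
  shows "open S \<Longrightarrow> (\<And>i. i \<in> I \<Longrightarrow> smooth_on S (f i)) \<Longrightarrow> smooth_on S (\<lambda>x. \<Prod>i\<in>I. f i x)"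
  by (induction I rule: infinite_finite_induct) (auto intro: smooth_on_mult smooth_on_const)

lemma smooth_on_linear:
  assumes "open S" "bounded_linear L"
  shows "smooth_on S L"
proof -
  have "ck_on k S L" for k
  proof (cases k)
    case 0
    then show ?thesis using assms(2) by (simp add: linear_continuous_on)
  next
    case (Suc j)
    have "(L has_derivative L) (at x)" for x
      by (rule bounded_linear_imp_has_derivative[OF assms(2)])
    then show ?thesis
      using Suc by (auto simp: differentiable_def dirder_eq[where f' = L] ck_on_const)
  qed
  then show ?thesis by (simp add: smooth_on_def)
qed

lemma smooth_on_det:
  fixes A :: "'a::euclidean_space \<Rightarrow> real ^ 'n ^ 'n"
  assumes "open S" "\<And>i j. smooth_on S (\<lambda>x. A x $ i $ j)"
  shows "smooth_on S (\<lambda>x. det (A x))"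
  unfolding det_def using assms
  by (intro smooth_on_sum smooth_on_mult smooth_on_prod smooth_on_const)

lemma vec_basis_sum: "(x::real ^ 'k) = (\<Sum>i\<in>UNIV. x $ i *\<^sub>R axis i 1)"
  by (simp add: vec_eq_iff axis_def if_distrib cong: if_cong)

lemma smooth_on_vec:
  fixes f :: "'n::finite \<Rightarrow> 'a::euclidean_space \<Rightarrow> real"
  assumes "open S" "\<And>i. smooth_on S (f i)"
  shows "smooth_on S (\<lambda>x. \<chi> i. f i x)"
proof -
  have "(\<chi> i. f i x) = (\<Sum>i\<in>UNIV. f i x *\<^sub>R axis i 1)" for x
    using vec_basis_sum[of "\<chi> i. f i x"] by simp
  then show ?thesis
    using assms
    by (simp only:) (intro smooth_on_sum smooth_on_linear_compose[OF _ bounded_linear_scaleR_left])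
qed

text \<open>Two mean value theorems in succession: first in \<open>a\<close> for the increment in
  direction \<open>w\<close>, then in \<open>b\<close> for the derivative along \<open>v\<close>.
  The second difference is symmetric in \<open>v\<close> and \<open>w\<close> while the right-hand
  side is not, which is what forces the mixed derivatives to agree.\<close>

lemma second_difference_mean_value:
  fixes f :: "'a::euclidean_space \<Rightarrow> real"
  assumes "open S" "ck_on 2 S f" "h > 0"
    and "\<And>a b. 0 \<le> a \<Longrightarrow> a \<le> h \<Longrightarrow> 0 \<le> b \<Longrightarrow> b \<le> h \<Longrightarrow> x + a *\<^sub>R v + b *\<^sub>R w \<in> S"
  obtains a b where "0 < a" "a < h" "0 < b" "b < h"
    "f (x + h *\<^sub>R v + h *\<^sub>R w) - f (x + h *\<^sub>R v) - f (x + h *\<^sub>R w) + f x =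
       h * h * dirder (\<lambda>y. dirder f y v) (x + a *\<^sub>R v + b *\<^sub>R w) w"
proof -
  have f: "(f has_derivative dirder f y) (at y)"
    "((\<lambda>y. dirder f y v) has_derivative dirder (\<lambda>y. dirder f y v) y) (at y)" if "y \<in> S" for y
    using assms(2) that by (auto simp: numeral_2_eq_2 intro!: has_derivative_dirder)
  have lin: "linear (dirder f y)" "linear (dirder (\<lambda>y. dirder f y v) y)" if "y \<in> S" for y
    using f[OF that] has_derivative_linear by blast+
  have "((\<lambda>a. f (x + a *\<^sub>R v + b *\<^sub>R w)) has_real_derivative
      dirder f (x + a *\<^sub>R v + b *\<^sub>R w) v) (at a)" if "0 \<le> a" "a \<le> h" "0 \<le> b" "b \<le> h" for a b
  proof -
    have "((\<lambda>a. f (x + a *\<^sub>R v + b *\<^sub>R w)) has_derivative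
        (\<lambda>t. dirder f (x + a *\<^sub>R v + b *\<^sub>R w) (t *\<^sub>R v))) (at a)"
      by (rule has_derivative_compose[where g = "f" and f = "\<lambda>a. x + a *\<^sub>R v + b *\<^sub>R w", OF _ f(1)[OF assms(4)[OF that]]])
        (auto intro!: derivative_eq_intros)
    then show ?thesis
      using lin(1)[OF assms(4)[OF that]]
      by (simp add: has_field_derivative_def linear_cmul mult.commute[of _ "dirder _ _ _"])
  qed
  from DERIV_diff[OF this[where b = h] this[where b = 0]]
  have "\<exists>a. 0 < a \<and> a < h \<and>
      (f (x + h *\<^sub>R v + h *\<^sub>R w) - f (x + h *\<^sub>R v + 0 *\<^sub>R w)) -
      (f (x + 0 *\<^sub>R v + h *\<^sub>R w) - f (x + 0 *\<^sub>R v + 0 *\<^sub>R w))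
      = (h - 0) * (dirder f (x + a *\<^sub>R v + h *\<^sub>R w) v - dirder f (x + a *\<^sub>R v + 0 *\<^sub>R w) v)"
    using \<open>h > 0\<close> by (intro MVT2) auto
  then obtain a where a: "0 < a" "a < h" and
    eq1: "f (x + h *\<^sub>R v + h *\<^sub>R w) - f (x + h *\<^sub>R v) - f (x + h *\<^sub>R w) + f x
      = h * (dirder f (x + a *\<^sub>R v + h *\<^sub>R w) v - dirder f (x + a *\<^sub>R v + 0 *\<^sub>R w) v)"
    by auto
  have "((\<lambda>b. dirder f (x + a *\<^sub>R v + b *\<^sub>R w) v) has_real_derivative
      dirder (\<lambda>y. dirder f y v) (x + a *\<^sub>R v + b *\<^sub>R w) w) (at b)" if "0 \<le> b" "b \<le> h" for b
  proof -
    have *: "x + a *\<^sub>R v + b *\<^sub>R w \<in> S" using a that by (intro assms(4)) auto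
    have "((\<lambda>b. dirder f (x + a *\<^sub>R v + b *\<^sub>R w) v) has_derivative
        (\<lambda>t. dirder (\<lambda>y. dirder f y v) (x + a *\<^sub>R v + b *\<^sub>R w) (t *\<^sub>R w))) (at b)"
      by (rule has_derivative_compose[where g = "\<lambda>y. dirder f y v" and f = "\<lambda>b. x + a *\<^sub>R v + b *\<^sub>R w", OF _ f(2)[OF *]]) (auto intro!: derivative_eq_intros)
    then show ?thesis
      using lin(2)[OF *]
      by (simp add: has_field_derivative_def linear_cmul mult.commute[of _ "dirder _ _ _"])
  qed
  then have "\<exists>b. 0 < b \<and> b < h \<and>
      dirder f (x + a *\<^sub>R v + h *\<^sub>R w) v - dirder f (x + a *\<^sub>R v + 0 *\<^sub>R w) v =
      (h - 0) * dirder (\<lambda>y. dirder f y v) (x + a *\<^sub>R v + b *\<^sub>R w) w"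
    using \<open>h > 0\<close> by (intro MVT2) auto
  then obtain b where "0 < b" "b < h"
      "dirder f (x + a *\<^sub>R v + h *\<^sub>R w) v - dirder f (x + a *\<^sub>R v + 0 *\<^sub>R w) v =
      (h - 0) * dirder (\<lambda>y. dirder f y v) (x + a *\<^sub>R v + b *\<^sub>R w) w"
    by blast
  with eq1 a show thesis by (intro that[of a b]) auto
qed

text \<open>Exchanging \<open>v\<close> and \<open>w\<close> in the second difference makes the two
  mixed derivatives agree at two possibly different points near \<open>x\<close>. Both are
  continuous because \<open>f\<close> is C^2, so a gap at \<open>x\<close> is impossible.\<close>

lemma symmetric_second_derivative_real:
  fixes f :: "'a::euclidean_space \<Rightarrow> real"
  assumes "open S" "ck_on 2 S f" "x \<in> S"
  shows "dirder (\<lambda>y. dirder f y v) x w = dirder (\<lambda>y. dirder f y w) x v"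
proof (rule ccontr)
  let ?A = "\<lambda>y. dirder (\<lambda>y. dirder f y v) y w" and ?B = "\<lambda>y. dirder (\<lambda>y. dirder f y w) y v"
  assume "?A x \<noteq> ?B x"
  define e where "e = \<bar>?A x - ?B x\<bar> / 2"
  have "e > 0" using \<open>?A x \<noteq> ?B x\<close> by (simp add: e_def)
  have "continuous_on S ?A" "continuous_on S ?B"
    using assms(2) by (simp_all add: numeral_2_eq_2)
  then have "isCont ?A x" "isCont ?B x"
    using assms by (auto simp: continuous_on_eq_continuous_at)
  then have "\<exists>d>0. \<forall>y. dist y x < d \<longrightarrow> dist (?A y) (?A x) < e"
    "\<exists>d>0. \<forall>y. dist y x < d \<longrightarrow> dist (?B y) (?B x) < e"
    using \<open>e > 0\<close> unfolding continuous_at_eps_delta by simp_all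
  then obtain d1 d2 where d: "d1 > 0" "\<And>y. dist y x < d1 \<Longrightarrow> dist (?A y) (?A x) < e"
     "d2 > 0" "\<And>y. dist y x < d2 \<Longrightarrow> dist (?B y) (?B x) < e"
    by blast
  obtain d3 where d3: "d3 > 0" "ball x d3 \<subseteq> S" using assms by (meson openE)
  define d where "d = Min {d1, d2, d3}"
  have "d > 0" using d d3 by (simp add: d_def)
  \<comment> \<open>This size keeps the whole parallelogram within distance \<open>d\<close> of
    \<open>x\<close>; the summand 1 keeps the denominator positive when \<open>v\<close> and
    \<open>w\<close> vanish.\<close>
  define h where "h = d / (2 * (norm v + norm w + 1))"
  have "h > 0" using \<open>d > 0\<close> by (simp add: h_def add_nonneg_pos)
  have near: "dist (x + a *\<^sub>R p + b *\<^sub>R q) x < d"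
    if "0 \<le> a" "a \<le> h" "0 \<le> b" "b \<le> h" "(p, q) \<in> {(v, w), (w, v)}" for a b p q
  proof -
    have "norm (a *\<^sub>R p + b *\<^sub>R q) \<le> a * norm p + b * norm q"
      using that norm_triangle_ineq[of "a *\<^sub>R p" "b *\<^sub>R q"] by simp
    also have "\<dots> \<le> h * norm p + h * norm q"
      using that by (intro add_mono mult_right_mono) auto
    also have "\<dots> \<le> h * (norm v + norm w + 1)"
      using that \<open>h > 0\<close> by (auto simp: algebra_simps)
    also have "\<dots> < d"
    proof -
      have "norm v + norm w + 1 > 0" by (simp add: add_nonneg_pos)
      then have "h * (norm v + norm w + 1) = d / 2"
        by (simp add: h_def field_simps del: distrib_left_numeral)
      then show ?thesis using \<open>d > 0\<close> by simp
    qed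
    finally show ?thesis by (simp add: dist_norm algebra_simps)
  qed
  have S: "x + a *\<^sub>R p + b *\<^sub>R q \<in> S"
    if "0 \<le> a" "a \<le> h" "0 \<le> b" "b \<le> h" "(p, q) \<in> {(v, w), (w, v)}" for a b p q
    using near[OF that] d3 by (auto simp: d_def dist_commute)
  obtain a b where ab: "0 < a" "a < h" "0 < b" "b < h"
    "f (x + h *\<^sub>R v + h *\<^sub>R w) - f (x + h *\<^sub>R v) - f (x + h *\<^sub>R w) + f x =
       h * h * ?A (x + a *\<^sub>R v + b *\<^sub>R w)"
    using second_difference_mean_value[OF assms(1,2) \<open>h > 0\<close> S] by blast
  obtain a' b' where ab': "0 < a'" "a' < h" "0 < b'" "b' < h"
    "f (x + h *\<^sub>R w + h *\<^sub>R v) - f (x + h *\<^sub>R w) - f (x + h *\<^sub>R v) + f x =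
       h * h * ?B (x + a' *\<^sub>R w + b' *\<^sub>R v)"
    using second_difference_mean_value[OF assms(1,2) \<open>h > 0\<close> S] by blast
  have "h * h * ?A (x + a *\<^sub>R v + b *\<^sub>R w) = h * h * ?B (x + a' *\<^sub>R w + b' *\<^sub>R v)"
    using ab(5) ab'(5) by (simp add: algebra_simps)
  then have "?A (x + a *\<^sub>R v + b *\<^sub>R w) = ?B (x + a' *\<^sub>R w + b' *\<^sub>R v)"
    using \<open>h > 0\<close> by simp
  moreover have "dist (?A (x + a *\<^sub>R v + b *\<^sub>R w)) (?A x) < e"
    using near[of a b v w] ab by (intro d) (auto simp: d_def)
  moreover have "dist (?B (x + a' *\<^sub>R w + b' *\<^sub>R v)) (?B x) < e"
    using near[of a' b' w v] ab' by (intro d) (auto simp: d_def)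
  ultimately show False
    unfolding e_def dist_real_def by (smt (verit) field_sum_of_halves)
qed

lemma symmetric_second_derivative:
  fixes f :: "'a::euclidean_space \<Rightarrow> 'b::euclidean_space"
  assumes "open S" "smooth_on S f" "x \<in> S"
  shows "dirder (\<lambda>y. dirder f y v) x w = dirder (\<lambda>y. dirder f y w) x v"
proof (rule euclidean_eqI)
  fix b :: 'b
  have bl: "bounded_linear (\<lambda>y. y \<bullet> b)" by (rule bounded_linear_inner_left)
  have comp: "dirder (\<lambda>y. g y \<bullet> b) y u = dirder g y u \<bullet> b"
    if "g differentiable (at y)" for g :: "'a \<Rightarrow> 'b" and y u
    using bounded_linear.has_derivative[OF bl has_derivative_dirder[OF that]] by (rule dirder_eq)
  have second: "dirder (\<lambda>y. dirder f y p) x q \<bullet> b = dirder (\<lambda>y. dirder (\<lambda>y. f y \<bullet> b) y p) x q" for p q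
  proof -
    have "dirder (\<lambda>y. dirder (\<lambda>y. f y \<bullet> b) y p) x = dirder (\<lambda>y. dirder f y p \<bullet> b) x"
      by (rule dirder_cong[OF assms(1,3)])
        (use comp smooth_on_differentiable[OF assms(2)] in blast)
    then show ?thesis
      using comp[OF smooth_on_differentiable[OF smooth_on_dirder[OF assms(2)] assms(3)]] by simp
  qed
  have "ck_on 2 S (\<lambda>y. f y \<bullet> b)"
    using assms(1,2) ck_on_linear_compose[OF _ bl] by (auto simp: smooth_on_def)
  then show "dirder (\<lambda>y. dirder f y v) x w \<bullet> b = dirder (\<lambda>y. dirder f y w) x v \<bullet> b"
    unfolding second by (rule symmetric_second_derivative_real[OF assms(1) _ assms(3)])
qed

section \<open>Product rule for fields of bilinear forms and naturality of the Lie
  derivative\<close>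

lemma bilinear_basis_expansion:
  fixes h :: "'a::euclidean_space \<Rightarrow> 'b::euclidean_space \<Rightarrow> real"
  assumes "bilinear h"
  shows "h a b = (\<Sum>i\<in>Basis. \<Sum>j\<in>Basis. (a \<bullet> i) * (b \<bullet> j) * h i j)"
proof -
  have "h a b = h (\<Sum>i\<in>Basis. (a \<bullet> i) *\<^sub>R i) (\<Sum>j\<in>Basis. (b \<bullet> j) *\<^sub>R j)"
    by (simp add: euclidean_representation)
  also have "\<dots> = (\<Sum>i\<in>Basis. \<Sum>j\<in>Basis. h ((a \<bullet> i) *\<^sub>R i) ((b \<bullet> j) *\<^sub>R j))"
    by (subst bilinear_sum[OF assms]) (simp only: sum.cartesian_product)
  also have "\<dots> = (\<Sum>i\<in>Basis. \<Sum>j\<in>Basis. (a \<bullet> i) * (b \<bullet> j) * h i j)"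
    by (intro sum.cong refl)
      (simp only: bilinear_lmul[OF assms] bilinear_rmul[OF assms] real_scaleR_def mult.assoc mult.left_commute)
  finally show ?thesis .
qed

text \<open>Differentiability is assumed of the scalar functions \<open>H y i j\<close> only, so the
  form is expanded in a basis and the ordinary product rule is applied to each summand. The two
  arguments may have different types: choosing the reals for one of them lets the lemma treat linear
  fields as well.\<close>

lemma has_derivative_bilinear_field:
  fixes H :: "'c::real_normed_vector \<Rightarrow> 'a::euclidean_space \<Rightarrow> 'b::euclidean_space \<Rightarrow> real"
  assumes "open D" "x \<in> D" and bil: "\<And>y. y \<in> D \<Longrightarrow> bilinear (H y)"
    and H: "\<And>i j. i \<in> Basis \<Longrightarrow> j \<in> Basis \<Longrightarrow> (\<lambda>y. H y i j) differentiable (at x)"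
    and a: "(a has_derivative a') (at x)" and b: "(b has_derivative b') (at x)"
  shows "((\<lambda>y. H y (a y) (b y)) has_derivative
    (\<lambda>t. dirder (\<lambda>y. H y (a x) (b x)) x t + H x (a' t) (b x) + H x (a x) (b' t))) (at x)"
proof -
  have H': "((\<lambda>y. H y i j) has_derivative dirder (\<lambda>y. H y i j) x) (at x)"
    if "i \<in> Basis" "j \<in> Basis" for i j
    using H[OF that] by (rule has_derivative_dirder)
  have c: "((\<lambda>y. \<Sum>i\<in>Basis. \<Sum>j\<in>Basis. (a x \<bullet> i) * (b x \<bullet> j) * H y i j) has_derivative
    (\<lambda>t. \<Sum>i\<in>Basis. \<Sum>j\<in>Basis. (a x \<bullet> i) * (b x \<bullet> j) * dirder (\<lambda>y. H y i j) x t)) (at x)"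
    by (auto intro!: derivative_eq_intros H' sum.cong)
  have "dirder (\<lambda>y. H y (a x) (b x)) x
    = dirder (\<lambda>y. \<Sum>i\<in>Basis. \<Sum>j\<in>Basis. (a x \<bullet> i) * (b x \<bullet> j) * H y i j) x"
    by (rule dirder_cong[OF assms(1,2)]) (rule bilinear_basis_expansion[OF bil])
  then have c': "dirder (\<lambda>y. H y (a x) (b x)) x t =
    (\<Sum>i\<in>Basis. \<Sum>j\<in>Basis. (a x \<bullet> i) * (b x \<bullet> j) * dirder (\<lambda>y. H y i j) x t)" for t
    using dirder_eq[OF c] by simp
  have "((\<lambda>y. \<Sum>i\<in>Basis. \<Sum>j\<in>Basis. (a y \<bullet> i) * (b y \<bullet> j) * H y i j) has_derivative
    (\<lambda>t. \<Sum>i\<in>Basis. \<Sum>j\<in>Basis.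
       (a x \<bullet> i) * (b x \<bullet> j) * dirder (\<lambda>y. H y i j) x t
       + (a' t \<bullet> i) * (b x \<bullet> j) * H x i j + (a x \<bullet> i) * (b' t \<bullet> j) * H x i j)) (at x)"
    by (intro has_derivative_sum)
      (rule derivative_eq_intros a b H' refl | assumption | simp add: algebra_simps)+
  then have "((\<lambda>y. \<Sum>i\<in>Basis. \<Sum>j\<in>Basis. (a y \<bullet> i) * (b y \<bullet> j) * H y i j) has_derivative
    (\<lambda>t. dirder (\<lambda>y. H y (a x) (b x)) x t + H x (a' t) (b x) + H x (a x) (b' t))) (at x)"
    unfolding c' bilinear_basis_expansion[OF bil[OF assms(2)], of "a' _"]
      bilinear_basis_expansion[OF bil[OF assms(2)], of _ "b' _"]
    by (simp add: sum.distrib)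
  then show ?thesis
    by (rule has_derivative_transform_within_open[OF _ assms(1,2)])
      (rule bilinear_basis_expansion[OF bil, symmetric])
qed

lemma lie_bracket_const: "lie_bracket V (\<lambda>_. X) z = - dirder V z X"
  by (simp add: lie_bracket_def)

lemma lie_form_cong:
  assumes "open S" "z \<in> S" "\<And>y X Y. y \<in> S \<Longrightarrow> h y X Y = h' y X Y"
  shows "lie_form V h z X Y = lie_form V h' z X Y"
  using dirder_cong[OF assms(1,2), of "\<lambda>y. h y X Y" "\<lambda>y. h' y X Y"] assms
  by (simp add: lie_form_def)

text \<open>Differentiating the relation \<open>V (f y) = dirder f y (k y)\<close> brings a second
  derivative of \<open>f\<close> into the derivative of \<open>V\<close>. The same second derivative
  appears when the pushed-forward vectors \<open>dirder f y X\<close> are differentiated, and by its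
  symmetry the two cancel. The dimensions of source and target may differ.\<close>

lemma lie_form_pullback:
  fixes f :: "'a::euclidean_space \<Rightarrow> 'b::euclidean_space"
  assumes D: "open D" "x \<in> D" and f: "smooth_on D f"
    and Om: "open \<Omega>" "f ` D \<subseteq> \<Omega>" and bil: "\<And>z. z \<in> \<Omega> \<Longrightarrow> bilinear (h z)"
    and h: "\<And>X Y. (\<lambda>z. h z X Y) differentiable (at (f x))"
    and V: "V differentiable (at (f x))" and k: "k differentiable (at x)"
    and related: "\<And>y. y \<in> D \<Longrightarrow> V (f y) = dirder f y (k y)"
  shows "lie_form V h (f x) (dirder f x X) (dirder f x Y) =
    lie_form k (\<lambda>y X Y. h (f y) (dirder f y X) (dirder f y Y)) x X Y"
proof -
  have fx: "f x \<in> \<Omega>" using Om D by auto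
  have df: "(f has_derivative dirder f x) (at x)"
    by (rule smooth_on_has_derivative[OF f D(2)])
  have d2: "((\<lambda>y. dirder f y X) has_derivative dirder (\<lambda>y. dirder f y X) x) (at x)" for X
    by (rule smooth_on_has_derivative[OF smooth_on_dirder[OF f] D(2)])
  have linf: "linear (dirder f y)" if "y \<in> D" for y
    using linear_frechet_derivative smooth_on_differentiable[OF f that] by blast
  have hf: "((\<lambda>y. h (f y) X Y) has_derivative (\<lambda>t. dirder (\<lambda>z. h z X Y) (f x) (dirder f x t))) (at x)" for X Y
    using has_derivative_compose[OF df has_derivative_dirder[OF h]] .
  have hfd: "(\<lambda>y. h (f y) X Y) differentiable (at x)" for X Y
    using hf by (auto simp: differentiable_def)
  have dVf: "dirder V (f x) (dirder f x X)
      = dirder f x (dirder k x X) + dirder (\<lambda>y. dirder f y X) x (k x)" for X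
  proof -
    have "((\<lambda>y. V (f y)) has_derivative (\<lambda>t. dirder V (f x) (dirder f x t))) (at x)"
      by (rule has_derivative_compose[OF df has_derivative_dirder[OF V]])
    moreover have "((\<lambda>y. V (f y)) has_derivative
        (\<lambda>t. dirder f x (dirder k x t) + dirder (\<lambda>y. dirder f y t) x (k x))) (at x)"
    proof -
      have "((\<lambda>y. dirder f y (k y)) has_derivative
          (\<lambda>t. dirder (\<lambda>y. dirder f y (k x)) x t + dirder f x (dirder k x t))) (at x)"
      proof (subst has_derivative_componentwise_within, intro ballI)
        fix b :: 'b assume "b \<in> Basis"
        \<comment> \<open>A dummy real slot, later set to 1, turns the linear field into a bilinear
          one.\<close>
        define H where "H = (\<lambda>y (r::real) X. r * (dirder f y X \<bullet> b))"
        have bH: "bilinear (H y)" if "y \<in> D" for y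
          using linf[OF that] unfolding H_def bilinear_def
          by (auto intro!: linearI simp: linear_add linear_cmul algebra_simps inner_add_left)
        have dH: "((\<lambda>y. H y r X) has_derivative (\<lambda>t. r * (dirder (\<lambda>y. dirder f y X) x t \<bullet> b))) (at x)" for r X
          unfolding H_def by (auto intro!: derivative_eq_intros d2)
        have "((\<lambda>y. H y 1 (k y)) has_derivative
          (\<lambda>t. dirder (\<lambda>y. H y 1 (k x)) x t + H x 0 (k x) + H x 1 (dirder k x t))) (at x)"
          by (rule has_derivative_bilinear_field[OF D bH])
            (use dH in \<open>auto simp: differentiable_def intro!: derivative_eq_intros has_derivative_dirder k\<close>)
        then show "((\<lambda>y. dirder f y (k y) \<bullet> b) has_derivative
           (\<lambda>t. (dirder (\<lambda>y. dirder f y (k x)) x t + dirder f x (dirder k x t)) \<bullet> b)) (at x)"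
          unfolding dirder_eq[OF dH] by (simp add: H_def inner_add_left)
      qed
      then have "((\<lambda>y. V (f y)) has_derivative
          (\<lambda>t. dirder (\<lambda>y. dirder f y (k x)) x t + dirder f x (dirder k x t))) (at x)"
        by (rule has_derivative_transform_within_open[OF _ D]) (simp add: related)
      then show ?thesis
        by (simp add: symmetric_second_derivative[OF D(1) f D(2), of "k x"] add.commute)
    qed
    ultimately show ?thesis
      by (rule has_derivative_unique[THEN fun_cong])
  qed
  have "((\<lambda>y. h (f y) (dirder f y X) (dirder f y Y)) has_derivative
    (\<lambda>t. dirder (\<lambda>y. h (f y) (dirder f x X) (dirder f x Y)) x t
      + h (f x) (dirder (\<lambda>y. dirder f y X) x t) (dirder f x Y)
      + h (f x) (dirder f x X) (dirder (\<lambda>y. dirder f y Y) x t))) (at x)"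
    by (rule has_derivative_bilinear_field[OF D _ hfd d2 d2]) (use bil Om in auto)
  from dirder_eq[OF this, of "k x"]
  have "dirder (\<lambda>y. h (f y) (dirder f y X) (dirder f y Y)) x (k x) =
      dirder (\<lambda>z. h z (dirder f x X) (dirder f x Y)) (f x) (V (f x))
      + h (f x) (dirder (\<lambda>y. dirder f y X) x (k x)) (dirder f x Y)
      + h (f x) (dirder f x X) (dirder (\<lambda>y. dirder f y Y) x (k x))"
    unfolding dirder_eq[OF hf] related[OF D(2)] .
  moreover have "bilinear (h (f x))" using bil fx by blast
  ultimately show ?thesis
    unfolding lie_form_def lie_bracket_const
    using linf[OF D(2)]
    by (simp add: dVf bilinear_ladd bilinear_radd bilinear_lsub bilinear_rsub linear_neg
      bilinear_lneg bilinear_rneg)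
qed

section \<open>Homogeneous functions and their sprays\<close>

lemma linear_Pair_0: "linear (Pair 0)" "linear (\<lambda>\<xi>. (\<xi>, 0))"
  by (auto intro!: linearI)

lemma bilinear_compose:
  assumes "bilinear h" "linear a" "linear b"
  shows "bilinear (\<lambda>x y. h (a x) (b y))"
  using assms unfolding bilinear_def
  by (auto intro: linear_compose[unfolded o_def])

text \<open>The setting inside one chart. Homogeneity is recorded infinitesimally, by Euler's
  equation, so that the higher identities arise by differentiating it.\<close>

locale homogeneous_function =
  fixes F :: "'n::finite pt \<Rightarrow> real" and m :: real and \<Omega> :: "'n pt set"
  assumes open_\<Omega>: "open \<Omega>"
    and smooth: "smooth_on \<Omega> F"
    and euler: "\<And>z. z \<in> \<Omega> \<Longrightarrow> dirder F z (0, snd z) = m * F z"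
    and nondegenerate: "\<And>z. z \<in> \<Omega> \<Longrightarrow> det (fibre_hessian F z) \<noteq> 0"
    and m_neq_1: "m \<noteq> 1"
begin

section \<open>Higher derivatives on constant vectors and Euler's identities\<close>

definition D2 :: "'n pt \<Rightarrow> 'n pt \<Rightarrow> 'n pt \<Rightarrow> real" where
  "D2 z X Y = dirder (\<lambda>y. dirder F y Y) z X"

definition D3 :: "'n pt \<Rightarrow> 'n pt \<Rightarrow> 'n pt \<Rightarrow> 'n pt \<Rightarrow> real" where
  "D3 z X Y Z = dirder (\<lambda>y. D2 y Y Z) z X"

lemma smooth_D2: "smooth_on \<Omega> (\<lambda>z. D2 z X Y)"
  unfolding D2_def by (intro smooth_on_dirder smooth)

lemma has_derivative_D1: "z \<in> \<Omega> \<Longrightarrow> ((\<lambda>y. dirder F y Y) has_derivative (\<lambda>X. D2 z X Y)) (at z)"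
  using smooth_on_has_derivative[OF smooth_on_dirder[OF smooth]] by (simp add: D2_def)

lemma has_derivative_D2: "z \<in> \<Omega> \<Longrightarrow> ((\<lambda>y. D2 y Y Z) has_derivative (\<lambda>X. D3 z X Y Z)) (at z)"
  using smooth_on_has_derivative[OF smooth_D2] by (simp add: D3_def)

lemma linear_D1: "z \<in> \<Omega> \<Longrightarrow> linear (dirder F z)"
  using smooth_on_has_derivative[OF smooth] has_derivative_linear by blast

lemma D2_sym: "z \<in> \<Omega> \<Longrightarrow> D2 z X Y = D2 z Y X"
  unfolding D2_def by (rule symmetric_second_derivative[OF open_\<Omega> smooth])

lemma linear_D2: "z \<in> \<Omega> \<Longrightarrow> linear (\<lambda>X. D2 z X Y)"
  using has_derivative_D1 has_derivative_linear by blast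

lemma bilinear_D2: "z \<in> \<Omega> \<Longrightarrow> bilinear (D2 z)"
  using linear_D2[of z] by (simp add: bilinear_def D2_sym[of z])

lemma D3_sym12: "z \<in> \<Omega> \<Longrightarrow> D3 z X Y Z = D3 z Y X Z"
  unfolding D3_def D2_def
  by (rule symmetric_second_derivative[OF open_\<Omega> smooth_on_dirder[OF smooth]])

lemma D3_sym23: "z \<in> \<Omega> \<Longrightarrow> D3 z X Y Z = D3 z X Z Y"
  unfolding D3_def using dirder_cong[OF open_\<Omega>] D2_sym by metis

lemma linear_D3: "z \<in> \<Omega> \<Longrightarrow> linear (\<lambda>X. D3 z X Y Z)"
  using has_derivative_D2 has_derivative_linear by blast

lemma D3_add1: "z \<in> \<Omega> \<Longrightarrow> D3 z (X + X') Y Z = D3 z X Y Z + D3 z X' Y Z"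
  using linear_add[OF linear_D3[of z Y Z]] by simp

lemma has_derivative_D2_field:
  assumes "z \<in> \<Omega>" "(a has_derivative a') (at z)" "(b has_derivative b') (at z)"
  shows "((\<lambda>y. D2 y (a y) (b y)) has_derivative
    (\<lambda>X. D3 z X (a z) (b z) + D2 z (a' X) (b z) + D2 z (a z) (b' X))) (at z)"
proof -
  have "(\<lambda>y. D2 y i j) differentiable (at z)" for i j
    using smooth_on_differentiable[OF smooth_D2 assms(1)] .
  from has_derivative_bilinear_field[OF open_\<Omega> assms(1) bilinear_D2 this assms(2,3)]
  show ?thesis by (simp add: D3_def)
qed

text \<open>The derivative of \<open>euler\<close> along \<open>Y\<close>. The subtracted term
  appears because the radial vector \<open>(0, snd z)\<close> itself moves with
  \<open>z\<close>.\<close>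

lemma euler2:
  assumes "z \<in> \<Omega>"
  shows "D2 z Y (0, snd z) = m * dirder F z Y - dirder F z (0, snd Y)"
proof -
  define H where "H = (\<lambda>y (r::real) X. r * dirder F y X)"
  have bH: "bilinear (H y)" if "y \<in> \<Omega>" for y
    unfolding H_def bilinear_def
    by (intro conjI allI linearI)
      (simp_all add: linear_add[OF linear_D1[OF that]] linear_cmul[OF linear_D1[OF that]] algebra_simps)
  have dH: "((\<lambda>y. H y r X) has_derivative (\<lambda>t. r * D2 z t X)) (at z)" for r X
    unfolding H_def by (auto intro!: derivative_eq_intros has_derivative_D1 assms)
  have s: "((\<lambda>y. (0::real ^ 'n, snd y)) has_derivative (\<lambda>t. (0::real ^ 'n, snd t))) (at z)"
    by (auto intro!: derivative_eq_intros)
  have "((\<lambda>y. H y 1 (0, snd y)) has_derivative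
    (\<lambda>t. dirder (\<lambda>y. H y 1 (0, snd z)) z t + H z 0 (0, snd z) + H z 1 (0, snd t))) (at z)"
    by (rule has_derivative_bilinear_field[OF open_\<Omega> assms bH])
      (use dH s in \<open>auto simp: differentiable_def intro!: derivative_eq_intros\<close>)
  then have "((\<lambda>y. dirder F y (0, snd y)) has_derivative
    (\<lambda>t. D2 z t (0, snd z) + dirder F z (0, snd t))) (at z)"
    unfolding dirder_eq[OF dH] by (simp add: H_def)
  then have "((\<lambda>y. m * F y) has_derivative
    (\<lambda>t. D2 z t (0, snd z) + dirder F z (0, snd t))) (at z)"
    by (rule has_derivative_transform_within_open[OF _ open_\<Omega> assms]) (rule euler)
  moreover have "((\<lambda>y. m * F y) has_derivative (\<lambda>t. m * dirder F z t)) (at z)"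
    by (auto intro!: derivative_eq_intros smooth_on_has_derivative[OF smooth] assms)
  ultimately have "D2 z Y (0, snd z) + dirder F z (0, snd Y) = m * dirder F z Y"
    by (rule has_derivative_unique[THEN fun_cong])
  then show ?thesis by simp
qed

lemma euler2_vertical:
  "z \<in> \<Omega> \<Longrightarrow> D2 z (0, \<xi>) (0, snd z) = (m - 1) * dirder F z (0, \<xi>)"
  by (simp add: euler2 algebra_simps)

text \<open>The derivative of \<open>euler2\<close> along \<open>X\<close>; again the last term
  comes from the moving radial vector.\<close>

lemma euler3:
  assumes "z \<in> \<Omega>"
  shows "D3 z X Y (0, snd z) = m * D2 z X Y - D2 z X (0, snd Y) - D2 z Y (0, snd X)"
proof -
  have s: "((\<lambda>y. (0::real ^ 'n, snd y)) has_derivative (\<lambda>t. (0::real ^ 'n, snd t))) (at z)"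
    by (auto intro!: derivative_eq_intros)
  have "((\<lambda>y. D2 y Y (0, snd y)) has_derivative
      (\<lambda>t. D3 z t Y (0, snd z) + D2 z 0 (0, snd z) + D2 z Y (0, snd t))) (at z)"
    by (rule has_derivative_D2_field[OF assms has_derivative_const s])
  moreover have "((\<lambda>y. D2 y Y (0, snd y)) has_derivative
      (\<lambda>t. m * D2 z t Y - D2 z t (0, snd Y))) (at z)"
  proof -
    have "((\<lambda>y. m * dirder F y Y - dirder F y (0, snd Y)) has_derivative
      (\<lambda>t. m * D2 z t Y - D2 z t (0, snd Y))) (at z)"
      by (auto intro!: derivative_eq_intros has_derivative_D1 assms)
    then show ?thesis
      by (rule has_derivative_transform_within_open[OF _ open_\<Omega> assms]) (simp add: euler2)
  qed
  ultimately have "D3 z X Y (0, snd z) + D2 z 0 (0, snd z) + D2 z Y (0, snd X)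
      = m * D2 z X Y - D2 z X (0, snd Y)"
    by (rule has_derivative_unique[THEN fun_cong])
  then show ?thesis
    using linear_0[OF linear_D2[OF assms]] by simp
qed

section \<open>The fibre metric and the coordinate form of the spray\<close>

definition g :: "'n pt \<Rightarrow> real ^ 'n \<Rightarrow> real ^ 'n \<Rightarrow> real" where
  "g z \<xi> \<eta> = D2 z (0, \<xi>) (0, \<eta>)"

lemma fibre_hessian_nth: "fibre_hessian F z $ i $ j = g z (axis i 1) (axis j 1)"
  by (simp add: fibre_hessian_def pdv_def[abs_def] g_def D2_def)

lemma bilinear_g: "z \<in> \<Omega> \<Longrightarrow> bilinear (g z)"
  using bilinear_compose[OF bilinear_D2 linear_Pair_0(1) linear_Pair_0(1)]
  by (simp add: g_def[abs_def])

lemma g_sym: "z \<in> \<Omega> \<Longrightarrow> g z \<xi> \<eta> = g z \<eta> \<xi>"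
  by (simp add: g_def D2_sym)

lemma g_matrix: "z \<in> \<Omega> \<Longrightarrow> g z \<xi> \<eta> = \<xi> \<bullet> (fibre_hessian F z *v \<eta>)"
proof -
  assume "z \<in> \<Omega>"
  note b = bilinear_g[OF this]
  have "g z \<xi> \<eta> = g z (\<Sum>i\<in>UNIV. \<xi> $ i *\<^sub>R axis i 1) (\<Sum>j\<in>UNIV. \<eta> $ j *\<^sub>R axis j 1)"
    by (simp only: vec_basis_sum[symmetric])
  also have "\<dots> = (\<Sum>i\<in>UNIV. \<Sum>j\<in>UNIV. g z (\<xi> $ i *\<^sub>R axis i 1) (\<eta> $ j *\<^sub>R axis j 1))"
    by (subst bilinear_sum[OF b]) (simp only: sum.cartesian_product)
  also have "\<dots> = \<xi> \<bullet> (fibre_hessian F z *v \<eta>)"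
    by (simp add: inner_vec_def matrix_vector_mult_def fibre_hessian_nth sum_distrib_left
        bilinear_lmul[OF b] bilinear_rmul[OF b] ac_simps)
  finally show ?thesis .
qed

lemma g_h_eq: "z \<in> \<Omega> \<Longrightarrow> g_h F z X Y = g z (fst X) (fst Y)"
  by (simp add: g_matrix g_h_def inner_vec_def matrix_vector_mult_def sum_distrib_left ac_simps)

lemma g_v_eq: "z \<in> \<Omega> \<Longrightarrow> g_v F z X Y = g z (snd X) (snd Y)"
  by (simp add: g_matrix g_v_def inner_vec_def matrix_vector_mult_def sum_distrib_left ac_simps)

lemma Dv_eq: "z \<in> \<Omega> \<Longrightarrow> Dv F z X = dirder F z (0, fst X)"
proof -
  assume "z \<in> \<Omega>"
  then have l: "linear (\<lambda>\<xi>. dirder F z (0, \<xi>))"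
    using linear_compose[OF linear_Pair_0(1) linear_D1] by (simp add: o_def)
  have "dirder F z (0, fst X) = dirder F z (0, \<Sum>i\<in>UNIV. fst X $ i *\<^sub>R axis i 1)"
    by (simp only: vec_basis_sum[symmetric])
  also have "\<dots> = Dv F z X"
    by (simp add: linear_sum[OF l] linear_cmul[OF l] Dv_def pdv_def mult.commute)
  finally show ?thesis ..
qed

lemma g_nondegenerate:
  assumes "z \<in> \<Omega>" "\<And>\<eta>. g z \<eta> \<xi> = 0"
  shows "\<xi> = 0"
proof -
  have "fibre_hessian F z *v \<xi> = 0"
    using assms g_matrix by (metis inner_eq_zero_iff)
  moreover have "invertible (fibre_hessian F z)"
    using nondegenerate[OF assms(1)] by (simp add: invertible_det_nz)
  ultimately show ?thesis
    unfolding invertible_left_inverse matrix_left_invertible_ker by blast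
qed

text \<open>Cramer's rule for \<open>u\<^sup>i g\<^sub>i\<^sub>j = \<partial>G/\<partial>x\<^sup>j - v\<^sup>i \<partial>\<^sup>2G/\<partial>x\<^sup>i\<partial>v\<^sup>j\<close>, which exhibits \<open>u\<close> as smooth.\<close>

definition spray_rhs :: "'n pt \<Rightarrow> real ^ 'n" where
  "spray_rhs z = (\<chi> j. dirder F z (axis j 1, 0) - (\<Sum>i\<in>UNIV. snd z $ i * D2 z (axis i 1, 0) (0, axis j 1)))"

definition u :: "'n pt \<Rightarrow> real ^ 'n" where
  "u z = (\<chi> k. det (\<chi> i j. if j = k then spray_rhs z $ i else fibre_hessian F z $ i $ j)
            / det (fibre_hessian F z))"

lemma smooth_u: "smooth_on \<Omega> u"
proof -
  have H: "smooth_on \<Omega> (\<lambda>z. fibre_hessian F z $ i $ j)" for i j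
    unfolding fibre_hessian_nth g_def by (rule smooth_D2)
  have "bounded_linear (\<lambda>z::'n pt. snd z $ i)" for i
    by (intro bounded_linear_compose[OF bounded_linear_vec_nth bounded_linear_snd])
  then have R: "smooth_on \<Omega> (\<lambda>z. spray_rhs z $ i)" for i
    unfolding spray_rhs_def vec_lambda_beta using open_\<Omega>
    by (intro smooth_on_diff smooth_on_dirder smooth smooth_on_sum smooth_on_mult smooth_D2 smooth_on_linear)
  have "smooth_on \<Omega> (\<lambda>z. (\<chi> i j. if j = k then spray_rhs z $ i else fibre_hessian F z $ i $ j) $ i $ j)" for i j k
    using R H by (cases "j = k") simp_all
  then show ?thesis
    unfolding u_def[abs_def]
    by (intro smooth_on_vec smooth_on_divide smooth_on_det open_\<Omega> H nondegenerate)
qed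

text \<open>The linear system solved by Cramer's rule, freed of indices. Later \<open>u\<close> is
  differentiated implicitly through this identity and not through the determinants, which serve only
  for smoothness.\<close>

lemma g_u:
  assumes "z \<in> \<Omega>"
  shows "g z \<eta> (u z) = dirder F z (\<eta>, 0) - D2 z (snd z, 0) (0, \<eta>)"
proof -
  have "fibre_hessian F z *v u z = spray_rhs z"
    using cramer[OF nondegenerate[OF assms]] by (simp add: u_def)
  then have gu: "g z \<eta> (u z) = (\<Sum>j\<in>UNIV. \<eta> $ j * spray_rhs z $ j)"
    by (simp add: g_matrix[OF assms] inner_vec_def)
  have l: "linear (\<lambda>\<xi>. dirder F z (\<xi>, 0))"
    using linear_compose[OF linear_Pair_0(2) linear_D1[OF assms]] by (simp add: o_def)
  have b: "bilinear (\<lambda>\<xi> \<eta>. D2 z (\<xi>, 0) (0, \<eta>))"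
    by (rule bilinear_compose[OF bilinear_D2[OF assms] linear_Pair_0(2,1)])
  have "dirder F z (\<eta>, 0) = dirder F z (\<Sum>i\<in>UNIV. \<eta> $ i *\<^sub>R axis i 1, 0)"
    by (simp only: vec_basis_sum[symmetric])
  then have 1: "dirder F z (\<eta>, 0) = (\<Sum>j\<in>UNIV. \<eta> $ j * dirder F z (axis j 1, 0))"
    by (simp add: linear_sum[OF l] linear_cmul[OF l])
  have "D2 z (snd z, 0) (0, \<eta>)
     = D2 z (\<Sum>i\<in>UNIV. snd z $ i *\<^sub>R axis i 1, 0) (0, \<Sum>j\<in>UNIV. \<eta> $ j *\<^sub>R axis j 1)"
    by (simp only: vec_basis_sum[symmetric])
  also have "\<dots> = (\<Sum>i\<in>UNIV. \<Sum>j\<in>UNIV. D2 z (snd z $ i *\<^sub>R axis i 1, 0) (0, \<eta> $ j *\<^sub>R axis j 1))"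
    by (subst bilinear_sum[OF b]) (simp only: sum.cartesian_product)
  also have "\<dots> = (\<Sum>i\<in>UNIV. \<Sum>j\<in>UNIV. \<eta> $ j * (snd z $ i * D2 z (axis i 1, 0) (0, axis j 1)))"
    by (simp add: bilinear_lmul[OF b] bilinear_rmul[OF b] ac_simps)
  also have "\<dots> = (\<Sum>j\<in>UNIV. \<Sum>i\<in>UNIV. \<eta> $ j * (snd z $ i * D2 z (axis i 1, 0) (0, axis j 1)))"
    by (rule sum.swap)
  finally have 2: "D2 z (snd z, 0) (0, \<eta>)
    = (\<Sum>j\<in>UNIV. \<Sum>i\<in>UNIV. \<eta> $ j * (snd z $ i * D2 z (axis i 1, 0) (0, axis j 1)))" .
  show ?thesis
    unfolding 1 2 gu
    by (simp add: spray_rhs_def right_diff_distrib sum_subtractf sum_distrib_left)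
qed

lemma ext_d_Dv:
  assumes "z \<in> \<Omega>"
  shows "ext_d (Dv F) z X Y = D2 z X (0, fst Y) - D2 z Y (0, fst X)"
proof -
  have "dirder (\<lambda>y. Dv F y X) z = dirder (\<lambda>y. dirder F y (0, fst X)) z" for X
    by (rule dirder_cong[OF open_\<Omega> assms]) (rule Dv_eq)
  then show ?thesis by (simp add: ext_d_def D2_def)
qed

lemma D2_split:
  assumes "z \<in> \<Omega>"
  shows "D2 z (a, b) Y = D2 z (a, 0) Y + D2 z (0, b) Y" "D2 z Y (a, b) = D2 z Y (a, 0) + D2 z Y (0, b)"
  using bilinear_ladd[OF bilinear_D2[OF assms], of "(a, 0)" "(0, b)" Y]
    bilinear_radd[OF bilinear_D2[OF assms], of Y "(a, 0)" "(0, b)"] by simp_all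

text \<open>That the pair is a solution follows from \<open>euler2\<close> and \<open>g_u\<close>.
  For uniqueness, test vectors along the fibre determine the base component and test vectors
  \<open>(\<eta>, 0)\<close> then determine the fibre component, each time by nondegeneracy of
  \<open>g z\<close>.\<close>

lemma spray_eq:
  assumes "z \<in> \<Omega>"
  shows "spray F m z = (snd z, u z)"
  unfolding spray_def
proof (rule the_equality)
  have D1_split: "dirder F z (a, b) = dirder F z (a, 0) + dirder F z (0, b)" for a b
    using linear_add[OF linear_D1[OF assms], of "(a, 0)" "(0, b)"] by simp
  have D2_0: "D2 z X 0 = 0" "D2 z 0 X = 0" for X
    using bilinear_rzero bilinear_lzero bilinear_D2[OF assms] by blast+
  show "\<forall>Y. ext_d (Dv F) z (snd z, u z) Y = - (m - 1) * dirder F z Y"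
  proof
    fix Y :: "'n pt"
    obtain a b where Y: "Y = (a, b)" by fastforce
    have "D2 z (a, b) (0, snd z) = m * dirder F z (a, b) - dirder F z (0, b)"
      by (simp add: euler2[OF assms])
    moreover have "D2 z (snd z, u z) (0, a) = dirder F z (a, 0)"
      using g_u[OF assms, of a] by (simp add: D2_split(1)[OF assms, of "snd z" "u z"] g_def D2_sym[OF assms, of "(0, u z)"])
    ultimately show "ext_d (Dv F) z (snd z, u z) Y = - (m - 1) * dirder F z Y"
      using D1_split[of a b] by (simp add: ext_d_Dv[OF assms] Y algebra_simps)
  qed
  fix V assume V: "\<forall>Y. ext_d (Dv F) z V Y = - (m - 1) * dirder F z Y"
  obtain a b where ab: "V = (a, b)" by fastforce
  have "g z \<eta> (a - snd z) = 0" for \<eta>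
  proof -
    have "- g z \<eta> a = - (m - 1) * dirder F z (0, \<eta>)"
      using V[rule_format, of "(0, \<eta>)"]
      by (simp add: ext_d_Dv[OF assms] ab g_def D2_0 zero_prod_def[symmetric])
    also have "\<dots> = - g z \<eta> (snd z)"
      using euler2_vertical[OF assms, of \<eta>] by (simp add: g_def algebra_simps)
    finally show ?thesis
      by (simp add: bilinear_rsub[OF bilinear_g[OF assms]])
  qed
  then have a: "a = snd z"
    using g_nondegenerate[OF assms] by fastforce
  have "g z \<eta> (b - u z) = 0" for \<eta>
  proof -
    have "D2 z (a, b) (0, \<eta>) - D2 z (\<eta>, 0) (0, a) = - (m - 1) * dirder F z (\<eta>, 0)"
      using V[rule_format, of "(\<eta>, 0)"] by (simp add: ext_d_Dv[OF assms] ab)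
    moreover have "D2 z (\<eta>, 0) (0, a) = m * dirder F z (\<eta>, 0)"
      using euler2[OF assms, of "(\<eta>, 0)"] linear_0[OF linear_D1[OF assms]] by (simp add: a zero_prod_def)
    moreover have "D2 z (a, b) (0, \<eta>) = D2 z (snd z, 0) (0, \<eta>) + g z \<eta> b"
      by (simp add: D2_split(1)[OF assms, of "snd z" b] g_def a D2_sym[OF assms, of "(0, b)"])
    ultimately have "g z \<eta> b = g z \<eta> (u z)"
      using g_u[OF assms, of \<eta>] by (simp add: algebra_simps)
    then show ?thesis
      by (simp add: bilinear_rsub[OF bilinear_g[OF assms]])
  qed
  then have "b = u z"
    using g_nondegenerate[OF assms] by fastforce
  with a ab show "V = (snd z, u z)" by simp
qed

section \<open>Fibre derivatives of the spray coefficients and the Lie derivative of the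
  metric\<close>

abbreviation du :: "'n pt \<Rightarrow> 'n pt \<Rightarrow> real ^ 'n" where
  "du z \<equiv> dirder u z"

lemma has_derivative_u: "z \<in> \<Omega> \<Longrightarrow> (u has_derivative du z) (at z)"
  by (rule smooth_on_has_derivative[OF smooth_u])

lemma has_derivative_spray:
  assumes "z \<in> \<Omega>"
  shows "(spray F m has_derivative (\<lambda>X. (snd X, du z X))) (at z)"
proof -
  have "((\<lambda>z. (snd z, u z)) has_derivative (\<lambda>X. (snd X, du z X))) (at z)"
    by (auto intro!: derivative_eq_intros has_derivative_u assms)
  then show ?thesis
    by (rule has_derivative_transform_within_open[OF _ open_\<Omega> assms]) (simp add: spray_eq)
qed

text \<open>Implicit differentiation of \<open>g_u\<close> along the fibre vector
  \<open>\<zeta>\<close>. The formula for the Lie derivative and both homogeneity relations for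
  \<open>u\<close> are special cases or symmetrizations of this identity.\<close>

lemma g_du:
  assumes "z \<in> \<Omega>"
  shows "D3 z (0, \<zeta>) (0, \<eta>) (0, u z) + g z \<eta> (du z (0, \<zeta>)) =
    D2 z (0, \<zeta>) (\<eta>, 0) - D3 z (0, \<zeta>) (snd z, 0) (0, \<eta>) - D2 z (\<zeta>, 0) (0, \<eta>)"
proof -
  have du0: "((\<lambda>y. (0::real ^ 'n, u y)) has_derivative (\<lambda>X. (0, du z X))) (at z)"
    by (auto intro!: derivative_eq_intros has_derivative_u assms)
  have s: "((\<lambda>y. (snd y, 0::real ^ 'n)) has_derivative (\<lambda>t. (snd t, 0))) (at z)"
    by (auto intro!: derivative_eq_intros)
  have "((\<lambda>y. D2 y (0, \<eta>) (0, u y)) has_derivative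
     (\<lambda>X. D3 z X (0, \<eta>) (0, u z) + D2 z 0 (0, u z) + D2 z (0, \<eta>) (0, du z X))) (at z)"
    by (rule has_derivative_D2_field[OF assms has_derivative_const du0])
  moreover have "((\<lambda>y. D2 y (0, \<eta>) (0, u y)) has_derivative
     (\<lambda>X. D2 z X (\<eta>, 0) - (D3 z X (snd z, 0) (0, \<eta>) + D2 z (snd X, 0) (0, \<eta>)
       + D2 z (snd z, 0) 0))) (at z)"
  proof -
    have "((\<lambda>y. dirder F y (\<eta>, 0) - D2 y (snd y, 0) (0, \<eta>)) has_derivative
     (\<lambda>X. D2 z X (\<eta>, 0) - (D3 z X (snd z, 0) (0, \<eta>) + D2 z (snd X, 0) (0, \<eta>)
       + D2 z (snd z, 0) 0))) (at z)"
      by (intro has_derivative_diff has_derivative_D1 assms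
          has_derivative_D2_field[OF assms s has_derivative_const])
    then show ?thesis
      by (rule has_derivative_transform_within_open[OF _ open_\<Omega> assms])
        (use g_u in \<open>simp add: g_def\<close>)
  qed
  ultimately have "D3 z (0, \<zeta>) (0, \<eta>) (0, u z) + D2 z 0 (0, u z) + D2 z (0, \<eta>) (0, du z (0, \<zeta>))
    = D2 z (0, \<zeta>) (\<eta>, 0) - (D3 z (0, \<zeta>) (snd z, 0) (0, \<eta>) + D2 z (snd (0::real ^ 'n, \<zeta>), 0) (0, \<eta>)
       + D2 z (snd z, 0) 0)"
    by (rule has_derivative_unique[THEN fun_cong])
  then show ?thesis
    using bilinear_rzero[OF bilinear_D2[OF assms]] bilinear_lzero[OF bilinear_D2[OF assms]]
    by (simp add: g_def)
qed

text \<open>Adding \<open>g_du\<close> for the pairs \<open>\<xi>, \<eta>\<close> and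
  \<open>\<eta>, \<xi>\<close> cancels the mixed second derivatives, which are antisymmetric in the
  pair, while the third derivatives are symmetric and double.\<close>

lemma D3_spray:
  assumes "z \<in> \<Omega>"
  shows "D3 z (snd z, u z) (0, \<xi>) (0, \<eta>) =
    - (1/2) * (g z (du z (0, \<xi>)) \<eta> + g z \<xi> (du z (0, \<eta>)))"
proof -
  have split: "D3 z (snd z, u z) Y Z = D3 z (snd z, 0) Y Z + D3 z (0, u z) Y Z" for Y Z
    using D3_add1[OF assms, of "(snd z, 0)" "(0, u z)"] by simp
  have "D3 z (0, \<eta>) (0, \<xi>) (0, u z) = D3 z (0, u z) (0, \<xi>) (0, \<eta>)"
     "D3 z (0, \<xi>) (0, \<eta>) (0, u z) = D3 z (0, u z) (0, \<xi>) (0, \<eta>)"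
     "D3 z (0, \<eta>) (snd z, 0) (0, \<xi>) = D3 z (snd z, 0) (0, \<xi>) (0, \<eta>)"
     "D3 z (0, \<xi>) (snd z, 0) (0, \<eta>) = D3 z (snd z, 0) (0, \<xi>) (0, \<eta>)"
    using D3_sym12[OF assms] D3_sym23[OF assms] by metis+
  with g_du[OF assms, of \<eta> \<xi>] g_du[OF assms, of \<xi> \<eta>] split[of "(0, \<xi>)" "(0, \<eta>)"]
    D2_sym[OF assms, of "(0, \<xi>)" "(\<eta>, 0)"] D2_sym[OF assms, of "(0, \<eta>)" "(\<xi>, 0)"]
    g_sym[OF assms, of "du z (0, \<xi>)" \<eta>]
  have "2 * D3 z (snd z, u z) (0, \<xi>) (0, \<eta>) = - (g z (du z (0, \<xi>)) \<eta> + g z \<xi> (du z (0, \<eta>)))"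
    by linarith
  then show ?thesis by (simp add: field_simps)
qed

text \<open>The base component of the spray is the fibre coordinate, so the bracket terms contribute
  \<open>snd X\<close> and \<open>snd Y\<close>; the derivative of the components of the metric
  contributes the \<open>du\<close> terms together with their factor 1/2.\<close>

lemma lie_form_g_h:
  assumes "z \<in> \<Omega>"
  shows "lie_form (spray F m) (g_h F) z X Y =
    g z (snd X - (1/2) *\<^sub>R du z (0, fst X)) (fst Y) + g z (fst X) (snd Y - (1/2) *\<^sub>R du z (0, fst Y))"
proof -
  note dV = dirder_eq[OF has_derivative_spray[OF assms]]
  have "dirder (\<lambda>y. g_h F y X Y) z = dirder (\<lambda>y. D2 y (0, fst X) (0, fst Y)) z"
    by (rule dirder_cong[OF open_\<Omega> assms]) (simp add: g_h_eq g_def)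
  then have "dirder (\<lambda>y. g_h F y X Y) z (spray F m z)
      = - (1/2) * (g z (du z (0, fst X)) (fst Y) + g z (fst X) (du z (0, fst Y)))"
    using D3_spray[OF assms] by (simp add: spray_eq[OF assms] D3_def)
  then show ?thesis
    using bilinear_g[OF assms]
    by (simp add: lie_form_def lie_bracket_const dV g_h_eq[OF assms] bilinear_lneg bilinear_rneg
        bilinear_lsub bilinear_rsub bilinear_lmul bilinear_rmul add_divide_distrib)
qed

text \<open>In the sum of the identity and the Lie derivative of \<open>lam\<close> the base
  components cancel, \<open>snd X\<close> occurs twice and \<open>du z (0, fst X)\<close> once.
  Hence the 1/2 survives only in front of \<open>du\<close>.\<close>

lemma vert_proj_eq:
  assumes "z \<in> \<Omega>"
  shows "vert_proj F m z X = (0, snd X - (1/2) *\<^sub>R du z (0, fst X))"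
proof -
  note dV = dirder_eq[OF has_derivative_spray[OF assms]]
  show ?thesis
    by (simp add: vert_proj_def lie_endo_def lie_bracket_const lam_def dV prod_eq_iff)
      (simp add: vec_eq_iff field_simps)
qed

text \<open>The infinitesimal form of the fact that \<open>u\<close> has degree 2 in the fibre,
  obtained from \<open>g_du\<close> with the radial vector as \<open>\<zeta>\<close>. Reducing the
  third derivatives by \<open>euler3\<close> makes the degree \<open>m\<close> drop out.\<close>

lemma du_homogeneous:
  assumes "z \<in> \<Omega>"
  shows "du z (0, snd z) = 2 *\<^sub>R u z"
proof -
  have "g z \<eta> (du z (0, snd z) - 2 *\<^sub>R u z) = 0" for \<eta>
  proof -
    have "D3 z (0, snd z) (0, \<eta>) (0, u z) = (m - 2) * g z \<eta> (u z)"
      using euler3[OF assms, of "(0, \<eta>)" "(0, u z)"] D3_sym12[OF assms] D3_sym23[OF assms]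
        D2_sym[OF assms, of "(0, u z)"]
      by (simp add: g_def algebra_simps)
    moreover have "D2 z (0, snd z) (\<eta>, 0) = m * dirder F z (\<eta>, 0)"
      using euler2[OF assms, of "(\<eta>, 0)"] linear_0[OF linear_D1[OF assms]]
      by (simp add: D2_sym[OF assms, of "(0, snd z)"] zero_prod_def)
    moreover have "D3 z (0, snd z) (snd z, 0) (0, \<eta>) = (m - 1) * D2 z (snd z, 0) (0, \<eta>)"
      using euler3[OF assms, of "(snd z, 0)" "(0, \<eta>)"] D3_sym12[OF assms] D3_sym23[OF assms]
        bilinear_rzero[OF bilinear_D2[OF assms]]
      by (simp add: zero_prod_def[symmetric] algebra_simps)
    ultimately show ?thesis
      using g_du[OF assms, of "snd z" \<eta>] g_u[OF assms, of \<eta>] bilinear_g[OF assms]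
      by (simp add: bilinear_rsub bilinear_rmul algebra_simps)
  qed
  then show ?thesis
    using g_nondegenerate[OF assms] by fastforce
qed

text \<open>The other contraction of \<open>g_du\<close> with the radial vector, now in the slot
  \<open>\<eta>\<close>. It is what will place the image of \<open>P_s\<close> in the orthogonal
  complement of \<open>k\<close>.\<close>

lemma g_snd_du:
  assumes "z \<in> \<Omega>"
  shows "g z (snd z) (du z (0, \<zeta>)) = - (2 * (m - 1)) * dirder F z (\<zeta>, 0)"
proof -
  have "D3 z (0, \<zeta>) (0, snd z) (0, u z) = (m - 2) * g z \<zeta> (u z)"
    using euler3[OF assms, of "(0, \<zeta>)" "(0, u z)"] D3_sym12[OF assms] D3_sym23[OF assms]
      D2_sym[OF assms, of "(0, u z)"]
    by (simp add: g_def algebra_simps)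
  moreover have "D3 z (0, \<zeta>) (snd z, 0) (0, snd z) = (m - 1) * D2 z (snd z, 0) (0, \<zeta>)"
    using euler3[OF assms, of "(0, \<zeta>)" "(snd z, 0)"] D2_sym[OF assms, of "(0, \<zeta>)"]
      bilinear_rzero[OF bilinear_D2[OF assms]]
    by (simp add: zero_prod_def[symmetric] algebra_simps)
  moreover have "D2 z (\<zeta>, 0) (0, snd z) = m * dirder F z (\<zeta>, 0)"
    using euler2[OF assms, of "(\<zeta>, 0)"] linear_0[OF linear_D1[OF assms]]
    by (simp add: zero_prod_def)
  ultimately show ?thesis
    using g_du[OF assms, of \<zeta> "snd z"] g_u[OF assms, of \<zeta>] D2_sym[OF assms, of "(0, \<zeta>)" "(snd z, 0)"]
    by (simp add: algebra_simps)
qed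

lemma g_snd: "z \<in> \<Omega> \<Longrightarrow> g z (snd z) \<xi> = (m - 1) * dirder F z (0, \<xi>)"
  using euler2_vertical g_sym by (simp add: g_def)

end

section \<open>Traces on the quotient by a null vector\<close>

lemma rep_coset:
  assumes "subspace N"
  obtains w where "w \<in> N" "rep (coset N v) = v + w"
proof -
  have "v \<in> coset N v"
    using subspace_0[OF assms] by (force simp: coset_def)
  then have "rep (coset N v) \<in> coset N v"
    unfolding rep_def by (rule someI)
  then show thesis using that by (auto simp: coset_def)
qed

lemma coset_eq_iff:
  assumes "subspace N"
  shows "coset N v = coset N w \<longleftrightarrow> v - w \<in> N"
proof
  assume "coset N v = coset N w"
  moreover have "v \<in> coset N v"
    using subspace_0[OF assms] by (force simp: coset_def)
  ultimately show "v - w \<in> N" by (auto simp: coset_def)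
next
  assume vw: "v - w \<in> N"
  have "x \<in> coset N v \<longleftrightarrow> x - v \<in> N" for x v
    unfolding coset_def by (auto intro!: exI[of _ "x - v"])
  moreover have "x - v \<in> N \<longleftrightarrow> x - w \<in> N" for x
    using subspace_add[OF assms, of "x - v" "v - w"] subspace_diff[OF assms, of "x - w" "v - w"] vw
    by (auto simp: algebra_simps)
  ultimately show "coset N v = coset N w" by blast
qed

lemma coset_rep: "subspace N \<Longrightarrow> C \<in> quot V N \<Longrightarrow> coset N (rep C) = C"
  unfolding quot_def by (metis (no_types, lifting) add_diff_cancel_left' coset_eq_iff imageE rep_coset)

lemma rep_in:
  assumes "subspace N" "subspace V" "N \<subseteq> V" "C \<in> quot V N"
  shows "rep C \<in> V"
proof -
  obtain v where "v \<in> V" "C = coset N v" using assms(4) by (auto simp: quot_def)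
  moreover obtain w where "w \<in> N" "rep (coset N v) = v + w"
    using rep_coset[OF assms(1)] .
  ultimately show ?thesis using assms(2,3) by (auto intro: subspace_add)
qed

lemma q_lin2_coset:
  assumes "subspace N" "E C = coset N x" "E' C = coset N y"
  shows "q_lin2 N a E b E' C = coset N (a *\<^sub>R x + b *\<^sub>R y)"
proof -
  obtain w w' where w: "w \<in> N" "rep (coset N x) = x + w" "w' \<in> N" "rep (coset N y) = y + w'"
    using rep_coset[OF assms(1)] by metis
  then have "a *\<^sub>R w + b *\<^sub>R w' \<in> N"
    using assms(1) by (simp add: subspace_add subspace_scale)
  then show ?thesis
    by (simp add: q_lin2_def assms(2,3) w coset_eq_iff[OF assms(1)] algebra_simps)
qed

text \<open>The Euclidean orthogonal complement of \<open>N\<close> inside \<open>V\<close> is a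
  transversal, so a basis of it projects to a basis of the quotient. The inner product is auxiliary
  and unrelated to the form that the quotient carries later.\<close>

lemma q_basis_exists:
  fixes V N :: "'a::euclidean_space set"
  assumes V: "subspace V" and N: "subspace N" and "N \<subseteq> V"
  obtains B where "q_basis V N B"
proof -
  define V' where "V' = {y \<in> V. \<forall>w\<in>N. w \<bullet> y = 0}"
  have V': "subspace V'"
    using V unfolding V'_def subspace_def by (auto simp: inner_add_right)
  have trivial: "y = 0" if "y \<in> V'" "y \<in> N" for y
    using that by (auto simp: V'_def)
  obtain B0 where B0: "B0 \<subseteq> V'" "independent B0" "V' \<subseteq> span B0"
    using maximal_independent_subset[of V'] by metis
  have fin: "finite B0" using B0(2) by (rule independent_imp_finite)
  have span_B0: "(\<Sum>b\<in>B0. c b *\<^sub>R b) \<in> V'" for c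
    using B0(1) V' by (intro subspace_sum subspace_scale) auto
  have inj: "inj_on (coset N) B0"
    by (intro inj_onI)
      (metis B0(1) coset_eq_iff[OF N] eq_iff_diff_eq_0 in_mono subspace_diff[OF V'] trivial)
  define B where "B = coset N ` B0"
  have lincomb: "q_lincomb N B r = coset N (\<Sum>b\<in>B0. r (coset N b) *\<^sub>R b)" for r
  proof -
    have "(\<Sum>b\<in>B. r b *\<^sub>R rep b) = (\<Sum>b\<in>B0. r (coset N b) *\<^sub>R rep (coset N b))"
      unfolding B_def by (simp add: sum.reindex[OF inj])
    moreover have "rep (coset N b) - b \<in> N" for b
      using rep_coset[OF N] by (metis add_diff_cancel_left')
    then have "(\<Sum>b\<in>B0. r (coset N b) *\<^sub>R (rep (coset N b) - b)) \<in> N"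
      using N by (intro subspace_sum subspace_scale) auto
    ultimately show ?thesis
      by (simp add: q_lincomb_def coset_eq_iff[OF N] scaleR_diff_right sum_subtractf)
  qed
  have "\<exists>!r. (\<forall>b. b \<notin> B \<longrightarrow> r b = 0) \<and> C = q_lincomb N B r" if C: "C \<in> quot V N" for C
  proof -
    obtain v where v: "v \<in> V" "C = coset N v" using C by (auto simp: quot_def)
    obtain y z where yz: "y \<in> span N" "\<And>w. w \<in> span N \<Longrightarrow> orthogonal z w" "v = y + z"
      using orthogonal_subspace_decomp_exists[of N v] by blast
    have "span N = N" using N by (simp add: span_eq_iff)
    with yz have "y \<in> N" "z \<in> V'"
      using v(1) assms(3) subspace_diff[OF V, of v y]
      by (auto simp: V'_def orthogonal_def inner_commute)
    then obtain c where c: "z = (\<Sum>b\<in>B0. c b *\<^sub>R b)"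
      using B0(3) fin by (auto simp: span_finite)
    \<comment> \<open>The value 0 off \<open>B\<close> is the normalization that makes the
      coefficient function unique in \<open>q_basis\<close>.\<close>
    define r where "r = (\<lambda>C. if C \<in> B then c (the_inv_into B0 (coset N) C) else 0)"
    have "(\<Sum>b\<in>B0. r (coset N b) *\<^sub>R b) = z"
      unfolding c by (rule sum.cong) (auto simp: r_def B_def the_inv_into_f_f[OF inj])
    then have "C = q_lincomb N B r"
      using \<open>y \<in> N\<close> yz(3) by (simp add: lincomb v(2) coset_eq_iff[OF N])
    moreover have "r' = r"
      if r': "\<forall>b. b \<notin> B \<longrightarrow> r' b = 0" "C = q_lincomb N B r'" for r'
    proof
      fix b
      have "(\<Sum>b\<in>B0. r' (coset N b) *\<^sub>R b) - (\<Sum>b\<in>B0. r (coset N b) *\<^sub>R b) \<in> N"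
        using \<open>C = q_lincomb N B r\<close> r'(2) by (simp add: lincomb coset_eq_iff[OF N])
      then have "(\<Sum>b\<in>B0. (r' (coset N b) - r (coset N b)) *\<^sub>R b) \<in> N"
        by (simp add: scaleR_diff_left sum_subtractf)
      from trivial[OF span_B0 this]
      have "r' (coset N b) - r (coset N b) = 0" if "b \<in> B0" for b
        using independentD[OF B0(2) fin subset_refl, where u = "\<lambda>b. r' (coset N b) - r (coset N b)"] that
        by blast
      then show "r' b = r b"
        using r'(1) by (cases "b \<in> B") (auto simp: B_def r_def)
    qed
    ultimately show ?thesis
      by (intro ex1I[of _ r]) (auto simp: r_def)
  qed
  moreover have "B \<subseteq> quot V N"
    using B0(1) by (auto simp: B_def quot_def V'_def)
  ultimately have "q_basis V N B"
    using fin by (simp add: q_basis_def B_def)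
  then show thesis by (rule that)
qed

lemma q_coord_eqI:
  assumes "q_basis V N B" "C \<in> quot V N" "\<And>b. b \<notin> B \<Longrightarrow> r b = 0" "C = q_lincomb N B r"
  shows "q_coord N B C = r"
  unfolding q_coord_def using assms by (intro the1_equality) (auto simp: q_basis_def)

lemma q_coord:
  assumes "q_basis V N B" "C \<in> quot V N"
  shows "C = q_lincomb N B (q_coord N B C)" "b \<notin> B \<Longrightarrow> q_coord N B C b = 0"
proof -
  obtain r where "\<forall>b. b \<notin> B \<longrightarrow> r b = 0" "C = q_lincomb N B r"
    using assms unfolding q_basis_def by (metis (no_types, lifting))
  with q_coord_eqI[OF assms] show "C = q_lincomb N B (q_coord N B C)" "b \<notin> B \<Longrightarrow> q_coord N B C b = 0"
    by metis+
qed

lemma q_coord_coset: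
  assumes "subspace N" "q_basis V N B" "y \<in> V"
  shows "y - (\<Sum>b\<in>B. q_coord N B (coset N y) b *\<^sub>R rep b) \<in> N"
proof -
  have "coset N y \<in> quot V N" using assms(3) by (simp add: quot_def)
  from q_coord(1)[OF assms(2) this] show ?thesis
    by (simp add: q_lincomb_def coset_eq_iff[OF assms(1)])
qed

lemma q_coord_lincomb:
  assumes "subspace V" "subspace N" "q_basis V N B" "x \<in> V" "y \<in> V"
  shows "q_coord N B (coset N (a *\<^sub>R x + c *\<^sub>R y)) b =
    a * q_coord N B (coset N x) b + c * q_coord N B (coset N y) b"
proof -
  let ?q = "\<lambda>z. q_coord N B (coset N z)"
  have in_quot: "coset N z \<in> quot V N" if "z \<in> V" for z
    using that by (simp add: quot_def)
  have xy: "a *\<^sub>R x + c *\<^sub>R y \<in> V"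
    using assms by (simp add: subspace_add subspace_scale)
  have "a *\<^sub>R (x - (\<Sum>b\<in>B. ?q x b *\<^sub>R rep b)) + c *\<^sub>R (y - (\<Sum>b\<in>B. ?q y b *\<^sub>R rep b)) \<in> N"
    using assms q_coord_coset[OF assms(2,3)] by (intro subspace_add subspace_scale) auto
  then have "coset N (a *\<^sub>R x + c *\<^sub>R y) = q_lincomb N B (\<lambda>b. a * ?q x b + c * ?q y b)"
    by (simp add: q_lincomb_def coset_eq_iff[OF assms(2)] algebra_simps sum.distrib scaleR_sum_right)
  then have "?q (a *\<^sub>R x + c *\<^sub>R y) = (\<lambda>b. a * ?q x b + c * ?q y b)"
    using assms by (intro q_coord_eqI[OF assms(3) in_quot[OF xy]])
      (auto simp: q_coord(2)[OF assms(3) in_quot])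
  then show ?thesis by simp
qed

lemma q_coord_zero:
  assumes "subspace V" "subspace N" "q_basis V N B" "N \<subseteq> V" "w \<in> N"
  shows "q_coord N B (coset N w) b = 0"
proof -
  have "coset N w = coset N (0 *\<^sub>R w + 0 *\<^sub>R w)"
    using assms by (simp add: coset_eq_iff)
  then show ?thesis
    using q_coord_lincomb[OF assms(1-3), of w w 0 0 b] assms(4,5) by auto
qed

text \<open>The first hypothesis resolves the identity into rank one maps. Composing it with
  \<open>A\<close> and taking traces turns each summand into a functional evaluated at the image of
  its vector.\<close>

lemma trace_frame:
  fixes A :: "real ^ 'k::finite ^ 'k" and e1 e2 :: "real ^ 'k"
  assumes "\<And>x. x = (\<Sum>b\<in>B. \<phi> b x *\<^sub>R e b) + \<phi>1 x *\<^sub>R e1 + \<phi>2 x *\<^sub>R e2"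
    and lin: "\<And>b. b \<in> B \<Longrightarrow> linear (\<phi> b)" "linear \<phi>1" "linear \<phi>2"
  shows "trace A = (\<Sum>b\<in>B. \<phi> b (A *v e b)) + \<phi>1 (A *v e1) + \<phi>2 (A *v e2)"
proof -
  have expand: "\<psi> y = (\<Sum>j\<in>UNIV. y $ j * \<psi> (axis j 1))" if "linear \<psi>" for \<psi> :: "real ^ 'k \<Rightarrow> real" and y
  proof -
    have "y = (\<Sum>j\<in>UNIV. y $ j *\<^sub>R axis j 1)"
      by (rule vec_basis_sum)
    then have "\<psi> y = \<psi> (\<Sum>j\<in>UNIV. y $ j *\<^sub>R axis j 1)" by simp
    then show ?thesis by (simp add: linear_sum[OF that] linear_cmul[OF that])
  qed
  have "A $ j $ j = (\<Sum>b\<in>B. (A *v e b) $ j * \<phi> b (axis j 1))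
     + (A *v e1) $ j * \<phi>1 (axis j 1) + (A *v e2) $ j * \<phi>2 (axis j 1)" for j
  proof -
    have "A $ j $ j = (A *v axis j 1) $ j"
      by (simp add: matrix_vector_mult_basis column_def)
    also have "A *v axis j 1 = A *v ((\<Sum>b\<in>B. \<phi> b (axis j 1) *\<^sub>R e b)
        + \<phi>1 (axis j 1) *\<^sub>R e1 + \<phi>2 (axis j 1) *\<^sub>R e2)"
      using assms(1)[of "axis j 1"] by simp
    also have "\<dots> = (\<Sum>b\<in>B. \<phi> b (axis j 1) *\<^sub>R (A *v e b))
        + \<phi>1 (axis j 1) *\<^sub>R (A *v e1) + \<phi>2 (axis j 1) *\<^sub>R (A *v e2)"
      by (simp add: matrix_vector_right_distrib matrix_vector_mult_scaleR
          linear_sum[OF matrix_vector_mul_linear])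
    finally show ?thesis by (simp add: mult.commute)
  qed
  then have "trace A = (\<Sum>b\<in>B. \<Sum>j\<in>UNIV. (A *v e b) $ j * \<phi> b (axis j 1))
     + (\<Sum>j\<in>UNIV. (A *v e1) $ j * \<phi>1 (axis j 1)) + (\<Sum>j\<in>UNIV. (A *v e2) $ j * \<phi>2 (axis j 1))"
    unfolding trace_def by (simp add: sum.distrib sum.swap[of _ B])
  also have "\<dots> = (\<Sum>b\<in>B. \<phi> b (A *v e b)) + \<phi>1 (A *v e1) + \<phi>2 (A *v e2)"
    by (intro arg_cong2[where f = "(+)"] sum.cong refl expand[symmetric] lin)
  finally show ?thesis .
qed

lemma trace_scaleR: "trace (c *\<^sub>R (A :: real ^ 'k::finite ^ 'k)) = c * trace A"
  by (simp add: trace_def sum_distrib_left)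

text \<open>The mixed products cancel between the two squares even if \<open>A\<close> and
  \<open>B\<close> do not commute. With the adjoint of \<open>A\<close> as \<open>B\<close>, this
  separates the skew and the symmetric contribution to the trace of a square.\<close>

lemma matrix_polarization:
  fixes A B :: "real ^ 'k::finite ^ 'k"
  shows "((1/2) *\<^sub>R A - (1/2) *\<^sub>R B) ** ((1/2) *\<^sub>R A - (1/2) *\<^sub>R B)
    + ((1/2) *\<^sub>R A + (1/2) *\<^sub>R B) ** ((1/2) *\<^sub>R A + (1/2) *\<^sub>R B)
    = (1/2) *\<^sub>R (A ** A) + (1/2) *\<^sub>R (B ** B)"
proof -
  have *: "(1/2 * a - 1/2 * b) * (1/2 * c - 1/2 * d) + (1/2 * a + 1/2 * b) * (1/2 * c + 1/2 * d)
    = 1/2 * (a * c) + 1/2 * (b * d)" for a b c d :: real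
    by (simp add: field_simps)
  show ?thesis
    unfolding vec_eq_iff matrix_matrix_mult_def vector_add_component vec_lambda_beta
      vector_scaleR_component vector_minus_component real_scaleR_def sum.distrib[symmetric]
      sum_distrib_left *
    by simp
qed

text \<open>Linear algebra at a single point: \<open>\<Gamma>\<close> will be the Gram matrix of
  \<open>g_s\<close> and \<open>k\<close> the value of the associated field.\<close>

locale null_vector =
  fixes \<Gamma> :: "real ^ 'n::finite ^ 'n" and k :: "real ^ 'n"
  assumes sym_\<Gamma>: "transpose \<Gamma> = \<Gamma>" and inv_\<Gamma>: "invertible \<Gamma>"
    and null: "k \<bullet> (\<Gamma> *v k) = 0" and k_nonzero: "k \<noteq> 0"
begin

definition form :: "real ^ 'n \<Rightarrow> real ^ 'n \<Rightarrow> real" where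
  "form x y = x \<bullet> (\<Gamma> *v y)"

lemma form_sym: "form x y = form y x"
  unfolding form_def by (metis dot_lmul_matrix inner_commute sym_\<Gamma> transpose_matrix_vector)

lemma form_simps:
  "form (x + x') y = form x y + form x' y" "form (x - x') y = form x y - form x' y"
  "form (c *\<^sub>R x) y = c * form x y"
  "form x (y + y') = form x y + form x y'" "form x (y - y') = form x y - form x y'"
  "form x (c *\<^sub>R y) = c * form x y" "form 0 y = 0" "form x 0 = 0"
  by (simp_all add: form_def inner_add_left inner_diff_left inner_add_right inner_diff_right
      matrix_vector_right_distrib matrix_vector_mult_diff_distrib matrix_vector_mult_scaleR)

lemma form_nondegenerate: "(\<And>x. form x y = 0) \<Longrightarrow> y = 0"
proof -
  assume "\<And>x. form x y = 0"
  then have "\<Gamma> *v y = 0" unfolding form_def by (metis inner_eq_zero_iff)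
  then show "y = 0"
    using inv_\<Gamma> unfolding invertible_left_inverse matrix_left_invertible_ker by blast
qed

definition perp :: "(real ^ 'n) set" where "perp = {x. form k x = 0}"
definition line :: "(real ^ 'n) set" where "line = span {k}"

lemma subspace_perp: "subspace perp"
  by (auto simp: perp_def subspace_def form_simps)

lemma subspace_line: "subspace line"
  by (simp add: line_def)

lemma mem_line: "x \<in> line \<longleftrightarrow> (\<exists>c. x = c *\<^sub>R k)"
  by (auto simp: line_def span_singleton)

lemma line_subset: "line \<subseteq> perp"
proof -
  have "form k k = 0" using null by (simp add: form_def)
  then show ?thesis by (auto simp: mem_line perp_def form_simps)
qed

text \<open>A vector transversal to \<open>perp\<close>; subtracting \<open>form k x\<close> times
  \<open>l\<close> from \<open>x\<close> projects onto \<open>perp\<close>.\<close>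

definition l :: "real ^ 'n" where "l = (SOME l. form k l = 1)"

lemma form_k_l: "form k l = 1"
proof -
  obtain y where "form k y \<noteq> 0"
    using form_nondegenerate k_nonzero form_sym by metis
  then have "form k ((1 / form k y) *\<^sub>R y) = 1"
    by (simp add: form_simps)
  then show ?thesis unfolding l_def by (rule someI)
qed

text \<open>Every vector is an element of \<open>perp\<close> plus a multiple of \<open>l\<close>,
  so \<open>d - form l d *\<^sub>R k\<close> is orthogonal to everything. This is what determines an
  adjoint on the quotient uniquely, modulo \<open>line\<close>.\<close>

lemma perp_perp:
  assumes "\<And>y. y \<in> perp \<Longrightarrow> form y d = 0"
  shows "d \<in> line"
proof -
  have "form x (d - form l d *\<^sub>R k) = 0" for x
  proof -
    have "x - form k x *\<^sub>R l \<in> perp" by (simp add: perp_def form_simps form_k_l)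
    from assms[OF this] have "form x d = form k x * form l d" by (simp add: form_simps)
    then show ?thesis using form_sym[of x k] by (simp add: form_simps)
  qed
  from form_nondegenerate[OF this] have "d = form l d *\<^sub>R k" by simp
  then show ?thesis unfolding mem_line ..
qed

text \<open>The first condition lets \<open>A\<close> descend to the quotient, the second lets it
  preserve \<open>perp\<close>; together they ensure that no part of the trace is lost in the
  descent.\<close>

definition tame :: "real ^ 'n ^ 'n \<Rightarrow> bool" where
  "tame A \<longleftrightarrow> A *v k = 0 \<and> (\<forall>x. A *v x \<in> perp)"

text \<open>The scalar \<open>c\<close> is kept apart from \<open>A\<close> because the identity,
  which does not kill \<open>k\<close>, is not tame.\<close>

definition induces :: "real ^ 'n ^ 'n \<Rightarrow> real \<Rightarrow> ((real ^ 'n) set \<Rightarrow> (real ^ 'n) set) \<Rightarrow> bool" where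
  "induces A c E \<longleftrightarrow> tame A \<and> (\<forall>C\<in>quot perp line. E C = coset line (A *v rep C + c *\<^sub>R rep C))"

lemma tame_linear:
  assumes "tame A" "tame A'"
  shows "tame (a *\<^sub>R A + b *\<^sub>R A')"
proof -
  have "(a *\<^sub>R A + b *\<^sub>R A') *v x = a *\<^sub>R (A *v x) + b *\<^sub>R (A' *v x)" for x
    by (simp add: matrix_vector_mult_add_rdistrib scaleR_matrix_vector_assoc)
  then show ?thesis
    using assms subspace_perp by (simp add: tame_def subspace_add subspace_scale)
qed

lemma tame_mult: "tame A \<Longrightarrow> tame A' \<Longrightarrow> tame (A ** A')"
  by (simp add: tame_def flip: matrix_vector_mul_assoc)

text \<open>A basis of the quotient is completed by \<open>k\<close> and \<open>l\<close> to a frame of the whole space.\<close>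

lemma q_trace_induces:
  assumes "induces A c E"
  shows "q_trace perp line E = trace A + c * (real CARD('n) - 2)"
proof -
  define B where "B = (SOME B. q_basis perp line B)"
  have B: "q_basis perp line B"
    unfolding B_def using q_basis_exists[OF subspace_perp subspace_line line_subset] someI by metis
  let ?q = "\<lambda>b z. q_coord line B (coset line z) b"
  note lincomb = q_coord_lincomb[OF subspace_perp subspace_line B]
  define pr where "pr = (\<lambda>x. x - form k x *\<^sub>R l)"
  have pr: "pr x \<in> perp" "linear pr" for x
    by (simp_all add: pr_def perp_def form_simps form_k_l linear_iff algebra_simps)
  have pr_id: "x \<in> perp \<Longrightarrow> pr x = x" for x by (simp add: pr_def perp_def)
  have lin_q: "linear (\<lambda>x. ?q b (pr x))" for b
  proof (rule linearI)
    fix x y r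
    show "?q b (pr (x + y)) = ?q b (pr x) + ?q b (pr y)"
      using lincomb[OF pr(1) pr(1), of 1 x 1 y] by (simp add: linear_add[OF pr(2)])
    show "?q b (pr (r *\<^sub>R x)) = r *\<^sub>R ?q b (pr x)"
      using lincomb[OF pr(1) pr(1), of r x 0 x] by (simp add: linear_cmul[OF pr(2)])
  qed
  \<comment> \<open>The coefficient of \<open>k\<close> in the frame. The bracketed vector is a
    multiple of \<open>k\<close>, so the Euclidean product with \<open>k\<close> recovers the factor
    by an expression that is linear in \<open>x\<close>.\<close>
  define \<kappa> where "\<kappa> = (\<lambda>x. (pr x - (\<Sum>b\<in>B. ?q b (pr x) *\<^sub>R rep b)) \<bullet> k / (k \<bullet> k))"
  have lin_\<kappa>: "linear \<kappa>"
  proof (rule linearI)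
    fix x y r
    show "\<kappa> (x + y) = \<kappa> x + \<kappa> y"
      unfolding \<kappa>_def linear_add[OF lin_q] unfolding linear_add[OF pr(2)]
      by (simp add: scaleR_add_left sum.distrib inner_add_left inner_diff_left add_divide_distrib
          diff_divide_distrib)
    show "\<kappa> (r *\<^sub>R x) = r *\<^sub>R \<kappa> x"
      unfolding \<kappa>_def linear_cmul[OF lin_q] unfolding linear_cmul[OF pr(2)]
      by (simp add: inner_diff_left right_diff_distrib flip: scaleR_scaleR scaleR_sum_right)
  qed
  have lin_g: "linear (form k)" by (auto intro!: linearI simp: form_simps)
  have frame: "x = (\<Sum>b\<in>B. ?q b (pr x) *\<^sub>R rep b) + \<kappa> x *\<^sub>R k + form k x *\<^sub>R l" for x
  proof -
    obtain a where a: "pr x - (\<Sum>b\<in>B. ?q b (pr x) *\<^sub>R rep b) = a *\<^sub>R k"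
      using q_coord_coset[OF subspace_line B pr(1)] mem_line by metis
    then have "\<kappa> x = a" using k_nonzero by (simp add: \<kappa>_def)
    with a show ?thesis by (simp add: pr_def algebra_simps)
  qed
  note tr = trace_frame[where B = B and \<phi> = "\<lambda>b x. ?q b (pr x)" and e = rep and ?\<phi>1.0 = \<kappa> and ?e1.0 = k
      and ?\<phi>2.0 = "form k" and ?e2.0 = l, OF frame lin_q lin_\<kappa> lin_g]
  have A: "tame A" "\<And>C. C \<in> quot perp line \<Longrightarrow> E C = coset line (A *v rep C + c *\<^sub>R rep C)"
    using assms by (auto simp: induces_def)
  have kN: "k \<in> line" unfolding mem_line by (metis scaleR_one)
  have "?q b k = 0" for b
    by (rule q_coord_zero[OF subspace_perp subspace_line B line_subset kN])
  moreover have "pr k = k" using kN line_subset pr_id by blast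
  ultimately have "\<kappa> k = 1" using k_nonzero by (simp add: \<kappa>_def)
  have Brep: "b \<in> quot perp line" "rep b \<in> perp" if "b \<in> B" for b
    using that B rep_in[OF subspace_line subspace_perp line_subset] by (auto simp: q_basis_def)
  \<comment> \<open>The vector \<open>k\<close> contributes nothing since \<open>A\<close> kills it,
    and \<open>l\<close> nothing since \<open>A\<close> maps into the kernel of
    \<open>form k\<close>.\<close>
  have "trace A = (\<Sum>b\<in>B. ?q b (A *v rep b))"
    using A(1) by (simp add: tr[of A] tame_def pr_id perp_def linear_0[OF lin_\<kappa>])
  \<comment> \<open>The same trace formula for the identity counts the frame: \<open>k\<close> and
    \<open>l\<close> account for the 2.\<close>
  moreover have "real CARD('n) = (\<Sum>b\<in>B. ?q b (rep b)) + 2"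
    using tr[of "mat 1"] Brep \<open>\<kappa> k = 1\<close> by (simp add: trace_I pr_id form_k_l)
  moreover have "q_trace perp line E = (\<Sum>b\<in>B. ?q b (A *v rep b) + c * ?q b (rep b))"
    unfolding q_trace_def Let_def B_def[symmetric]
  proof (rule sum.cong[OF refl])
    fix b assume "b \<in> B"
    have "A *v rep b \<in> perp" using A(1) by (simp add: tame_def)
    from lincomb[OF this Brep(2)[OF \<open>b \<in> B\<close>], of 1 c b]
    show "q_coord line B (E b) b = ?q b (A *v rep b) + c * ?q b (rep b)"
      by (simp add: A(2)[OF Brep(1)[OF \<open>b \<in> B\<close>]])
  qed
  ultimately show ?thesis
    by (simp add: sum.distrib sum_distrib_left)
qed

text \<open>This is the square of \<open>A + c\<close>. The representative of \<open>E C\<close> is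
  determined only up to a multiple of \<open>k\<close>, but \<open>A\<close> kills that error and
  the scalar part keeps it in \<open>line\<close>.\<close>

lemma induces_comp:
  assumes "induces A c E"
  shows "induces (A ** A + (2 * c) *\<^sub>R A) (c * c) (E \<circ> E)"
proof -
  have A: "tame A" "\<And>C. C \<in> quot perp line \<Longrightarrow> E C = coset line (A *v rep C + c *\<^sub>R rep C)"
    using assms by (auto simp: induces_def)
  have "tame (1 *\<^sub>R (A ** A) + (2 * c) *\<^sub>R A)"
    by (intro tame_linear tame_mult A)
  moreover have "(E \<circ> E) C = coset line ((A ** A + (2 * c) *\<^sub>R A) *v rep C + (c * c) *\<^sub>R rep C)"
    if C: "C \<in> quot perp line" for C
  proof -
    let ?x = "rep C"
    have x: "?x \<in> perp" using rep_in[OF subspace_line subspace_perp line_subset C] .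
    have "A *v ?x + c *\<^sub>R ?x \<in> perp"
      using A(1) x subspace_perp by (simp add: tame_def subspace_add subspace_scale)
    then have EC: "E C \<in> quot perp line" by (simp add: A(2)[OF C] quot_def)
    obtain w where "w \<in> line" "rep (E C) = A *v ?x + c *\<^sub>R ?x + w"
      using rep_coset[OF subspace_line] A(2)[OF C] by metis
    then obtain t where t: "rep (E C) = A *v ?x + c *\<^sub>R ?x + t *\<^sub>R k"
      by (auto simp: mem_line)
    have 1: "A *v rep (E C) = A *v (A *v ?x) + c *\<^sub>R (A *v ?x)"
      using A(1) by (simp add: t tame_def matrix_vector_right_distrib matrix_vector_mult_scaleR)
    have 2: "(A ** A + (2 * c) *\<^sub>R A) *v ?x = A *v (A *v ?x) + c *\<^sub>R (A *v ?x) + c *\<^sub>R (A *v ?x)"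
      by (simp only: matrix_vector_mult_add_rdistrib matrix_vector_mul_assoc mult_2
          scaleR_matrix_vector_assoc[symmetric] scaleR_add_left add.assoc)
    have "A *v rep (E C) + c *\<^sub>R rep (E C)
      - ((A ** A + (2 * c) *\<^sub>R A) *v ?x + (c * c) *\<^sub>R ?x) = (c * t) *\<^sub>R k"
      unfolding 1 2 unfolding t by (simp add: scaleR_add_right)
    then show ?thesis
      unfolding comp_def A(2)[OF EC] coset_eq_iff[OF subspace_line] mem_line by blast
  qed
  ultimately show ?thesis by (simp add: induces_def)
qed

section \<open>Adjoints and the decomposition into skew, trace-free symmetric and trace part\<close>

definition adj :: "real ^ 'n ^ 'n \<Rightarrow> real ^ 'n ^ 'n" where
  "adj A = matrix_inv \<Gamma> ** transpose A ** \<Gamma>"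

lemma matrix_inv_\<Gamma>: "\<Gamma> ** matrix_inv \<Gamma> = mat 1" "matrix_inv \<Gamma> ** \<Gamma> = mat 1"
  using someI_ex[OF inv_\<Gamma>[unfolded invertible_def]] unfolding matrix_inv_def by blast+

lemma form_adj: "form (A *v x) y = form x (adj A *v y)"
proof -
  have "\<Gamma> ** adj A = transpose A ** \<Gamma>"
    unfolding adj_def by (simp add: matrix_mul_assoc matrix_inv_\<Gamma>)
  then have "\<Gamma> *v (adj A *v y) = transpose A *v (\<Gamma> *v y)"
    by (simp add: matrix_vector_mul_assoc)
  then show ?thesis
    unfolding form_def by (metis dot_lmul_matrix transpose_transpose transpose_matrix_vector)
qed

lemma trace_conj: "trace (matrix_inv \<Gamma> ** A ** \<Gamma>) = trace A"
  using trace_mul_sym[of "matrix_inv \<Gamma> ** A" \<Gamma>] by (simp add: matrix_mul_assoc matrix_inv_\<Gamma>)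

lemma trace_adj: "trace (adj A) = trace A"
  unfolding adj_def trace_conj by (simp add: trace_def transpose_def)

lemma adj_mult: "adj A ** adj A = adj (A ** A)"
proof -
  have "adj A ** adj A = matrix_inv \<Gamma> ** transpose A ** (\<Gamma> ** matrix_inv \<Gamma>) ** transpose A ** \<Gamma>"
    by (simp add: adj_def matrix_mul_assoc)
  also have "\<dots> = adj (A ** A)"
    by (simp add: adj_def matrix_inv_\<Gamma> matrix_transpose_mul matrix_mul_assoc)
  finally show ?thesis .
qed

text \<open>Taking adjoints exchanges the two conditions of \<open>tame\<close>: an image inside
  \<open>perp\<close> becomes the killing of \<open>k\<close>, and conversely.\<close>

lemma tame_adj:
  assumes "tame A"
  shows "tame (adj A)"
proof -
  have "form x (adj A *v k) = 0" for x
    using assms form_sym by (simp add: tame_def perp_def flip: form_adj)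
  then have "adj A *v k = 0" by (rule form_nondegenerate)
  moreover have "form k (adj A *v x) = 0" for x
    using assms by (simp add: tame_def form_simps flip: form_adj)
  ultimately show ?thesis by (simp add: tame_def perp_def)
qed

lemma induces_q_endo: "tame A \<Longrightarrow> induces A 0 (q_endo line ((*v) A))"
  by (simp add: induces_def q_endo_def)

lemma form_rep_coset:
  assumes "y \<in> perp"
  shows "form (rep (coset line x)) y = form x y" "form y (rep (coset line x)) = form y x"
proof -
  obtain c where "rep (coset line x) = x + c *\<^sub>R k"
    using rep_coset[OF subspace_line] mem_line by metis
  then show "form (rep (coset line x)) y = form x y" "form y (rep (coset line x)) = form y x"
    using assms form_sym[of y k] by (simp_all add: form_simps perp_def)
qed

text \<open>On \<open>perp\<close> the values of the form do not depend on representatives, so the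
  matrix adjoint descends and satisfies the defining relation. Uniqueness is
  \<open>perp_perp\<close>: the form restricted to \<open>perp\<close> degenerates only along
  \<open>line\<close>.\<close>

lemma q_adjoint_eq:
  assumes "tame A" "D \<in> quot perp line"
  shows "q_adjoint perp line (q_form form) (q_endo line ((*v) A)) D = coset line (adj A *v rep D)"
  unfolding q_adjoint_def
proof (rule the_equality)
  have repV: "rep C \<in> perp" if "C \<in> quot perp line" for C
    using rep_in[OF subspace_line subspace_perp line_subset that] .
  have main: "q_form form (q_endo line ((*v) A) C) D = form (rep C) (adj A *v rep D)" if "C \<in> quot perp line" for C
    by (simp add: q_form_def q_endo_def form_rep_coset(1)[OF repV[OF assms(2)]] form_adj)
  have "adj A *v rep D \<in> perp" using tame_adj[OF assms(1)] by (simp add: tame_def)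
  moreover have "coset line (adj A *v rep D) \<in> quot perp line"
    using calculation by (simp add: quot_def)
  ultimately show "coset line (adj A *v rep D) \<in> quot perp line \<and>
    (\<forall>C\<in>quot perp line. q_form form (q_endo line ((*v) A) C) D = q_form form C (coset line (adj A *v rep D)))"
    by (simp add: main) (simp add: q_form_def form_rep_coset(2)[OF repV])
  fix D'
  assume D': "D' \<in> quot perp line \<and>
    (\<forall>C\<in>quot perp line. q_form form (q_endo line ((*v) A) C) D = q_form form C D')"
  have "form y (rep D' - adj A *v rep D) = 0" if y: "y \<in> perp" for y
  proof -
    have C: "coset line y \<in> quot perp line" using y by (simp add: quot_def)
    with D' have "form (rep (coset line y)) (adj A *v rep D) = form (rep (coset line y)) (rep D')"
      using main by (simp add: q_form_def)
    then show ?thesis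
      using repV D' \<open>adj A *v rep D \<in> perp\<close> by (simp add: form_rep_coset form_simps)
  qed
  from perp_perp[OF this] show "D' = coset line (adj A *v rep D)"
    using D' coset_rep[OF subspace_line, of D' perp] coset_eq_iff[OF subspace_line] by metis
qed

lemma induces_q_alt:
  assumes "tame A"
  shows "induces ((1/2) *\<^sub>R A - (1/2) *\<^sub>R adj A) 0 (q_alt perp line (q_form form) (q_endo line ((*v) A)))"
proof -
  have "tame ((1/2) *\<^sub>R A + (-1/2) *\<^sub>R adj A)"
    by (intro tame_linear tame_adj assms)
  moreover have "q_alt perp line (q_form form) (q_endo line ((*v) A)) C =
      coset line (((1/2) *\<^sub>R A - (1/2) *\<^sub>R adj A) *v rep C)" if "C \<in> quot perp line" for C
    unfolding q_alt_def
    by (subst q_lin2_coset[OF subspace_line, where x = "A *v rep C" and y = "adj A *v rep C"])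
      (simp_all add: q_adjoint_eq[OF assms that] q_endo_def matrix_vector_mult_diff_rdistrib
        flip: scaleR_matrix_vector_assoc)
  ultimately show ?thesis by (simp add: induces_def)
qed

lemma induces_q_sym0:
  assumes "tame A"
  shows "induces ((1/2) *\<^sub>R A + (1/2) *\<^sub>R adj A) (- (trace A / d))
    (q_sym0 perp line (q_form form) d (q_endo line ((*v) A)))"
proof -
  have "tame ((1/2) *\<^sub>R A + (1/2) *\<^sub>R adj A)"
    by (intro tame_linear tame_adj assms)
  moreover have "q_sym0 perp line (q_form form) d (q_endo line ((*v) A)) C =
      coset line (((1/2) *\<^sub>R A + (1/2) *\<^sub>R adj A) *v rep C + (- (trace A / d)) *\<^sub>R rep C)"
    if "C \<in> quot perp line" for C
  proof -
    have *: "q_sym perp line (q_form form) (q_endo line ((*v) A)) C =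
        coset line ((1/2) *\<^sub>R (A *v rep C) + (1/2) *\<^sub>R (adj A *v rep C))"
      unfolding q_sym_def
      by (rule q_lin2_coset[OF subspace_line]) (simp_all add: q_adjoint_eq[OF assms that] q_endo_def)
    have **: "id C = coset line (rep C)"
      using coset_rep[OF subspace_line that] by simp
    show ?thesis
      unfolding q_sym0_def
      by (subst q_lin2_coset[where E = "q_sym perp line (q_form form) (q_endo line ((*v) A))" and E' = id and C = C,
            OF subspace_line * **])
        (simp add: q_trace_induces[OF induces_q_endo[OF assms]]
          matrix_vector_mult_add_rdistrib flip: scaleR_matrix_vector_assoc)
  qed
  ultimately show ?thesis by (simp add: induces_def)
qed

lemma q_trace_decomposition:
  assumes A: "tame A" and n: "CARD('n) \<noteq> 2"
  defines "P \<equiv> q_endo line ((*v) A)" and "d \<equiv> real CARD('n) - 2"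
  defines "\<rho> \<equiv> q_alt perp line (q_form form) P" and "\<sigma> \<equiv> q_sym0 perp line (q_form form) d P"
  shows "q_trace perp line (\<rho> \<circ> \<rho>) + q_trace perp line (\<sigma> \<circ> \<sigma>) + (trace A)\<^sup>2 / d = trace (A ** A)"
proof -
  have d: "d \<noteq> 0" using n by (simp add: d_def)
  let ?R = "(1/2) *\<^sub>R A - (1/2) *\<^sub>R adj A" and ?Q = "(1/2) *\<^sub>R A + (1/2) *\<^sub>R adj A" and ?c = "- (trace A / d)"
  have "q_trace perp line (\<rho> \<circ> \<rho>) = trace (?R ** ?R)"
    using q_trace_induces[OF induces_comp[OF induces_q_alt[OF A]]] by (simp add: \<rho>_def P_def)
  moreover have "q_trace perp line (\<sigma> \<circ> \<sigma>) = trace (?Q ** ?Q) + 2 * ?c * trace ?Q + ?c * ?c * d"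
    using q_trace_induces[OF induces_comp[OF induces_q_sym0[OF A, of d]]]
    by (simp add: \<sigma>_def P_def d_def trace_add trace_sub trace_scaleR)
  moreover have "trace ?Q = trace A"
    by (simp add: trace_add trace_scaleR trace_adj)
  \<comment> \<open>Removing the trace part from the symmetric part costs \<open>-2\<close> times
    the square of the trace over \<open>d\<close> from the mixed term and returns \<open>+1\<close>
    from the squared scalar.\<close>
  moreover have "2 * ?c * trace A + ?c * ?c * d = - (trace A)\<^sup>2 / d"
    using d by (simp add: field_simps power2_eq_square)
  moreover have "trace (?R ** ?R) + trace (?Q ** ?Q) = trace (A ** A)"
  proof -
    have "trace (?R ** ?R) + trace (?Q ** ?Q) = trace (?R ** ?R + ?Q ** ?Q)"
      by (simp add: trace_add)
    also have "?R ** ?R + ?Q ** ?Q = (1/2) *\<^sub>R (A ** A) + (1/2) *\<^sub>R (adj A ** adj A)"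
      by (rule matrix_polarization)
    finally show ?thesis
      by (simp add: trace_add trace_scaleR trace_adj adj_mult)
  qed
  ultimately show ?thesis by simp
qed

end

section \<open>Sections tangent to the spray\<close>

text \<open>A section in one chart. The assumptions make \<open>snd (f x)\<close> nonzero and null
  for the metric and, through \<open>spray_tangent\<close>, make the spray related to a field on the
  base.\<close>

locale spray_section = homogeneous_function F m \<Omega>
  for F :: "'n::finite pt \<Rightarrow> real" and m \<Omega> +
  fixes D :: "(real ^ 'n) set" and f :: "real ^ 'n \<Rightarrow> 'n pt"
  assumes open_D: "open D" and smooth_f: "smooth_on D f"
    and fst_f: "\<And>x. x \<in> D \<Longrightarrow> fst (f x) = x"
    and f_in: "\<And>x. x \<in> D \<Longrightarrow> f x \<in> \<Omega>"
    and F_f: "\<And>x. x \<in> D \<Longrightarrow> F (f x) = 0"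
    and snd_f: "\<And>x. x \<in> D \<Longrightarrow> snd (f x) \<noteq> 0"
    and spray_tangent: "\<And>x. x \<in> D \<Longrightarrow> spray F m (f x) \<in> range (dirder f x)"
begin

definition k :: "real ^ 'n \<Rightarrow> real ^ 'n" where "k x = snd (f x)"

lemma smooth_k: "smooth_on D k"
  unfolding k_def[abs_def] by (rule smooth_on_linear_compose[OF open_D bounded_linear_snd smooth_f])

lemma has_derivative_k: "x \<in> D \<Longrightarrow> (k has_derivative dirder k x) (at x)"
  by (rule smooth_on_has_derivative[OF smooth_k])

lemma has_derivative_f: "x \<in> D \<Longrightarrow> (f has_derivative dirder f x) (at x)"
  by (rule smooth_on_has_derivative[OF smooth_f])

lemma dirder_f:
  assumes "x \<in> D"
  shows "dirder f x X = (X, dirder k x X)"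
proof -
  have "((\<lambda>x. (x, k x)) has_derivative (\<lambda>X. (X, dirder k x X))) (at x)"
    by (auto intro!: derivative_eq_intros has_derivative_k assms)
  moreover have "(x, k x) = f x" if "x \<in> D" for x
    using fst_f[OF that] by (simp add: k_def prod_eq_iff)
  ultimately have "(f has_derivative (\<lambda>X. (X, dirder k x X))) (at x)"
    using has_derivative_transform_within_open[OF _ open_D assms] by blast
  then show ?thesis by (rule dirder_eq)
qed

lemma linear_dk: "x \<in> D \<Longrightarrow> linear (dirder k x)"
  using has_derivative_k has_derivative_linear by blast

text \<open>Comparing base components identifies the preimage of the spray as \<open>k x\<close>.
  The fibre components then say that integral curves of \<open>k\<close> satisfy the second-order
  equation of the spray.\<close>

lemma spray_f:
  assumes "x \<in> D"
  shows "spray F m (f x) = dirder f x (k x)" "u (f x) = dirder k x (k x)"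
proof -
  obtain X where "spray F m (f x) = dirder f x X" using spray_tangent[OF assms] by blast
  then have "(k x, u (f x)) = (X, dirder k x X)"
    using spray_eq[OF f_in[OF assms]] dirder_f[OF assms] by (simp add: k_def)
  then show "u (f x) = dirder k x (k x)" "spray F m (f x) = dirder f x (k x)"
    using spray_eq[OF f_in[OF assms]] dirder_f[OF assms] by (simp_all add: k_def)
qed

lemma assoc_field_eq: "x \<in> D \<Longrightarrow> assoc_field F m f x = k x"
  unfolding assoc_field_def by (rule the_equality) (auto simp: spray_f dirder_f)

lemma g_s_eq: "x \<in> D \<Longrightarrow> g_s F f x X Y = g (f x) X Y"
  by (simp add: g_s_def g_h_eq f_in dirder_f)

abbreviation \<Gamma> :: "real ^ 'n \<Rightarrow> real ^ 'n ^ 'n" where "\<Gamma> x \<equiv> fibre_hessian F (f x)"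

text \<open>The vertical projection applied to \<open>(X, dirder k x X)\<close>. It is the covariant
  derivative of \<open>k\<close> along \<open>X\<close> for the nonlinear connection with
  coefficients \<open>-1/2\<close> times the fibre derivative of \<open>u\<close>.\<close>

definition L :: "real ^ 'n \<Rightarrow> real ^ 'n \<Rightarrow> real ^ 'n" where
  "L x X = dirder k x X - (1/2) *\<^sub>R du (f x) (0, X)"

definition B :: "real ^ 'n \<Rightarrow> real ^ 'n ^ 'n" where
  "B x = matrix (L x)"

lemma linear_du: "z \<in> \<Omega> \<Longrightarrow> linear (du z)"
  using has_derivative_u has_derivative_linear by blast

lemma B_mult: "x \<in> D \<Longrightarrow> B x *v X = L x X"
proof -
  assume x: "x \<in> D"
  have "linear (\<lambda>X. du (f x) (0, X))"
    using linear_compose[OF linear_Pair_0(1) linear_du[OF f_in[OF x]]] by (simp add: o_def)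
  then have "linear (L x)"
    unfolding L_def[abs_def] by (intro linear_compose_sub linear_dk[OF x] linear_compose_scale_right)
  then show ?thesis unfolding B_def by (rule matrix_vector_mul(2)[THEN fun_cong])
qed

lemma P_s_eq:
  assumes "x \<in> D"
  shows "P_s F m f x = (*v) (B x)"
proof
  fix X
  have "inj lam_bar" by (auto simp: lam_bar_def inj_on_def)
  then have "inv lam_bar (0, y) = y" for y :: "real ^ 'n"
    using inv_f_f[of lam_bar y] by (simp add: lam_bar_def)
  then show "P_s F m f x X = B x *v X"
    by (simp add: P_s_def vert_proj_eq[OF f_in[OF assms]] dirder_f[OF assms] B_mult[OF assms] L_def)
qed

lemma g_\<Gamma>: "x \<in> D \<Longrightarrow> g (f x) X Y = X \<bullet> (\<Gamma> x *v Y)"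
  by (rule g_matrix[OF f_in])

lemma null_vector_k:
  assumes "x \<in> D"
  shows "null_vector (\<Gamma> x) (k x)"
proof
  note z = f_in[OF assms]
  show "transpose (\<Gamma> x) = \<Gamma> x"
    by (simp add: vec_eq_iff transpose_def fibre_hessian_nth) (intro allI g_sym[OF z])
  show "invertible (\<Gamma> x)"
    using nondegenerate[OF z] by (simp add: invertible_det_nz)
  have "g (f x) (k x) (k x) = (m - 1) * (m * F (f x))"
    using g_snd[OF z] euler[OF z] by (simp add: k_def)
  then show "k x \<bullet> (\<Gamma> x *v k x) = 0"
    by (simp add: g_\<Gamma>[OF assms] F_f[OF assms])
  show "k x \<noteq> 0" using snd_f[OF assms] by (simp add: k_def)
qed

lemma form_eq: "x \<in> D \<Longrightarrow> null_vector.form (\<Gamma> x) X Y = g (f x) X Y"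
  by (simp add: null_vector.form_def[OF null_vector_k] g_\<Gamma>)

text \<open>That \<open>k\<close> is killed follows from \<open>u (f x) = dirder k x (k x)\<close>
  and the degree 2 homogeneity of \<open>u\<close>. For the image, contracting with \<open>k\<close>
  turns both parts of \<open>L x X\<close> into derivatives of \<open>F\<close> via
  \<open>g_snd\<close> and \<open>g_snd_du\<close>; their sum is the derivative of \<open>F\<close>
  along the section, where \<open>F\<close> vanishes.\<close>

lemma tame_B:
  assumes "x \<in> D"
  shows "null_vector.tame (\<Gamma> x) (k x) (B x)"
proof -
  interpret nv: null_vector "\<Gamma> x" "k x" by (rule null_vector_k[OF assms])
  note z = f_in[OF assms]
  have "L x (k x) = 0"
    using du_homogeneous[OF z] spray_f(2)[OF assms] by (simp add: L_def k_def)
  moreover have "g (f x) (k x) (L x X) = 0" for X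
  proof -
    have "((\<lambda>y. F (f y)) has_derivative (\<lambda>X. dirder F (f x) (dirder f x X))) (at x)"
      by (rule has_derivative_compose[OF has_derivative_f[OF assms] smooth_on_has_derivative[OF smooth z]])
    moreover have "((\<lambda>y. F (f y)) has_derivative (\<lambda>X. 0)) (at x)"
      by (rule has_derivative_transform_within_open[OF has_derivative_const open_D assms, of 0])
        (simp add: F_f)
    ultimately have "dirder F (f x) (dirder f x X) = 0"
      by (rule has_derivative_unique[THEN fun_cong])
    then have F0: "dirder F (f x) (X, 0) + dirder F (f x) (0, dirder k x X) = 0"
      using linear_add[OF linear_D1[OF z], of "(X, 0)" "(0, dirder k x X)"]
      by (simp add: dirder_f[OF assms])
    have "g (f x) (k x) (dirder k x X) = (m - 1) * dirder F (f x) (0, dirder k x X)"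
      using g_snd[OF z] by (simp add: k_def)
    moreover have "g (f x) (k x) (du (f x) (0, X)) = - (2 * (m - 1)) * dirder F (f x) (X, 0)"
      using g_snd_du[OF z] by (simp add: k_def)
    ultimately have "g (f x) (k x) (L x X)
        = (m - 1) * (dirder F (f x) (X, 0) + dirder F (f x) (0, dirder k x X))"
      by (simp add: L_def bilinear_rsub[OF bilinear_g[OF z]] bilinear_rmul[OF bilinear_g[OF z]]) (simp add: field_simps)
    then show ?thesis by (simp only: F0 mult_zero_right)
  qed
  ultimately show ?thesis
    by (simp add: nv.tame_def nv.perp_def B_mult[OF assms] form_eq[OF assms])
qed

lemma k_perp_eq: "x \<in> D \<Longrightarrow> k_perp F m f x = null_vector.perp (\<Gamma> x) (k x)"
  by (simp add: k_perp_def assoc_field_eq g_s_eq null_vector.perp_def[OF null_vector_k] form_eq)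

lemma k_span_eq: "x \<in> D \<Longrightarrow> k_span F m f x = null_vector.line (k x)"
  by (simp add: k_span_def assoc_field_eq null_vector.line_def[OF null_vector_k])

lemma g_K_eq: "x \<in> D \<Longrightarrow> g_K F f x = q_form (null_vector.form (\<Gamma> x))"
  by (simp add: g_K_def q_form_def[abs_def] g_s_eq form_eq)

lemma expansion_eq:
  assumes "x \<in> D"
  shows "expansion F m f x = trace (B x)"
proof -
  interpret nv: null_vector "\<Gamma> x" "k x" by (rule null_vector_k[OF assms])
  show ?thesis
    using nv.q_trace_induces[OF nv.induces_q_endo[OF tame_B[OF assms]]]
    by (simp add: expansion_def tr_K_def P_K_def k_perp_eq k_span_eq P_s_eq assms)
qed

lemma rot_shear_eq:
  assumes "x \<in> D" "CARD('n) \<noteq> 2"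
  shows "tr_K F m f x (rot F m f x \<circ> rot F m f x) + tr_K F m f x (shear F m f x \<circ> shear F m f x)
    + (expansion F m f x)\<^sup>2 / (real CARD('n) - 2) = trace (B x ** B x)"
proof -
  interpret nv: null_vector "\<Gamma> x" "k x" by (rule null_vector_k[OF assms(1)])
  show ?thesis
    using nv.q_trace_decomposition[OF tame_B[OF assms(1)] assms(2)]
    by (simp add: expansion_eq tr_K_def rot_def shear_def P_K_def k_perp_eq k_span_eq P_s_eq g_K_eq assms)
qed

section \<open>Lie derivatives along the spray, pulled back to the base\<close>

definition H :: "real ^ 'n \<Rightarrow> real ^ 'n \<Rightarrow> real ^ 'n \<Rightarrow> real" where
  "H x X Y = g (f x) (L x X) Y + g (f x) X (L x Y)"

lemma lie_form_g_h_section: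
  "x \<in> D \<Longrightarrow> lie_form (spray F m) (g_h F) (f x) (dirder f x X) (dirder f x Y) = H x X Y"
  by (simp add: lie_form_g_h[OF f_in] H_def L_def dirder_f)

lemma differentiable_spray: "z \<in> \<Omega> \<Longrightarrow> spray F m differentiable (at z)"
  unfolding differentiable_def using has_derivative_spray by blast

lemma f_image: "f ` D \<subseteq> \<Omega>"
  using f_in by auto

lemma differentiable_k: "x \<in> D \<Longrightarrow> k differentiable (at x)"
  using has_derivative_k by (auto simp: differentiable_def)

text \<open>Pulling back the first Lie derivative identifies \<open>H\<close> as the Lie derivative
  of \<open>g_s\<close> along \<open>k\<close>. This allows derivatives of the components of
  \<open>g_s\<close> along \<open>k\<close> to be eliminated in favour of \<open>L\<close>.\<close>

lemma lie_form_g: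
  assumes "x \<in> D"
  shows "lie_form k (\<lambda>y. g (f y)) x X Y = H x X Y"
proof -
  have bil: "bilinear (g_h F z)" if "z \<in> \<Omega>" for z
    using bilinear_compose[OF bilinear_g[OF that] linear_fst linear_fst]
    by (simp add: g_h_eq[OF that, abs_def])
  have diff: "(\<lambda>z. g_h F z X Y) differentiable (at (f x))" for X Y
    by (subst differentiable_cong_open[OF open_\<Omega> f_in[OF assms], where g = "\<lambda>z. D2 z (0, fst X) (0, fst Y)"])
      (auto simp: g_h_eq g_def intro: smooth_on_differentiable[OF smooth_D2 f_in[OF assms]])
  have "H x X Y = lie_form k (\<lambda>y X Y. g_h F (f y) (dirder f y X) (dirder f y Y)) x X Y"
    unfolding lie_form_g_h_section[OF assms, symmetric]
    by (rule lie_form_pullback[OF open_D assms smooth_f open_\<Omega> f_image bil diff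
          differentiable_spray[OF f_in[OF assms]] differentiable_k[OF assms] spray_f(1)])
  also have "\<dots> = lie_form k (\<lambda>y. g (f y)) x X Y"
    by (rule lie_form_cong[OF open_D assms]) (simp add: g_h_eq[OF f_in] dirder_f)
  finally show ?thesis ..
qed

text \<open>Naturality is applied a second time, to the first Lie derivative. For this the latter
  must be a bilinear form throughout \<open>\<Omega>\<close> and differentiable at
  \<open>f x\<close> in all directions, not merely known along the section.\<close>

lemma lie_form_lie_form_g_h:
  assumes "x \<in> D"
  shows "lie_form (spray F m) (lie_form (spray F m) (g_h F)) (f x) (dirder f x X) (dirder f x Y) =
    lie_form k H x X Y"
proof -
  note z = f_in[OF assms]
  define Q where "Q = (\<lambda>z X. snd X - (1/2) *\<^sub>R du z (0, fst X))"
  have lie: "lie_form (spray F m) (g_h F) z X Y = g z (Q z X) (fst Y) + g z (fst X) (Q z Y)"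
    if "z \<in> \<Omega>" for z X Y
    by (simp add: lie_form_g_h[OF that] Q_def)
  have bil: "bilinear (lie_form (spray F m) (g_h F) z)" if "z \<in> \<Omega>" for z
  proof -
    have "linear (\<lambda>X::'n pt. (0::real ^ 'n, fst X))" by (auto intro!: linearI)
    from linear_compose[OF this linear_du[OF that]]
    have lQ: "linear (Q z)"
      unfolding Q_def o_def by (intro linear_compose_sub linear_snd linear_compose_scale_right)
    have b1: "bilinear (\<lambda>X Y. g z (Q z X) (fst Y))" "bilinear (\<lambda>X Y. g z (fst X) (Q z Y))"
      using bilinear_compose[OF bilinear_g[OF that]] lQ linear_fst by blast+
    have "lie_form (spray F m) (g_h F) z = (\<lambda>X Y. g z (Q z X) (fst Y) + g z (fst X) (Q z Y))"
      by (intro ext lie that)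
    then show ?thesis
      unfolding bilinear_def
      by (simp only:) (intro conjI allI linear_compose_add b1[unfolded bilinear_def, THEN conjunct1, rule_format]
          b1[unfolded bilinear_def, THEN conjunct2, rule_format])
  qed
  have diff: "(\<lambda>z. lie_form (spray F m) (g_h F) z X Y) differentiable (at (f x))" for X Y
  proof -
    \<comment> \<open>\<open>Q\<close> is carried as a vertical vector because \<open>g z\<close> is
      \<open>D2 z\<close> on vertical vectors, for which a product rule is at hand.\<close>
    have "(\<lambda>z. (0::real ^ 'n, Q z X)) differentiable (at (f x))" for X
    proof -
      have "((\<lambda>z. (0::real ^ 'n, Q z X)) has_derivative
          (\<lambda>t. (0, 0 - (1/2) *\<^sub>R dirder (\<lambda>z. du z (0, fst X)) (f x) t))) (at (f x))"
        unfolding Q_def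
        by (intro has_derivative_Pair has_derivative_const has_derivative_diff has_derivative_scaleR_right
            smooth_on_has_derivative[OF smooth_on_dirder[OF smooth_u] z])
      then show ?thesis by (auto simp: differentiable_def)
    qed
    then obtain q1 q2 where q: "((\<lambda>z. (0::real ^ 'n, Q z X)) has_derivative q1) (at (f x))"
        "((\<lambda>z. (0::real ^ 'n, Q z Y)) has_derivative q2) (at (f x))"
      unfolding differentiable_def by blast
    from has_derivative_add[OF has_derivative_D2_field[OF z q(1) has_derivative_const, of "(0, fst Y)"]
        has_derivative_D2_field[OF z has_derivative_const q(2), of "(0, fst X)"]]
    have "(\<lambda>z. g z (Q z X) (fst Y) + g z (fst X) (Q z Y)) differentiable (at (f x))"
      unfolding g_def differentiable_def by blast
    then show ?thesis
      by (subst differentiable_cong_open[OF open_\<Omega> z]) (auto simp: lie)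
  qed
  have "lie_form (spray F m) (lie_form (spray F m) (g_h F)) (f x) (dirder f x X) (dirder f x Y) =
    lie_form k (\<lambda>y X Y. lie_form (spray F m) (g_h F) (f y) (dirder f y X) (dirder f y Y)) x X Y"
    by (rule lie_form_pullback[OF open_D assms smooth_f open_\<Omega> f_image bil diff
          differentiable_spray[OF z] differentiable_k[OF assms] spray_f(1)])
  also have "\<dots> = lie_form k H x X Y"
    by (rule lie_form_cong[OF open_D assms]) (rule lie_form_g_h_section)
  finally show ?thesis .
qed

lemma differentiable_L:
  assumes "x \<in> D"
  shows "(\<lambda>y. L y X) differentiable (at x)"
proof -
  have "(\<lambda>y. dirder k y X) differentiable (at x)"
    by (rule smooth_on_differentiable[OF smooth_on_dirder[OF smooth_k] assms])
  moreover have "(\<lambda>y. du (f y) (0, X)) differentiable (at x)"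
    using has_derivative_compose[OF has_derivative_f[OF assms]
        smooth_on_has_derivative[OF smooth_on_dirder[OF smooth_u] f_in[OF assms]]]
    by (auto simp: differentiable_def)
  ultimately show ?thesis
    unfolding L_def by (intro differentiable_diff differentiable_scaleR differentiable_const)
qed

lemma has_derivative_B:
  assumes "x \<in> D"
  shows "(B has_derivative dirder B x) (at x)"
proof (rule has_derivative_dirder)
  have "(\<lambda>y. B y \<bullet> b) differentiable (at x)" if bB: "b \<in> Basis" for b
  proof -
    obtain i j where b: "b = axis i (axis j 1)"
      using bB by (auto simp: Basis_vec_def)
    have "(\<lambda>y. B y \<bullet> b) = (\<lambda>y. L y (axis j 1) $ i)"
      by (simp add: b inner_axis B_def matrix_def)
    moreover obtain L' where "((\<lambda>y. L y (axis j 1)) has_derivative L') (at x)"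
      using differentiable_L[OF assms] unfolding differentiable_def by blast
    from bounded_linear.has_derivative[OF bounded_linear_vec_nth this]
    have "(\<lambda>y. L y (axis j 1) $ i) differentiable (at x)"
      unfolding differentiable_def by blast
    ultimately show ?thesis by simp
  qed
  then have "(\<lambda>y. \<Sum>b\<in>Basis. (B y \<bullet> b) *\<^sub>R b) differentiable (at x)"
    by (intro differentiable_sum differentiable_scaleR differentiable_const) auto
  then show "B differentiable (at x)"
    by (simp add: euclidean_representation)
qed

lemma has_derivative_L:
  assumes "x \<in> D"
  shows "((\<lambda>y. L y X) has_derivative (\<lambda>t. dirder B x t *v X)) (at x)"
proof -
  have "bounded_linear (\<lambda>M::real ^ 'n ^ 'n. M *v X)"
    by (auto simp: linear_conv_bounded_linear[symmetric] matrix_vector_mult_add_rdistrib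
        scaleR_matrix_vector_assoc intro!: linearI)
  from bounded_linear.has_derivative[OF this has_derivative_B[OF assms]]
  show ?thesis
    by (rule has_derivative_transform_within_open[OF _ open_D assms]) (rule B_mult)
qed

definition K :: "real ^ 'n \<Rightarrow> real ^ 'n ^ 'n" where
  "K x = matrix (dirder k x)"

text \<open>\<open>E\<close> is \<open>P_s\<^sup>2\<close> plus the Lie derivative of \<open>P_s\<close> along \<open>k\<close>.\<close>

definition E :: "real ^ 'n \<Rightarrow> real ^ 'n ^ 'n" where
  "E x = dirder B x (k x) + B x ** B x - K x ** B x + B x ** K x"

text \<open>Differentiating \<open>H\<close> along \<open>k\<close> differentiates the metric and
  \<open>L\<close>. Replacing the derivative of the metric by \<open>G'\<close> yields
  \<open>g (f x) (L x X) (L x Y)\<close> twice; halving leaves one copy, which the definition of the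
  tidal tensor subtracts. The products of \<open>L\<close> with the Jacobian of \<open>k\<close> in
  opposite slots cancel against \<open>H x (K X) Y\<close> and its mirror image.\<close>

lemma tidal_eq:
  assumes "x \<in> D"
  shows "tidal F m (f x) (dirder f x X) (dirder f x Y) =
    1/2 * (g (f x) (E x *v X) Y + g (f x) X (E x *v Y))"
proof -
  note z = f_in[OF assms]
  note b = bilinear_g[OF z]
  let ?g = "g (f x)" and ?K = "dirder k x" and ?L = "L x" and ?B' = "dirder B x (k x)"
  have diff_g: "(\<lambda>y. g (f y) X Y) differentiable (at x)" for X Y
    using has_derivative_compose[OF has_derivative_f[OF assms] has_derivative_D2[OF z]]
    unfolding g_def differentiable_def by blast
  define G' where "G' = (\<lambda>X Y. dirder (\<lambda>y. g (f y) X Y) x (k x))"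
  \<comment> \<open>The formula for the Lie derivative of \<open>g_s\<close>, solved for the
    derivative of its components along \<open>k\<close>.\<close>
  have G': "G' X Y = ?g (?L X) Y + ?g X (?L Y) - ?g (?K X) Y - ?g X (?K Y)" for X Y
    using lie_form_g[OF assms, of X Y]
    by (simp add: lie_form_def lie_bracket_const G'_def H_def bilinear_lneg[OF b] bilinear_rneg[OF b])
  have H1: "((\<lambda>y. g (f y) (L y X) Y) has_derivative
      (\<lambda>t. dirder (\<lambda>y. g (f y) (?L X) Y) x t + ?g (dirder B x t *v X) Y + ?g (?L X) 0)) (at x)" for X Y
    by (rule has_derivative_bilinear_field[OF open_D assms bilinear_g[OF f_in] diff_g
          has_derivative_L[OF assms] has_derivative_const])
  have H2: "((\<lambda>y. g (f y) X (L y Y)) has_derivative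
      (\<lambda>t. dirder (\<lambda>y. g (f y) X (?L Y)) x t + ?g 0 (?L Y) + ?g X (dirder B x t *v Y))) (at x)" for X Y
    by (rule has_derivative_bilinear_field[OF open_D assms bilinear_g[OF f_in] diff_g
          has_derivative_const has_derivative_L[OF assms]])
  have dH: "dirder (\<lambda>y. H y X Y) x (k x) =
    G' (?L X) Y + ?g (?B' *v X) Y + G' X (?L Y) + ?g X (?B' *v Y)"
    unfolding H_def dirder_eq[OF has_derivative_add[OF H1 H2]]
    by (simp add: G'_def bilinear_lzero[OF b] bilinear_rzero[OF b])
  have negH: "H x (- X) Y = - H x X Y" "H x X (- Y) = - H x X Y" for X Y
  proof -
    have "L x (- X) = - L x X" for X
      using B_mult[OF assms, of X] B_mult[OF assms, of "- X"]
      by (metis matrix_vector_mul_linear linear_neg)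
    then show "H x (- X) Y = - H x X Y" "H x X (- Y) = - H x X Y"
      by (simp_all add: H_def bilinear_lneg[OF b] bilinear_rneg[OF b])
  qed
  have EX: "E x *v X = ?B' *v X + ?L (?L X) - ?K (?L X) + ?L (?K X)" for X
    by (simp add: E_def matrix_vector_mult_add_rdistrib matrix_vector_mult_diff_rdistrib
        B_mult[OF assms] K_def matrix_vector_mul(2)[OF linear_dk[OF assms], THEN fun_cong] flip: matrix_vector_mul_assoc)
  have "tidal F m (f x) (dirder f x X) (dirder f x Y) = 1/2 * lie_form k H x X Y - ?g (?L X) (?L Y)"
    unfolding tidal_def lie_form_lie_form_g_h[OF assms]
    by (simp add: g_v_eq[OF z] vert_proj_eq[OF z] dirder_f[OF assms] L_def)
  also have "lie_form k H x X Y = G' (?L X) Y + ?g (?B' *v X) Y + G' X (?L Y) + ?g X (?B' *v Y)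
      + H x (?K X) Y + H x X (?K Y)"
    by (simp add: lie_form_def lie_bracket_const negH dH)
  finally show ?thesis
    unfolding G' EX H_def
    by (simp add: bilinear_ladd[OF b] bilinear_radd[OF b] bilinear_lsub[OF b] bilinear_rsub[OF b]
        add_divide_distrib diff_divide_distrib)
qed

text \<open>By \<open>tidal_eq\<close> the endomorphism is the self-adjoint part of
  \<open>E x\<close>, and an adjoint has the same trace. Of the four terms of \<open>E x\<close> the
  two containing \<open>K x\<close> form a commutator and drop out of the trace.\<close>

lemma trace_S_sharp:
  assumes "x \<in> D"
  shows "trace (matrix (S_sharp F m f x)) = trace (dirder B x (k x)) + trace (B x ** B x)"
proof -
  interpret nv: null_vector "\<Gamma> x" "k x" by (rule null_vector_k[OF assms])
  let ?S = "(1/2) *\<^sub>R E x + (1/2) *\<^sub>R nv.adj (E x)"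
  have S: "nv.form (?S *v X) Y = tidal F m (f x) (dirder f x X) (dirder f x Y)" for X Y
    using nv.form_adj[of "E x" Y X] nv.form_sym[of "nv.adj (E x) *v X" Y] nv.form_sym[of "E x *v Y" X]
    by (simp add: tidal_eq[OF assms] form_eq[OF assms, symmetric] matrix_vector_mult_add_rdistrib nv.form_simps
        flip: scaleR_matrix_vector_assoc)
  have "S_sharp F m f x X = ?S *v X" for X
    unfolding S_sharp_def g_s_eq[OF assms] form_eq[OF assms, symmetric]
  proof (rule the_equality)
    show "\<forall>Y. nv.form (?S *v X) Y = tidal F m (f x) (dirder f x X) (dirder f x Y)"
      using S by blast
    fix Z assume "\<forall>Y. nv.form Z Y = tidal F m (f x) (dirder f x X) (dirder f x Y)"
    then have "nv.form Y (Z - ?S *v X) = 0" for Y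
      using S by (simp add: nv.form_sym[of Y] nv.form_simps)
    from nv.form_nondegenerate[OF this] show "Z = ?S *v X" by simp
  qed
  then have "S_sharp F m f x = (*v) ?S" by blast
  then have "trace (matrix (S_sharp F m f x)) = trace (E x)"
    by (simp add: trace_scaleR trace_add nv.trace_adj)
  also have "\<dots> = trace (dirder B x (k x)) + trace (B x ** B x)"
    by (simp add: E_def trace_add trace_sub trace_mul_sym[of "K x"])
  finally show ?thesis .
qed

lemma derivative_expansion:
  assumes "x \<in> D"
  shows "dirder (expansion F m f) x X = trace (dirder B x X)"
proof -
  have "bounded_linear (trace :: real ^ 'n ^ 'n \<Rightarrow> real)"
    by (auto simp: linear_conv_bounded_linear[symmetric] trace_add trace_def sum.distrib
       sum_distrib_left intro!: linearI)
  from bounded_linear.has_derivative[OF this has_derivative_B[OF assms]]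
  have "dirder (\<lambda>y. trace (B y)) x X = trace (dirder B x X)"
    by (rule dirder_eq)
  moreover have "dirder (expansion F m f) x = dirder (\<lambda>y. trace (B y)) x"
    by (rule dirder_cong[OF open_D assms]) (rule expansion_eq)
  ultimately show ?thesis by simp
qed

lemma raychaudhuri:
  assumes "x \<in> D" "CARD('n) \<noteq> 2"
  shows "dirder (expansion F m f) x (assoc_field F m f x) =
    - tr_K F m f x (rot F m f x \<circ> rot F m f x) - tr_K F m f x (shear F m f x \<circ> shear F m f x)
    - (expansion F m f x)\<^sup>2 / (real CARD('n) - 2) + trace (matrix (S_sharp F m f x))"
  using rot_shear_eq[OF assms] trace_S_sharp[OF assms(1)] derivative_expansion[OF assms(1)]
  by (simp add: assoc_field_eq[OF assms(1)])

end

section \<open>Sachs sections\<close>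

text \<open>The straightened curve stays in the subspace \<open>L\<close> near 0, so its product
  with any normal of \<open>L\<close> is constant there and its velocity is orthogonal to all
  normals. A subspace equals its double orthogonal complement.\<close>

lemma curve_in_slice:
  fixes \<phi> :: "'a::euclidean_space \<Rightarrow> 'a"
  assumes \<phi>: "open U" "z \<in> U" "\<phi> differentiable (at z)"
    and L: "subspace L" "\<phi> ` (S \<inter> U) \<subseteq> L"
    and c: "(c has_vector_derivative w) (at 0)" "c 0 = z" "\<forall>\<^sub>F t in nhds (0::real). c t \<in> S"
  shows "dirder \<phi> z w \<in> L"
proof -
  have dc: "(c has_derivative (\<lambda>t. t *\<^sub>R w)) (at 0)"
    using c(1) by (simp add: has_vector_derivative_def)
  have "(c \<longlongrightarrow> c 0) (nhds 0)"
    using has_derivative_continuous[OF dc] by (simp add: continuous_at tendsto_at_iff_tendsto_nhds)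
  then have "\<forall>\<^sub>F t in nhds 0. c t \<in> U"
    using \<phi>(1,2) c(2) by (auto dest: topological_tendstoD)
  with c(3) have ev: "\<forall>\<^sub>F t in nhds 0. \<phi> (c t) \<in> L"
    by eventually_elim (use L(2) in auto)
  then have "\<phi> (c 0) \<in> L" by (rule eventually_nhds_x_imp_x)
  have "n \<bullet> dirder \<phi> z w = 0" if n: "\<And>y. y \<in> L \<Longrightarrow> n \<bullet> y = 0" for n
  proof -
    have "((\<lambda>t. n \<bullet> \<phi> (c t)) has_derivative (\<lambda>t. n \<bullet> dirder \<phi> z (t *\<^sub>R w))) (at 0)"
      using has_derivative_compose[OF dc, of \<phi> "dirder \<phi> z"] has_derivative_dirder[OF \<phi>(3)] c(2)
      by (intro has_derivative_inner_right) simp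
    moreover have "((\<lambda>t. n \<bullet> \<phi> (c t)) has_derivative (\<lambda>t. 0)) (at 0)"
    proof (rule has_derivative_transform_eventually[OF has_derivative_const])
      show "\<forall>\<^sub>F t in at 0. 0 = n \<bullet> \<phi> (c t)"
        unfolding eventually_at_filter using ev by eventually_elim (simp add: n)
    qed (use n \<open>\<phi> (c 0) \<in> L\<close> in auto)
    ultimately have "n \<bullet> dirder \<phi> z (1 *\<^sub>R w) = 0"
      by (rule has_derivative_unique[THEN fun_cong])
    then show ?thesis by simp
  qed
  then have "dirder \<phi> z w \<in> orthogonal_comp (orthogonal_comp L)"
    by (auto simp: orthogonal_comp_def orthogonal_def inner_commute)
  then show ?thesis by (simp add: orthogonal_comp_self[OF L(1)])
qed

text \<open>In a slice chart both the tangent vectors and the image of the derivative of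
  \<open>f\<close> land in \<open>L\<close>. The latter image has full dimension by injectivity, so
  it exhausts \<open>L\<close>; injectivity of the derivative of the slice chart carries this
  back.\<close>

lemma tangent_space_subset_range:
  fixes f :: "'b::euclidean_space \<Rightarrow> 'a::euclidean_space"
  assumes S: "submanifold DIM('b) S" and D: "open D" "x \<in> D" "f ` D \<subseteq> S"
    and f: "f differentiable (at x)" "inj (dirder f x)"
  shows "tangent_space S (f x) \<subseteq> range (dirder f x)"
proof
  fix w assume "w \<in> tangent_space S (f x)"
  then obtain e c where c: "e > 0" "c ` {-e<..<e} \<subseteq> S" "c 0 = f x" "(c has_vector_derivative w) (at 0)"
    unfolding tangent_space_def by auto
  have "f x \<in> S" using D by auto
  then obtain U \<phi> L where U: "f x \<in> U" "diffeomorphic_on U \<phi>" "subspace L" "dim L = DIM('b)"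
      "\<phi> ` (S \<inter> U) = \<phi> ` U \<inter> L"
    using S unfolding submanifold_def by meson
  have op: "open U" "open (\<phi> ` U)" "inj_on \<phi> U" "smooth_on U \<phi>" "smooth_on (\<phi> ` U) (inv_into U \<phi>)"
    using U(2) by (auto simp: diffeomorphic_on_def)
  let ?\<psi> = "dirder \<phi> (f x)"
  have \<phi>': "(\<phi> has_derivative ?\<psi>) (at (f x))"
    by (rule smooth_on_has_derivative[OF op(4) U(1)])
  have lin: "linear ?\<psi>" "linear (dirder f x)"
    using \<phi>' has_derivative_linear linear_frechet_derivative[OF f(1)] by blast+
  have slice: "\<phi> ` (S \<inter> U) \<subseteq> L" using U(5) by blast
  have "inj ?\<psi>"
  proof -
    have "((\<lambda>z. inv_into U \<phi> (\<phi> z)) has_derivative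
        (\<lambda>w. dirder (inv_into U \<phi>) (\<phi> (f x)) (?\<psi> w))) (at (f x))"
      using U(1) by (intro has_derivative_compose[OF \<phi>'] smooth_on_has_derivative[OF op(5)]) auto
    moreover have "((\<lambda>z. inv_into U \<phi> (\<phi> z)) has_derivative (\<lambda>w. w)) (at (f x))"
      by (rule has_derivative_transform_within_open[OF has_derivative_ident op(1) U(1)])
        (simp add: inv_into_f_f[OF op(3)])
    ultimately have "dirder (inv_into U \<phi>) (\<phi> (f x)) (?\<psi> w) = w" for w
      by (rule has_derivative_unique[THEN fun_cong])
    then show ?thesis by (metis injI)
  qed
  have "?\<psi> w \<in> L"
  proof (rule curve_in_slice[OF op(1) U(1) _ U(3) slice c(4) c(3)])
    show "\<phi> differentiable (at (f x))" using \<phi>' by (auto simp: differentiable_def)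
    have "\<forall>\<^sub>F t in nhds 0. t \<in> {-e<..<e}"
      using c(1) by (intro eventually_nhds_in_open) auto
    then show "\<forall>\<^sub>F t in nhds 0. c t \<in> S"
      by eventually_elim (use c(2) in auto)
  qed
  moreover have "(?\<psi> \<circ> dirder f x) ` UNIV = L"
  proof (rule subspace_dim_equal)
    show "subspace ((?\<psi> \<circ> dirder f x) ` UNIV)"
      by (intro linear_subspace_image linear_compose lin subspace_UNIV)
    have "dim ((?\<psi> \<circ> dirder f x) ` UNIV) = DIM('b)"
      using dim_image_eq[OF linear_compose[OF lin(2,1)], of UNIV] inj_compose[OF \<open>inj ?\<psi>\<close> f(2)]
      by (simp add: dim_UNIV)
    then show "dim L \<le> dim ((?\<psi> \<circ> dirder f x) ` UNIV)" using U(4) by simp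
    show "(?\<psi> \<circ> dirder f x) ` UNIV \<subseteq> L"
    proof clarify
      fix \<xi>
      have x0: "f x = f (x + 0 *\<^sub>R \<xi>)" by simp
      have "((\<lambda>t. f (x + t *\<^sub>R \<xi>)) has_derivative (\<lambda>t. dirder f x (t *\<^sub>R \<xi>))) (at 0)"
        by (rule has_derivative_compose[where f = "\<lambda>t. x + t *\<^sub>R \<xi>" and g = f])
          (use has_derivative_dirder[OF f(1)] in \<open>auto intro!: derivative_eq_intros\<close>)
      then have d: "((\<lambda>t. f (x + t *\<^sub>R \<xi>)) has_vector_derivative dirder f x \<xi>) (at 0)"
        by (simp add: has_vector_derivative_def linear_cmul[OF lin(2)])
      have "((\<lambda>t. x + t *\<^sub>R \<xi>) \<longlongrightarrow> x + 0 *\<^sub>R \<xi>) (nhds 0)"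
        by (intro tendsto_intros filterlim_ident)
      then have "\<forall>\<^sub>F t in nhds 0. x + t *\<^sub>R \<xi> \<in> D"
        using D(1,2) by (auto dest: topological_tendstoD)
      then have ev: "\<forall>\<^sub>F t in nhds 0. f (x + t *\<^sub>R \<xi>) \<in> S"
        by eventually_elim (use D(3) in auto)
      have "\<phi> differentiable (at (f x))" using \<phi>' by (auto simp: differentiable_def)
      from curve_in_slice[OF op(1) U(1) this U(3) slice d x0[symmetric] ev]
      show "(?\<psi> \<circ> dirder f x) \<xi> \<in> L" by simp
    qed
  qed (rule U(3))
  ultimately obtain \<xi> where "?\<psi> w = ?\<psi> (dirder f x \<xi>)" by auto
  with \<open>inj ?\<psi>\<close> show "w \<in> range (dirder f x)" by (auto dest: injD)
qed

section \<open>From the manifold to a single chart\<close>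

locale manifold_chart =
  fixes M :: "'a topology" and A :: "('a, 'n::finite) chart set" and c :: "('a, 'n) chart"
  assumes manifold: "smooth_manifold M A" and c_in: "c \<in> A"
begin

lemma openin_chart: "d \<in> A \<Longrightarrow> openin M (fst d)"
  using manifold by (auto simp: smooth_manifold_def is_chart_def)

lemma open_chart_image: "open (chart_image c)"
  using manifold c_in by (auto simp: smooth_manifold_def is_chart_def)

lemma inj_chart: "inj_on (snd c) (fst c)"
proof -
  have "homeomorphic_map (subtopology M (fst c)) (top_of_set (chart_image c)) (snd c)"
    using manifold c_in by (auto simp: smooth_manifold_def is_chart_def)
  then have "inj_on (snd c) (topspace (subtopology M (fst c)))"
    by (simp add: homeomorphic_eq_everything_map)
  then show ?thesis
    using openin_subset[OF openin_chart[OF c_in]] by (simp add: Int_absorb1)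
qed

lemma chart_inv_in: "x \<in> chart_image c \<Longrightarrow> chart_inv c x \<in> fst c"
  by (simp add: chart_inv_def inv_into_into)

lemma chart_chart_inv: "x \<in> chart_image c \<Longrightarrow> snd c (chart_inv c x) = x"
  by (simp add: chart_inv_def f_inv_into_f)

lemma chart_inv_chart: "p \<in> fst c \<Longrightarrow> chart_inv c (snd c p) = p"
  by (simp add: chart_inv_def inv_into_f_f[OF inj_chart])

lemma chart_inv_topspace: "x \<in> chart_image c \<Longrightarrow> chart_inv c x \<in> topspace M"
  using chart_inv_in openin_subset[OF openin_chart[OF c_in]] by blast

lemma linear_transition:
  assumes "x \<in> chart_image c" "d \<in> A" "chart_inv c x \<in> fst d"
  shows "linear (dirder (transition c d) x)"
proof -
  have "smooth_on (snd c ` (fst c \<inter> fst d)) (transition c d)"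
    using manifold c_in assms(2) by (auto simp: smooth_manifold_def)
  moreover have "x \<in> snd c ` (fst c \<inter> fst d)"
    using chart_inv_in[OF assms(1)] chart_chart_inv[OF assms(1)] assms(3) by force
  ultimately show ?thesis
    using linear_frechet_derivative smooth_on_differentiable by blast
qed

lemma tb_point_scale:
  "x \<in> chart_image c \<Longrightarrow> tb_point A c (x, t *\<^sub>R v) = scale_tvector t (tb_point A c (x, v))"
  using linear_cmul[OF linear_transition] by (auto simp: tb_point_def scale_tvector_def Let_def)

text \<open>The component in \<open>c\<close> determines the components in all other charts around
  the point by the transition rule, and the convention that the remaining entries are zero fixes the
  rest.\<close>

lemma tb_point_tb_coord:
  assumes "z \<in> tangent_bundle M A" "fst z \<in> fst c"
  shows "tb_point A c (tb_coord c z) = z"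
proof -
  obtain p \<xi> where z: "z = (p, \<xi>)" by fastforce
  note bundle_z = assms(1)[unfolded z tangent_bundle_def mem_Collect_eq case_prod_conv]
  note trans = bundle_z[THEN conjunct2, THEN conjunct1]
    and zero = bundle_z[THEN conjunct2, THEN conjunct2]
  have "(if d \<in> A \<and> p \<in> fst d then dirder (transition c d) (snd c p) (\<xi> c) else 0) = \<xi> d" for d
  proof (cases "d \<in> A \<and> p \<in> fst d")
    case True
    then have "\<xi> d = dirder (transition c d) (snd c p) (\<xi> c)"
      by (intro trans[rule_format, OF c_in]) (use assms(2) z in auto)
    with True show ?thesis by (simp only: if_True simp_thms)
  next
    case False
    then have "\<xi> d = 0" by (rule zero[rule_format])
    with False show ?thesis by (simp only: if_False)
  qed
  then show ?thesis
    using assms(2) by (simp add: z tb_coord_def tb_point_def Let_def chart_inv_chart)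
qed

lemma homogeneous_function_local_G:
  assumes "null_hypersurface M A W G m H"
  shows "homogeneous_function (local_G A G c) m (tb_set A c W)"
proof
  have op: "openin (tb_topology M A) W"
    and sm: "\<forall>c\<in>A. smooth_on (tb_set A c W) (local_G A G c)"
    and nd: "\<forall>c\<in>A. \<forall>z\<in>tb_set A c W. det (fibre_hessian (local_G A G c) z) \<noteq> 0"
    and hom: "\<forall>z\<in>W. \<forall>t>0. G (scale_tvector t z) = t powr m * G z"
    using assms unfolding null_hypersurface_def by blast+
  show "m \<noteq> 1"
    using assms by (simp add: null_hypersurface_def)
  show "open (tb_set A c W)"
    using op c_in by (simp add: openin_tb_topology)
  show smooth: "smooth_on (tb_set A c W) (local_G A G c)"
    using sm c_in by blast
  show "det (fibre_hessian (local_G A G c) z) \<noteq> 0" if "z \<in> tb_set A c W" for z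
    using nd c_in that by blast
  show "dirder (local_G A G c) z (0, snd z) = m * local_G A G c z" if z: "z \<in> tb_set A c W" for z
  proof -
    let ?F = "local_G A G c"
    obtain x v where xv: "z = (x, v)" by fastforce
    have x: "x \<in> chart_image c" "tb_point A c (x, v) \<in> W"
      using z by (auto simp: tb_set_def xv)
    have F: "?F (x, t *\<^sub>R v) = t powr m * ?F (x, v)" if "t > 0" for t
      using hom x(2) that by (simp add: local_G_def tb_point_scale[OF x(1)])
    have "((\<lambda>t. ?F (x, t *\<^sub>R v)) has_derivative (\<lambda>t. dirder ?F z (0, t *\<^sub>R v))) (at 1)"
      by (rule has_derivative_compose[where f = "\<lambda>t. (x, t *\<^sub>R v)" and g = ?F])
        (use smooth_on_has_derivative[OF smooth z] in \<open>auto simp: xv intro!: derivative_eq_intros\<close>)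
    \<comment> \<open>Euler's equation is the derivative of the scaling law at \<open>t = 1\<close>,
      computed here from the power and above by the chain rule.\<close>
    moreover have "((\<lambda>t. ?F (x, t *\<^sub>R v)) has_derivative (\<lambda>t. m * t * ?F (x, v))) (at 1)"
    proof -
      have "((\<lambda>t. t powr m) has_real_derivative m * 1 powr (m - 1)) (at 1)"
        by (rule has_real_derivative_powr) simp
      then have "((\<lambda>t. t powr m * ?F (x, v)) has_derivative (\<lambda>t. m * t * ?F (x, v))) (at 1)"
        unfolding has_field_derivative_def by (auto intro!: derivative_eq_intros)
      then show ?thesis
        by (rule has_derivative_transform_within_open[OF _ open_greaterThan[of 0]]) (auto simp: F)
    qed
    ultimately have "dirder ?F z (0, 1 *\<^sub>R v) = m * 1 * ?F (x, v)"
      by (rule has_derivative_unique[THEN fun_cong])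
    then show ?thesis by (simp add: xv)
  qed
qed

lemma spray_section_local_section:
  assumes hyp: "null_hypersurface M A W G m H" and T: "affine_sachs_manifold M A G m H T"
    and s: "sachs_section M A T s"
  shows "spray_section (local_G A G c) m (tb_set A c W) (chart_image c) (local_section s c)"
proof -
  interpret F: homogeneous_function "local_G A G c" m "tb_set A c W"
    by (rule homogeneous_function_local_G[OF hyp])
  let ?f = "local_section s c"
  have subs: "T \<subseteq> H" "H = {z \<in> W. G z = 0}" "W \<subseteq> slit_tangent_bundle M A"
    using hyp T by (auto simp: null_hypersurface_def affine_sachs_manifold_def)
  have W_sub: "W \<subseteq> tangent_bundle M A"
    using subs(3) by (auto simp: slit_tangent_bundle_def)
  have smooth: "smooth_on (chart_image c) ?f"
    using s c_in by (simp add: sachs_section_def)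
  have sp: "s (chart_inv c x) \<in> T" "fst (s (chart_inv c x)) = chart_inv c x" if "x \<in> chart_image c" for x
    using s chart_inv_topspace[OF that] by (auto simp: sachs_section_def)
  have fst_f: "fst (?f x) = x" if "x \<in> chart_image c" for x
    by (simp add: local_section_def tb_coord_def sp[OF that] chart_chart_inv[OF that])
  have tb: "tb_point A c (?f x) = s (chart_inv c x)" if "x \<in> chart_image c" for x
    unfolding local_section_def
    by (rule tb_point_tb_coord) (use sp[OF that] subs W_sub chart_inv_in[OF that] in auto)
  have fT: "?f x \<in> tb_set A c T" if "x \<in> chart_image c" for x
    using fst_f[OF that] tb[OF that] sp[OF that] that by (auto simp: tb_set_def mem_Times_iff)
  have fW: "?f x \<in> tb_set A c W" if "x \<in> chart_image c" for x
    using fT[OF that] subs by (auto simp: tb_set_def)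
  show ?thesis
  proof
    show "open (chart_image c)" by (rule open_chart_image)
    show "smooth_on (chart_image c) ?f" by (rule smooth)
    fix x assume x: "x \<in> chart_image c"
    show "fst (?f x) = x" by (rule fst_f[OF x])
    show "?f x \<in> tb_set A c W" by (rule fW[OF x])
    show "local_G A G c (?f x) = 0"
      using sp[OF x] subs by (auto simp: local_G_def tb[OF x])
    show "snd (?f x) \<noteq> 0"
    proof
      assume "snd (?f x) = 0"
      \<comment> \<open>A zero fibre coordinate would, by Euler's relation and \<open>m\<close>
        different from 1, annihilate all fibre derivatives of G, against the hypothesis that DG does
        not vanish.\<close>
      then have "dirder (local_G A G c) (?f x) (0, \<xi>) = 0" for \<xi>
        using F.g_snd[OF fW[OF x], of \<xi>] bilinear_lzero[OF F.bilinear_g[OF fW[OF x]]] F.m_neq_1 by simp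
      then have "Dv (local_G A G c) (?f x) X = 0" for X
        by (simp add: F.Dv_eq[OF fW[OF x]])
      moreover have "\<forall>c\<in>A. \<forall>z\<in>tb_set A c W. \<exists>X. Dv (local_G A G c) z X \<noteq> 0"
        using hyp by (simp add: null_hypersurface_def)
      ultimately show False using c_in fW[OF x] by blast
    qed
    \<comment> \<open>The base projection is a left inverse of a section, hence its derivative is
      one of the derivative of the section.\<close>
    have "inj (dirder ?f x)"
    proof -
      have "((\<lambda>y. fst (?f y)) has_derivative (\<lambda>X. fst (dirder ?f x X))) (at x)"
        by (rule bounded_linear.has_derivative[OF bounded_linear_fst smooth_on_has_derivative[OF smooth x]])
      moreover have "((\<lambda>y. fst (?f y)) has_derivative (\<lambda>X. X)) (at x)"
        by (rule has_derivative_transform_within_open[OF has_derivative_ident open_chart_image x])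
          (simp add: fst_f)
      ultimately have "fst (dirder ?f x X) = X" for X
        by (rule has_derivative_unique[THEN fun_cong])
      then show ?thesis by (metis injI)
    qed
    moreover have "submanifold DIM(real ^ 'n) (tb_set A c T)"
      using T c_in by (simp add: affine_sachs_manifold_def)
    moreover have "?f ` chart_image c \<subseteq> tb_set A c T"
      using fT by blast
    ultimately have "tangent_space (tb_set A c T) (?f x) \<subseteq> range (dirder ?f x)"
      by (intro tangent_space_subset_range[OF _ open_chart_image x] smooth_on_differentiable[OF smooth x])
    moreover have "spray (local_G A G c) m (?f x) \<in> tangent_space (tb_set A c T) (?f x)"
      using T c_in fT[OF x] by (simp add: affine_sachs_manifold_def)
    ultimately show "spray (local_G A G c) m (?f x) \<in> range (dirder ?f x)"
      by blast
  qed
qed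

end

theorem theorem8:
  fixes M :: "'a topology" and A :: "('a, 'n::finite) chart set"
    and W H T :: "('a, 'n) tvector set" and G :: "('a, 'n) tvector \<Rightarrow> real" and m :: real
    and s :: "'a \<Rightarrow> ('a, 'n) tvector" and p q :: nat
  assumes dim: "CARD('n) \<ge> 3"
    and manifold: "smooth_manifold M A"
    and hypersurface: "null_hypersurface M A W G m H"
    and sachs: "affine_sachs_manifold M A G m H T"
    and sec: "sachs_section M A T s"
    and signature: "\<And>c x. c \<in> A \<Longrightarrow> x \<in> chart_image c \<Longrightarrow>
      has_signature (g_s (local_G A G c) (local_section s c) x) p q"
  shows "\<forall>c\<in>A. \<forall>x\<in>chart_image c.
    (let F = local_G A G c; f = local_section s c;
         k = assoc_field F m f; \<theta> = expansion F m f;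
         \<rho> = rot F m f x; \<sigma> = shear F m f x
     in dirder \<theta> x (k x) =
          - tr_K F m f x (\<rho> \<circ> \<rho>) - tr_K F m f x (\<sigma> \<circ> \<sigma>)
          - (\<theta> x)\<^sup>2 / (real CARD('n) - 2)
          + trace (matrix (S_sharp F m f x)))"
  unfolding Let_def
proof (intro ballI)
  fix c x assume c: "c \<in> A" and x: "x \<in> chart_image c"
  interpret manifold_chart M A c
    using manifold c by unfold_locales
  interpret spray_section "local_G A G c" m "tb_set A c W" "chart_image c" "local_section s c"
    by (rule spray_section_local_section[OF hypersurface sachs sec])
  show "dirder (expansion (local_G A G c) m (local_section s c)) x
      (assoc_field (local_G A G c) m (local_section s c) x) =
    - tr_K (local_G A G c) m (local_section s c) x
        (rot (local_G A G c) m (local_section s c) x \<circ> rot (local_G A G c) m (local_section s c) x)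
    - tr_K (local_G A G c) m (local_section s c) x
        (shear (local_G A G c) m (local_section s c) x \<circ> shear (local_G A G c) m (local_section s c) x)
    - (expansion (local_G A G c) m (local_section s c) x)\<^sup>2 / (real CARD('n) - 2)
    + trace (matrix (S_sharp (local_G A G c) m (local_section s c) x))"
    \<comment> \<open>The dimension bound keeps \<open>n - 2\<close>, the dimension of K, away from
      zero.\<close>
    using dim by (intro raychaudhuri x) simp
qed

end
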